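(* Let $\phi\in C[-\alpha,0]$, let $(X(t):\,t\ge -\alpha)$ be the solution of the stochastic delay equation $$dX(t)=F(X_t)\,dt+G(X_t)\,dW(t)\quad (t\ge 0),\qquad X(u)=\phi(u)\quad (u\in[-\alpha,0]),$$ let $x=x(\cdot,\phi)$ be the solution of the deterministic equation $\dot x(t)=F(x_t)$ for $t\ge 0$, $x_0=\phi$, and let $r$ be the fundamental solution of this deterministic equation. Assume $r\in L^2(\mathbb{R}_+)$ and write $$\|G(r_\bullet)\|_{L^2(\mathbb{R}_+)}=\left(\int_0^\infty (G(r_s))^2\,ds\right)^{1/2}.$$ Then the following trichotomy holds: (a) if $\|G(r_\bullet)\|_{L^2(\mathbb{R}_+)}<1$, then there exists $\kappa>0$ such that $$\lim_{t\to\infty}e^{\kappa t}E|X(t)|^2=0;$$ (b) if $\|G(r_\bullet)\|_{L^2(\mathbb{R}_+)}=1$, then $$\lim_{t\to\infty}E|X(t)|^2=\frac{\left(\int_0^\infty G^2(x_s)\,ds\right)\left(\int_0^\infty r^2(s)\,ds\right)}{\int_0^\infty s\,G^2(r_s)\,ds}<\infty;$$ (c) if $\|G(r_\bullet)\|_{L^2(\mathbb{R}_+)}>1$, then there exists $\kappa>0$ such that $$\lim_{t\to\infty}e^{-\kappa t}E|X(t)|^2=\frac{\left(\int_0^\infty e^{-\kappa s}G^2(x_s)\,ds\right)\left(\int_0^\infty e^{-\kappa s}r^2(s)\,ds\right)}{\int_0^\infty s\,e^{-\kappa s}G^2(r_s)\,ds}<\infty.$$ Here $G^2(\cdot)=(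G(\cdot))^2$.
   Context: Fix $\alpha\ge 0$. $C[-\alpha,0]$ is the space of continuous functions $[-\alpha,0]\to\mathbb{R}$ with the supremum norm. $F$ and $G$ are continuous linear functionals on $C[-\alpha,0]$, given by finite signed Borel measures $\mu,\nu$ on $[-\alpha,0]$: $$F(\psi)=\int_{[-\alpha,0]}\psi(u)\,\mu(du),\qquad G(\psi)=\int_{[-\alpha,0]}\psi(u)\,\nu(du).$$ For a function $z$ on $[-\alpha,\infty)$ and $t\ge 0$, the segment $z_t:[-\alpha,0]\to\mathbb{R}$ is $z_t(u)=z(t+u)$. $\mathbb{R}_+=[0,\infty)$. $(\Omega,\mathcal{F},P)$ is a complete probability space with a filtration $(\mathcal{F}_t)_{t\ge 0}$ satisfying the usual conditions and $W$ is a Wiener process on it. For every (deterministic) $\phi\in C[-\alpha,0]$ the stochastic equation has a unique adapted strong solution $X=X(\cdot,\phi)$ with finite second moments. The deterministic equation has, for every $\phi\in C[-\alpha,0]$, a unique solution $x=x(\cdot,\phi)$, meaning a continuous function on $[-\alpha,\infty)$, continuously differentiable on $[0,\infty)$, satisfying $\dot x(t)=F(x_t)$ for all $t\ge 0$ and $x(t)=\phi(t)$ for $t\in[-\alpha,0]$. The fundamental solution $r:[0,\infty)\to\mathbb{R}$ is the unique locally absolutely continuous function with $$r(t)=1+\int_0^t\int_{[\max\{-\alpha,-s\},0]} r(s+u)\,\mu(du)\,ds,\quad t\ge 0,$$ extended by $r(u)=0$ for $u\in[-\alpha,0)$. The quantity $G(r_t)$ is understood as $\int_{[-\alpha,0]}r(t+u)\,\nu(du)$;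 the function $s\mapsto G(r_s)$ is square integrable on $\mathbb{R}_+$ when $r\in L^2(\mathbb{R}_+)$. *)

theory Defs
  imports "HOL-Probability.Probability"
begin

section \<open>Continuous linear functionals on $C[-\alpha,0]$\<close>

text \<open>
  A finite signed Borel measure on \<open>[-\<alpha>, 0]\<close> is represented by a pair of finite (positive) Borel
  measures on \<open>[-\<alpha>, 0]\<close> and stands for their difference. By the Jordan decomposition every finite
  signed measure is of this form. The two parts need not be mutually singular; integrals of
  functions that are integrable for both parts do not depend on the chosen representation.
\<close>

type_synonym signed_measure = "real measure \<times> real measure"

definition signed_borel_measure_on :: "real set \<Rightarrow> signed_measure \<Rightarrow> bool" where
  "signed_borel_measure_on S \<mu> \<longleftrightarrow>
     finite_measure (fst \<mu>) \<and> sets (fst \<mu>) = sets (restrict_space borel S) \<and>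
     finite_measure (snd \<mu>) \<and> sets (snd \<mu>) = sets (restrict_space borel S)"

definition signed_integral :: "signed_measure \<Rightarrow> (real \<Rightarrow> real) \<Rightarrow> real" where
  "signed_integral \<mu> \<psi> = (\<integral>u. \<psi> u \<partial>fst \<mu>) - (\<integral>u. \<psi> u \<partial>snd \<mu>)"

text \<open>
  The segment \<open>z\<^sub>t\<close>. It is a function on all of \<open>\<real>\<close>, but a signed measure on \<open>[-\<alpha>, 0]\<close> only
  sees its values there.
\<close>

definition segment :: "(real \<Rightarrow> real) \<Rightarrow> real \<Rightarrow> real \<Rightarrow> real" where
  "segment z t u = z (t + u)"

section \<open>The deterministic delay equation\<close>

definition dde_solution ::
  "real \<Rightarrow> signed_measure \<Rightarrow> (real \<Rightarrow> real) \<Rightarrow> (real \<Rightarrow> real) \<Rightarrow> bool" where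
  "dde_solution \<alpha> \<mu> \<phi> x \<longleftrightarrow>
     continuous_on {-\<alpha>..} x \<and>
     (\<forall>t\<ge>0. (x has_real_derivative signed_integral \<mu> (segment x t)) (at t within {0..})) \<and>
     continuous_on {0..} (\<lambda>t. signed_integral \<mu> (segment x t)) \<and>
     (\<forall>u\<in>{-\<alpha>..0}. x u = \<phi> u)"

definition absolutely_continuous_on_interval :: "real \<Rightarrow> real \<Rightarrow> (real \<Rightarrow> real) \<Rightarrow> bool" where
  "absolutely_continuous_on_interval c d f \<longleftrightarrow>
     (\<forall>\<epsilon>>0. \<exists>\<delta>>0. \<forall>(n::nat) a b.
        (\<forall>i<n. c \<le> a i \<and> a i \<le> b i \<and> b i \<le> d) \<and>
        (\<forall>i<n. \<forall>j<n. i \<noteq> j \<longrightarrow> {a i<..<b i} \<inter> {a j<..<b j} = {}) \<and>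
        (\<Sum>i<n. b i - a i) < \<delta>
        \<longrightarrow> (\<Sum>i<n. \<bar>f (b i) - f (a i)\<bar>) < \<epsilon>)"

definition fundamental_solution ::
  "real \<Rightarrow> signed_measure \<Rightarrow> (real \<Rightarrow> real) \<Rightarrow> bool" where
  "fundamental_solution \<alpha> \<mu> r \<longleftrightarrow>
     (\<forall>T\<ge>0. absolutely_continuous_on_interval 0 T r) \<and>
     (\<forall>t\<ge>0. r t = 1 + (LINT s:{0..t}|lborel.
        signed_integral \<mu> (\<lambda>u. indicator {max (-\<alpha>) (-s)..0} u * r (s + u)))) \<and>
     (\<forall>u\<in>{-\<alpha>..<0}. r u = 0)"

section \<open>Filtrations and Wiener processes\<close>

text \<open>
  A \<sigma>-algebra of a filtration is given as a measure, of which only the measurable sets matter.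
  Only the indices \<open>t \<ge> 0\<close> are relevant.
\<close>

definition usual_filtration :: "'a measure \<Rightarrow> (real \<Rightarrow> 'a measure) \<Rightarrow> bool" where
  "usual_filtration M Fil \<longleftrightarrow>
     (\<forall>t\<ge>0. subalgebra M (Fil t)) \<and>
     (\<forall>s t. 0 \<le> s \<and> s \<le> t \<longrightarrow> sets (Fil s) \<subseteq> sets (Fil t)) \<and>
     (\<forall>t\<ge>0. sets (Fil t) = (\<Inter>u\<in>{t<..}. sets (Fil u))) \<and>
     null_sets M \<subseteq> sets (Fil 0)"

definition wiener_process ::
  "'a measure \<Rightarrow> (real \<Rightarrow> 'a measure) \<Rightarrow> (real \<Rightarrow> 'a \<Rightarrow> real) \<Rightarrow> bool" where
  "wiener_process M Fil W \<longleftrightarrow>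
     (\<forall>t\<ge>0. W t \<in> borel_measurable (Fil t)) \<and>
     (AE \<omega> in M. W 0 \<omega> = 0) \<and>
     (AE \<omega> in M. continuous_on {0..} (\<lambda>t. W t \<omega>)) \<and>
     (\<forall>s t. 0 \<le> s \<and> s < t \<longrightarrow>
        distributed M lborel (\<lambda>\<omega>. W t \<omega> - W s \<omega>) (normal_density 0 (sqrt (t - s))) \<and>
        prob_space.indep_set M (sets (Fil s))
          (sets (vimage_algebra (space M) (\<lambda>\<omega>. W t \<omega> - W s \<omega>) borel)))"

section \<open>The Ito integral\<close>

text \<open>
  A triple \<open>n\<close>, \<open>\<tau>\<close>, \<open>\<xi>\<close> encodes the simple process that equals \<open>\<xi> i\<close> on the interval
  \<open>(\<tau> i, \<tau> (i + 1)]\<close> for \<open>i < n\<close> and vanishes elsewhere.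
\<close>

definition simple_integrand ::
  "'a measure \<Rightarrow> (real \<Rightarrow> 'a measure) \<Rightarrow> real \<Rightarrow> nat \<Rightarrow> (nat \<Rightarrow> real) \<Rightarrow> (nat \<Rightarrow> 'a \<Rightarrow> real) \<Rightarrow> bool"
where
  "simple_integrand M Fil t n \<tau> \<xi> \<longleftrightarrow>
     (\<forall>i\<le>n. 0 \<le> \<tau> i \<and> \<tau> i \<le> t) \<and> (\<forall>i<n. \<tau> i \<le> \<tau> (Suc i)) \<and>
     (\<forall>i<n. \<xi> i \<in> borel_measurable (Fil (\<tau> i)) \<and> (\<exists>C. \<forall>\<omega>\<in>space M. \<bar>\<xi> i \<omega>\<bar> \<le> C))"

definition simple_process ::
  "nat \<Rightarrow> (nat \<Rightarrow> real) \<Rightarrow> (nat \<Rightarrow> 'a \<Rightarrow> real) \<Rightarrow> real \<Rightarrow> 'a \<Rightarrow> real" where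
  "simple_process n \<tau> \<xi> s \<omega> = (\<Sum>i<n. \<xi> i \<omega> * indicator {\<tau> i<..\<tau> (Suc i)} s)"

definition simple_ito_integral ::
  "(real \<Rightarrow> 'a \<Rightarrow> real) \<Rightarrow> nat \<Rightarrow> (nat \<Rightarrow> real) \<Rightarrow> (nat \<Rightarrow> 'a \<Rightarrow> real) \<Rightarrow> 'a \<Rightarrow> real" where
  "simple_ito_integral W n \<tau> \<xi> \<omega> = (\<Sum>i<n. \<xi> i \<omega> * (W (\<tau> (Suc i)) \<omega> - W (\<tau> i) \<omega>))"

text \<open>
  Jointly measurable adapted processes with square integrable values with respect to the product
  of \<open>P\<close> and the Lebesgue measure on \<open>[0, t]\<close>.
\<close>

definition ito_integrand ::
  "'a measure \<Rightarrow> (real \<Rightarrow> 'a measure) \<Rightarrow> real \<Rightarrow> (real \<Rightarrow> 'a \<Rightarrow> real) \<Rightarrow> bool" where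
  "ito_integrand M Fil t H \<longleftrightarrow>
     (\<lambda>(s, \<omega>). H s \<omega>) \<in> borel_measurable (restrict_space borel {0..t} \<Otimes>\<^sub>M M) \<and>
     (\<forall>s\<in>{0..t}. H s \<in> borel_measurable (Fil s)) \<and>
     (\<integral>\<^sup>+\<omega>. (\<integral>\<^sup>+s\<in>{0..t}. ennreal ((H s \<omega>)\<^sup>2) \<partial>lborel) \<partial>M) < \<infinity>"

text \<open>
  The random variable \<open>J\<close> is (a version of) the Ito integral of \<open>H\<close> with respect to \<open>W\<close> over
  \<open>[0, t]\<close>: it is the mean square limit of the integrals of simple processes approximating \<open>H\<close>.
  By the Ito isometry, \<open>J\<close> is unique up to null sets, and any sequence of this kind yields it.
\<close>

definition has_ito_integral ::
  "'a measure \<Rightarrow> (real \<Rightarrow> 'a measure) \<Rightarrow> (real \<Rightarrow> 'a \<Rightarrow> real) \<Rightarrow> real \<Rightarrow>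
   (real \<Rightarrow> 'a \<Rightarrow> real) \<Rightarrow> ('a \<Rightarrow> real) \<Rightarrow> bool" where
  "has_ito_integral M Fil W t H J \<longleftrightarrow>
     ito_integrand M Fil t H \<and> J \<in> borel_measurable M \<and>
     (\<exists>n \<tau> \<xi>. (\<forall>k::nat. simple_integrand M Fil t (n k) (\<tau> k) (\<xi> k)) \<and>
        (\<lambda>k. \<integral>\<^sup>+\<omega>. (\<integral>\<^sup>+s\<in>{0..t}.
           ennreal ((simple_process (n k) (\<tau> k) (\<xi> k) s \<omega> - H s \<omega>)\<^sup>2) \<partial>lborel) \<partial>M)
          \<longlonglongrightarrow> 0 \<and>
        (\<lambda>k. \<integral>\<^sup>+\<omega>. ennreal ((simple_ito_integral W (n k) (\<tau> k) (\<xi> k) \<omega> - J \<omega>)\<^sup>2) \<partial>M)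
          \<longlonglongrightarrow> 0)"

section \<open>The stochastic delay equation\<close>

text \<open>
  A continuous adapted process with finite second moments that satisfies, almost surely for each
  \<open>t \<ge> 0\<close>, the integrated form of
  $dX(t) = F(X_t)\,dt + G(X_t)\,dW(t)$ with \<open>F\<close>, \<open>G\<close> given by \<open>\<mu>\<close>, \<open>\<nu>\<close>.
\<close>

definition sdde_solution ::
  "'a measure \<Rightarrow> (real \<Rightarrow> 'a measure) \<Rightarrow> (real \<Rightarrow> 'a \<Rightarrow> real) \<Rightarrow> real \<Rightarrow>
   signed_measure \<Rightarrow> signed_measure \<Rightarrow> (real \<Rightarrow> real) \<Rightarrow> (real \<Rightarrow> 'a \<Rightarrow> real) \<Rightarrow> bool" where
  "sdde_solution M Fil W \<alpha> \<mu> \<nu> \<phi> X \<longleftrightarrow>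
     (\<forall>\<omega>\<in>space M. continuous_on {-\<alpha>..} (\<lambda>t. X t \<omega>)) \<and>
     (\<forall>t\<ge>0. X t \<in> borel_measurable (Fil t)) \<and>
     (\<forall>t\<ge>0. integrable M (\<lambda>\<omega>. (X t \<omega>)\<^sup>2)) \<and>
     (AE \<omega> in M. \<forall>u\<in>{-\<alpha>..0}. X u \<omega> = \<phi> u) \<and>
     (\<forall>t\<ge>0. \<exists>J.
        has_ito_integral M Fil W t
          (\<lambda>s \<omega>. signed_integral \<nu> (segment (\<lambda>v. X v \<omega>) s)) J \<and>
        (AE \<omega> in M. X t \<omega> = \<phi> 0
           + (LINT s:{0..t}|lborel. signed_integral \<mu> (segment (\<lambda>v. X v \<omega>) s)) + J \<omega>))"

end

theory Submission
  imports Defs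
begin

text \<open>
  The difference \<open>X - x\<close> solves the deterministic delay equation driven, path by path, by the continuous
  martingale \<open>N t = \<integral>\<^sub>0\<^sup>t G(X\<^sub>s) dW(s)\<close>, so variation of constants expresses it through \<open>N\<close> and the fundamental
  solution \<open>r\<close> without any stochastic Fubini theorem. The Ito isometry identifies \<open>N\<close> with the family of
  indicators of \<open>[0, t]\<close> in \<open>L\<^sup>2(y dv)\<close>, where \<open>y v = E G(X\<^sub>v)\<^sup>2\<close>; pushing the linear operations through this
  isometry gives \<open>E X(t)\<^sup>2 = x(t)\<^sup>2 + (r\<^sup>2 * y)(t)\<close> and the renewal equation \<open>y = G(x)\<^sup>2 + G(r)\<^sup>2 * y\<close>.

  The semigroup property of the delay equation turns \<open>r \<in> L\<^sup>2\<close> into exponential decay of \<open>r\<close> and \<open>x\<close>. The three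
  cases are then those of a defective, proper and excessive renewal equation with exponentially decaying
  data. In the proper case, along times where \<open>y\<close> approaches its upper limit \<open>L\<close> the renewal equation forces
  \<open>y\<close> to be close to \<open>L\<close> on the whole distant past, and the conserved quantity
  \<open>\<integral>\<^sub>0\<^sup>t (\<integral>\<^sub>s\<^sup>\<infinity> k) y(t - s) ds = \<integral>\<^sub>0\<^sup>t f\<close> of \<open>y = f + k * y\<close> determines \<open>L\<close>; the same holds for the lower limit.
\<close>

section \<open>Convolution of causal functions\<close>

text \<open>Functions on [0, \<infinity>) are extended by zero and convolved on the whole line.
  Causal functions then form a commutative algebra in which a delay functional can be moved from one
  factor to the other, so variation of constants and the conserved quantity become algebra.
  Variation of constants is used in the form D = N + F(r) * N, the integral of r(t - s) dN(s) after
  integration by parts: it contains only Lebesgue integrals of continuous paths, so the stochastic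
  integral never has to be exchanged with another integral. The obstacle in the renewal part is that
  G(r_t) may jump, since r jumps at 0 and \<nu> may have atoms. Only right continuity of the kernel
  survives. It gives positivity on an interval, which excludes lattice behaviour, and L^1 continuity
  under small translations. In the critical case no contraction bounds y; the conserved quantity
  does so instead. The excessive case is the critical one after a weight exp(-\<kappa> t) has turned
  the kernel into a probability density.\<close>

definition causal :: "(real \<Rightarrow> real) \<Rightarrow> bool" where
  "causal f \<longleftrightarrow> f \<in> borel_measurable borel \<and> (\<forall>t<0. f t = 0) \<and> (\<forall>T. \<exists>B. \<forall>t\<le>T. \<bar>f t\<bar> \<le> B)"

text \<open>The integral runs over the whole line, yet for causal arguments the integrand is bounded
  and vanishes outside [0, t]. Local boundedness in \<open>causal\<close> makes it integrable
  without further hypotheses, also in iterated products.\<close>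

definition conv :: "(real \<Rightarrow> real) \<Rightarrow> (real \<Rightarrow> real) \<Rightarrow> real \<Rightarrow> real" where
  "conv f g t = (LBINT s. f (t - s) * g s)"

definition heaviside :: "real \<Rightarrow> real" where
  "heaviside = indicator {0..}"

lemma causal_measurable: "causal f \<Longrightarrow> f \<in> borel_measurable borel"
  by (simp add: causal_def)

lemma causal_neg: "causal f \<Longrightarrow> t < 0 \<Longrightarrow> f t = 0"
  by (simp add: causal_def)

lemma causal_bound:
  assumes "causal f"
  obtains B where "B > 0" "\<And>t. t \<le> T \<Longrightarrow> \<bar>f t\<bar> \<le> B"
proof -
  obtain B where "\<forall>t\<le>T. \<bar>f t\<bar> \<le> B" using assms unfolding causal_def by blast
  then show ?thesis by (intro that[of "\<bar>B\<bar> + 1"]) force+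
qed

lemma causalI:
  assumes "f \<in> borel_measurable borel" "\<And>t. t < 0 \<Longrightarrow> f t = 0"
    and "\<And>T. T \<ge> 0 \<Longrightarrow> \<exists>B. \<forall>t. 0 \<le> t \<and> t \<le> T \<longrightarrow> \<bar>f t\<bar> \<le> B"
  shows "causal f"
  unfolding causal_def
proof (intro conjI allI impI)
  fix T :: real
  obtain B where B: "\<forall>t. 0 \<le> t \<and> t \<le> max T 0 \<longrightarrow> \<bar>f t\<bar> \<le> B" using assms(3)[of "max T 0"] by auto
  show "\<exists>B. \<forall>t\<le>T. \<bar>f t\<bar> \<le> B"
  proof (intro exI[of _ "\<bar>B\<bar>"] allI impI)
    fix t assume "t \<le> T"
    have "\<bar>f t\<bar> \<le> B" if "\<not> t < 0" using B[rule_format, of t] \<open>t \<le> T\<close> that by auto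
    then show "\<bar>f t\<bar> \<le> \<bar>B\<bar>"
      using assms(2)[of t] by (cases "t < 0") auto
  qed
qed (use assms in auto)

lemma causal_heaviside: "causal heaviside"
  by (rule causalI) (auto simp: heaviside_def intro!: exI[of _ 1])

lemma heaviside_continuous: "continuous_on {0..} heaviside"
  by (rule continuous_on_eq[of _ "\<lambda>_. 1"]) (auto simp: heaviside_def)

lemma causal_bounded:
  assumes "f \<in> borel_measurable borel" "\<And>t. t < 0 \<Longrightarrow> f t = 0" "\<And>t. \<bar>f t\<bar> \<le> B"
  shows "causal f"
  by (rule causalI) (use assms in auto)

lemma causal_continuous_on:
  assumes "continuous_on {0..} g"
  shows "causal (\<lambda>t. heaviside t * g t)"
proof (rule causalI)
  show "(\<lambda>t. heaviside t * g t) \<in> borel_measurable borel"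
    using borel_measurable_continuous_on_indicator[OF _ assms] by (simp add: heaviside_def)
  fix T :: real assume "T \<ge> 0"
  have "compact (g ` {0..T})"
    by (intro compact_continuous_image continuous_on_subset[OF assms]) auto
  then have "bounded (g ` {0..T})" by (rule compact_imp_bounded)
  then obtain B where "\<forall>x\<in>g ` {0..T}. norm x \<le> B" unfolding bounded_iff by blast
  then show "\<exists>B. \<forall>t. 0 \<le> t \<and> t \<le> T \<longrightarrow> \<bar>heaviside t * g t\<bar> \<le> B"
    by (intro exI[of _ B]) (auto simp: heaviside_def)
qed (auto simp: heaviside_def)

lemma causal_lin:
  assumes "causal f" "causal g"
  shows "causal (\<lambda>t. a * f t + b * g t)"
proof (rule causalI)
  have [measurable]: "f \<in> borel_measurable borel" "g \<in> borel_measurable borel"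
    using assms by (auto simp: causal_measurable)
  show "(\<lambda>t. a * f t + b * g t) \<in> borel_measurable borel" by measurable
  fix T :: real
  obtain B where B: "B > 0" "\<And>t. t \<le> T \<Longrightarrow> \<bar>f t\<bar> \<le> B" using causal_bound[OF assms(1)] by metis
  obtain C where C: "C > 0" "\<And>t. t \<le> T \<Longrightarrow> \<bar>g t\<bar> \<le> C" using causal_bound[OF assms(2)] by metis
  show "\<exists>B. \<forall>t. 0 \<le> t \<and> t \<le> T \<longrightarrow> \<bar>a * f t + b * g t\<bar> \<le> B"
  proof (intro exI[of _ "\<bar>a\<bar> * B + \<bar>b\<bar> * C"] allI impI)
    fix t assume "0 \<le> t \<and> t \<le> T"
    then have "\<bar>a * f t\<bar> \<le> \<bar>a\<bar> * B" "\<bar>b * g t\<bar> \<le> \<bar>b\<bar> * C"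
      using B C by (auto simp: abs_mult intro!: mult_left_mono)
    then show "\<bar>a * f t + b * g t\<bar> \<le> \<bar>a\<bar> * B + \<bar>b\<bar> * C" by linarith
  qed
qed (use assms in \<open>auto simp: causal_neg\<close>)

lemma causal_add: "causal f \<Longrightarrow> causal g \<Longrightarrow> causal (\<lambda>t. f t + g t)"
  using causal_lin[of f g 1 1] by simp

lemma causal_diff: "causal f \<Longrightarrow> causal g \<Longrightarrow> causal (\<lambda>t. f t - g t)"
  using causal_lin[of f g 1 "-1"] by simp

lemma causal_cmult: "causal f \<Longrightarrow> causal (\<lambda>t. c * f t)"
  using causal_lin[of f f c 0] by simp

lemma causal_mult:
  assumes "causal f" "g \<in> borel_measurable borel" "\<And>T. T \<ge> 0 \<Longrightarrow> \<exists>B. \<forall>t. 0 \<le> t \<and> t \<le> T \<longrightarrow> \<bar>g t\<bar> \<le> B"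
  shows "causal (\<lambda>t. g t * f t)"
proof (rule causalI)
  have [measurable]: "f \<in> borel_measurable borel" "g \<in> borel_measurable borel"
    using assms by (auto simp: causal_measurable)
  show "(\<lambda>t. g t * f t) \<in> borel_measurable borel" by measurable
  fix T :: real assume "T \<ge> 0"
  obtain B where B: "B > 0" "\<And>t. t \<le> T \<Longrightarrow> \<bar>f t\<bar> \<le> B" using causal_bound[OF assms(1)] by metis
  obtain C where C: "\<forall>t. 0 \<le> t \<and> t \<le> T \<longrightarrow> \<bar>g t\<bar> \<le> C" using assms(3) \<open>T \<ge> 0\<close> by metis
  show "\<exists>B. \<forall>t. 0 \<le> t \<and> t \<le> T \<longrightarrow> \<bar>g t * f t\<bar> \<le> B"
    by (intro exI[of _ "\<bar>C\<bar> * B"] allI impI) (use B C in \<open>force simp: abs_mult intro!: mult_mono\<close>)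
qed (use assms in \<open>auto simp: causal_neg\<close>)

lemma causal_power2: "causal f \<Longrightarrow> causal (\<lambda>t. (f t)\<^sup>2)"
  using causal_mult[of f f] causal_bound[of f] unfolding power2_eq_square
  by (metis causal_measurable)

lemma causal_exp_mult: "causal f \<Longrightarrow> causal (\<lambda>t. exp (c * t) * f t)"
proof (rule causal_mult)
  fix T :: real assume "T \<ge> 0"
  show "\<exists>B. \<forall>t. 0 \<le> t \<and> t \<le> T \<longrightarrow> \<bar>exp (c * t)\<bar> \<le> B"
  proof (intro exI[of _ "exp (\<bar>c\<bar> * T)"] allI impI)
    fix t assume t: "0 \<le> t \<and> t \<le> T"
    then have "c * t \<le> \<bar>c\<bar> * t" by (intro mult_right_mono) auto
    also have "... \<le> \<bar>c\<bar> * T" using t by (intro mult_left_mono) auto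
    finally show "\<bar>exp (c * t)\<bar> \<le> exp (\<bar>c\<bar> * T)" by simp
  qed
qed auto

lemma integrable_bounded_support:
  fixes g :: "real \<Rightarrow> real"
  assumes "g \<in> borel_measurable borel" "\<And>s. s \<notin> {a..b} \<Longrightarrow> g s = 0"
    and "\<And>s. a \<le> s \<Longrightarrow> s \<le> b \<Longrightarrow> \<bar>g s\<bar> \<le> B"
  shows "integrable lborel g"
proof (rule Bochner_Integration.integrable_bound)
  show "integrable lborel (\<lambda>s. \<bar>B\<bar> * indicator {a..b} s)"
    by (intro integrable_mult_right integrable_real_indicator) (auto simp: emeasure_lborel_Icc_eq)
  show "AE s in lborel. norm (g s) \<le> norm (\<bar>B\<bar> * indicator {a..b} s)"
    using assms(2,3) by (intro AE_I2) (force simp: indicator_def)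
qed (use assms in simp)

lemma causal_integrable_conv:
  assumes "causal f" "causal g"
  shows "integrable lborel (\<lambda>s. f (t - s) * g s)"
proof -
  have [measurable]: "f \<in> borel_measurable borel" "g \<in> borel_measurable borel"
    using assms by (auto simp: causal_measurable)
  obtain B where B: "B > 0" "\<And>s. s \<le> t \<Longrightarrow> \<bar>f s\<bar> \<le> B" using causal_bound[OF assms(1)] by metis
  obtain C where C: "C > 0" "\<And>s. s \<le> t \<Longrightarrow> \<bar>g s\<bar> \<le> C" using causal_bound[OF assms(2)] by metis
  show ?thesis
  proof (rule integrable_bounded_support[of _ 0 t "B * C"])
    fix s assume "s \<notin> {0..t}"
    then show "f (t - s) * g s = 0" using assms causal_neg[of f "t - s"] causal_neg[of g s] by force
  next
    fix s assume "0 \<le> s" "s \<le> t"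
    then show "\<bar>f (t - s) * g s\<bar> \<le> B * C"
      unfolding abs_mult using B C by (intro mult_mono) auto
  qed measurable
qed

lemma conv_eq_set_integral:
  assumes "causal f" "causal g"
  shows "conv f g t = (LBINT s:{0..t}. f (t - s) * g s)"
  unfolding conv_def set_lebesgue_integral_def
proof (intro Bochner_Integration.integral_cong refl)
  fix s
  show "f (t - s) * g s = indicator {0..t} s *\<^sub>R (f (t - s) * g s)"
    using causal_neg[OF assms(1), of "t - s"] causal_neg[OF assms(2), of s] by (cases "s \<in> {0..t}") auto
qed

lemma causal_conv:
  assumes "causal f" "causal g"
  shows "causal (conv f g)"
proof (rule causalI)
  have [measurable]: "f \<in> borel_measurable borel" "g \<in> borel_measurable borel"
    using assms by (auto simp: causal_measurable)
  have "(\<lambda>t. LBINT s. f (t - s) * g s) \<in> borel_measurable borel"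
    by (rule lborel.borel_measurable_lebesgue_integral) measurable
  then show "conv f g \<in> borel_measurable borel" unfolding conv_def[abs_def] .
  show "conv f g t = 0" if "t < 0" for t
    using that unfolding conv_eq_set_integral[OF assms] set_lebesgue_integral_def by simp
  fix T :: real assume "T \<ge> 0"
  obtain B where B: "B > 0" "\<And>s. s \<le> T \<Longrightarrow> \<bar>f s\<bar> \<le> B" using causal_bound[OF assms(1)] by metis
  obtain C where C: "C > 0" "\<And>s. s \<le> T \<Longrightarrow> \<bar>g s\<bar> \<le> C" using causal_bound[OF assms(2)] by metis
  have "\<bar>conv f g t\<bar> \<le> B * C * T" if "0 \<le> t" "t \<le> T" for t
  proof -
    have "norm (conv f g t) \<le> (LBINT s. B * C * indicator {0..T} s)"
      unfolding conv_def
    proof (rule Bochner_Integration.integral_norm_bound_integral)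
      show "integrable lborel (\<lambda>s. B * C * indicat_real {0..T} s)"
        by (intro integrable_mult_right integrable_real_indicator) (auto simp: emeasure_lborel_Icc_eq)
      fix s :: real
      show "norm (f (t - s) * g s) \<le> B * C * indicator {0..T} s"
      proof (cases "s \<in> {0..t}")
        case True
        then have "\<bar>f (t - s)\<bar> * \<bar>g s\<bar> \<le> B * C" using B C that by (intro mult_mono) auto
        then show ?thesis using True that by (simp add: abs_mult)
      next
        case False
        then have z: "f (t - s) * g s = 0" using assms causal_neg[of f "t - s"] causal_neg[of g s] by force
        show ?thesis unfolding z using B C by simp
      qed
    qed (use causal_integrable_conv[OF assms] in simp)
    also have "... = B * C * T" using \<open>T \<ge> 0\<close> by simp
    finally show ?thesis by simp
  qed
  then show "\<exists>B. \<forall>t. 0 \<le> t \<and> t \<le> T \<longrightarrow> \<bar>conv f g t\<bar> \<le> B" by blast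
qed

text \<open>Reflection s -> t - s; if one side is not integrable, neither is the other, and both are
  the default 0.\<close>

lemma conv_commute: "conv f g t = conv g f t"
  unfolding conv_def
  by (subst lborel_integral_real_affine[where c="-1" and t=t]) (auto simp: mult.commute)

lemma conv_lin_right:
  assumes "causal f" "causal g" "causal h"
  shows "conv f (\<lambda>s. a * g s + b * h s) t = a * conv f g t + b * conv f h t"
proof -
  have "conv f (\<lambda>s. a * g s + b * h s) t
      = (LBINT s. a * (f (t - s) * g s) + b * (f (t - s) * h s))"
    unfolding conv_def by (simp add: algebra_simps)
  also have "... = a * conv f g t + b * conv f h t"
    unfolding conv_def using causal_integrable_conv[OF assms(1,2)] causal_integrable_conv[OF assms(1,3)]
    by simp
  finally show ?thesis .
qed

lemma conv_add_right:
  "causal f \<Longrightarrow> causal g \<Longrightarrow> causal h \<Longrightarrow> conv f (\<lambda>s. g s + h s) t = conv f g t + conv f h t"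
  using conv_lin_right[of f g h 1 1] by simp

lemma conv_diff_right:
  "causal f \<Longrightarrow> causal g \<Longrightarrow> causal h \<Longrightarrow> conv f (\<lambda>s. g s - h s) t = conv f g t - conv f h t"
  using conv_lin_right[of f g h 1 "-1"] by simp

lemma conv_cmult_right: "conv f (\<lambda>s. c * g s) t = c * conv f g t"
  unfolding conv_def by (simp add: mult.left_commute[of _ c])

lemma conv_add_left:
  "causal f \<Longrightarrow> causal g \<Longrightarrow> causal h \<Longrightarrow> conv (\<lambda>s. g s + h s) f t = conv g f t + conv h f t"
  using conv_add_right[of f g h] by (simp add: conv_commute[of _ f])

lemma conv_diff_left:
  "causal f \<Longrightarrow> causal g \<Longrightarrow> causal h \<Longrightarrow> conv (\<lambda>s. g s - h s) f t = conv g f t - conv h f t"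
  using conv_diff_right[of f g h] by (simp add: conv_commute[of _ f])

lemma integrable_bounded_support_pair:
  fixes g :: "real \<times> real \<Rightarrow> real"
  assumes "g \<in> borel_measurable (borel \<Otimes>\<^sub>M borel)"
    and "\<And>x y. x \<notin> {a..b} \<or> y \<notin> {a..b} \<Longrightarrow> g (x, y) = 0"
    and "\<And>x y. a \<le> x \<Longrightarrow> x \<le> b \<Longrightarrow> a \<le> y \<Longrightarrow> y \<le> b \<Longrightarrow> \<bar>g (x, y)\<bar> \<le> B"
  shows "integrable (lborel \<Otimes>\<^sub>M lborel) g"
proof (rule Bochner_Integration.integrable_bound)
  have "emeasure (lborel \<Otimes>\<^sub>M lborel) ({a..b} \<times> {a..b}) < \<infinity>"
    by (subst lborel.emeasure_pair_measure_Times)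
       (auto simp: emeasure_lborel_Icc_eq ennreal_mult_less_top)
  then show "integrable (lborel \<Otimes>\<^sub>M lborel) (\<lambda>s. \<bar>B\<bar> * indicator ({a..b} \<times> {a..b}) s)"
    by (intro integrable_mult_right integrable_real_indicator) (auto simp: emeasure_lborel_Icc_eq)
  show "AE s in lborel \<Otimes>\<^sub>M lborel. norm (g s) \<le> norm (\<bar>B\<bar> * indicator ({a..b} \<times> {a..b}) s)"
  proof (rule AE_I2)
    fix s :: "real \<times> real"
    obtain x y where s: "s = (x, y)" by force
    show "norm (g s) \<le> norm (\<bar>B\<bar> * indicator ({a..b} \<times> {a..b}) s)"
      using assms(2,3)[of x y] unfolding s by (force simp: indicator_def)
  qed
  show "g \<in> borel_measurable (lborel \<Otimes>\<^sub>M lborel)" using assms(1) by (simp cong: measurable_cong_sets)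
qed

text \<open>Fubini on the square [0, t] x [0, t]: outside it one of the three factors has a negative
  argument and vanishes, inside it all three are bounded.\<close>

lemma conv_assoc:
  assumes "causal f" "causal g" "causal h"
  shows "conv f (conv g h) t = conv (conv f g) h t"
proof -
  have [measurable]: "f \<in> borel_measurable borel" "g \<in> borel_measurable borel" "h \<in> borel_measurable borel"
    using assms by (auto simp: causal_measurable)
  obtain B where B: "B > 0" "\<And>s. s \<le> t \<Longrightarrow> \<bar>f s\<bar> \<le> B" using causal_bound[OF assms(1)] by metis
  obtain C where C: "C > 0" "\<And>s. s \<le> t \<Longrightarrow> \<bar>g s\<bar> \<le> C" using causal_bound[OF assms(2)] by metis
  obtain D where D: "D > 0" "\<And>s. s \<le> t \<Longrightarrow> \<bar>h s\<bar> \<le> D" using causal_bound[OF assms(3)] by metis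
  let ?I = "\<lambda>v s. f (t - s) * (g (s - v) * h v)"
  have "integrable (lborel \<Otimes>\<^sub>M lborel) (\<lambda>(v, s). ?I v s)"
  proof (rule integrable_bounded_support_pair[of _ 0 t "B * (C * D)"])
    fix v s :: real assume "v \<notin> {0..t} \<or> s \<notin> {0..t}"
    then have "v < 0 \<or> s - v < 0 \<or> t - s < 0" by auto
    then show "(\<lambda>(v, s). ?I v s) (v, s) = 0"
      using assms causal_neg[of f "t - s"] causal_neg[of g "s - v"] causal_neg[of h v] by auto
  next
    fix v s :: real assume "0 \<le> v" "v \<le> t" "0 \<le> s" "s \<le> t"
    then have "\<bar>f (t - s)\<bar> \<le> B" "\<bar>g (s - v)\<bar> \<le> C" "\<bar>h v\<bar> \<le> D" using B C D by auto
    then have "\<bar>f (t - s)\<bar> * (\<bar>g (s - v)\<bar> * \<bar>h v\<bar>) \<le> B * (C * D)"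
      using B C D by (intro mult_mono) auto
    then show "\<bar>(\<lambda>(v, s). ?I v s) (v, s)\<bar> \<le> B * (C * D)" by (simp add: abs_mult)
  qed measurable
  from lborel_pair.Fubini_integral[OF this]
  have *: "(LBINT s. LBINT v. ?I v s) = (LBINT v. LBINT s. ?I v s)" .
  have "conv f (conv g h) t = (LBINT s. LBINT v. ?I v s)"
    unfolding conv_def by simp
  also have "\<dots> = (LBINT v. (LBINT s. f (t - s) * g (s - v)) * h v)"
    unfolding * by (simp add: mult.assoc[symmetric])
  also have "\<dots> = conv (conv f g) h t"
    unfolding conv_def
  proof (intro Bochner_Integration.integral_cong refl)
    fix v
    have "(LBINT s. f (t - s) * g (s - v)) = (LBINT s. f (t - v - s) * g s)"
      by (subst lborel_integral_real_affine[where c=1 and t=v]) (auto simp: algebra_simps)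
    then show "(LBINT s. f (t - s) * g (s - v)) * h v = (LBINT s. f (t - v - s) * g s) * h v" by simp
  qed
  finally show ?thesis .
qed

lemma conv_heaviside:
  assumes "causal f"
  shows "conv heaviside f t = (LBINT s:{0..t}. f s)"
  unfolding conv_eq_set_integral[OF causal_heaviside assms] set_lebesgue_integral_def
  by (intro Bochner_Integration.integral_cong) (auto simp: heaviside_def indicator_def)

section \<open>Continuity of convolutions, and recovery of a function from its integral\<close>

lemma causal_isCont:
  assumes "causal f" "continuous_on {0..} f" "t \<noteq> 0"
  shows "isCont f t"
proof (cases "t < 0")
  case True
  then have "\<forall>\<^sub>F x in nhds t. x < 0" using eventually_nhds_in_open[of "{..<0}" t] by simp
  then have "\<forall>\<^sub>F x in nhds t. f x = 0" by eventually_elim (use assms causal_neg in auto)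
  then show ?thesis by (simp add: isCont_cong)
next
  case False
  then show ?thesis using assms continuous_on_interior[of "{0..}" f t] by auto
qed

text \<open>One continuous factor is enough. As the times tend to t, the integrand converges at
  every s except possibly s = t, where the argument of \<open>f\<close> meets the jump a causal
  function may have at 0. That is a single point, and bounds on a common interval give dominated
  convergence.\<close>

lemma continuous_on_conv:
  assumes "causal f" "continuous_on {0..} f" "causal g"
  shows "continuous_on {0..} (conv f g)"
  unfolding continuous_on_sequentially comp_def
proof (intro allI ballI impI)
  fix X :: "nat \<Rightarrow> real" and t
  assume "t \<in> {0..}" "(\<forall>n. X n \<in> {0..}) \<and> X \<longlonglongrightarrow> t"
  then have X: "X \<longlonglongrightarrow> t" by auto
  then have "Bseq X" by (intro convergent_imp_Bseq) (auto simp: convergent_def)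
  then obtain T where T: "T > 0" "\<And>n. \<bar>X n\<bar> \<le> T" by (auto elim!: BseqE)
  have [measurable]: "f \<in> borel_measurable borel" "g \<in> borel_measurable borel"
    using assms by (auto simp: causal_measurable)
  obtain B where B: "B > 0" "\<And>s. s \<le> T \<Longrightarrow> \<bar>f s\<bar> \<le> B" using causal_bound[OF assms(1)] by metis
  obtain C where C: "C > 0" "\<And>s. s \<le> T \<Longrightarrow> \<bar>g s\<bar> \<le> C" using causal_bound[OF assms(3)] by metis
  show "(\<lambda>n. conv f g (X n)) \<longlonglongrightarrow> conv f g t"
    unfolding conv_def
  proof (rule integral_dominated_convergence[where w="\<lambda>s. B * C * indicator {0..T} s"])
    show "integrable lborel (\<lambda>s. B * C * indicat_real {0..T} s)"
      by (intro integrable_mult_right integrable_real_indicator) (auto simp: emeasure_lborel_Icc_eq)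
    show "AE s in lborel. (\<lambda>n. f (X n - s) * g s) \<longlonglongrightarrow> f (t - s) * g s"
    proof (rule AE_mp[OF AE_lborel_singleton[of t]], rule AE_I2, rule impI)
      fix s assume "s \<noteq> t"
      then have "isCont f (t - s)" by (intro causal_isCont[OF assms(1,2)]) auto
      moreover have "(\<lambda>n. X n - s) \<longlonglongrightarrow> t - s" by (intro tendsto_intros X)
      ultimately show "(\<lambda>n. f (X n - s) * g s) \<longlonglongrightarrow> f (t - s) * g s"
        by (intro tendsto_mult tendsto_const isCont_tendsto_compose[of _ f])
    qed
    fix n
    show "AE s in lborel. norm (f (X n - s) * g s) \<le> B * C * indicator {0..T} s"
    proof (rule AE_I2)
      fix s
      show "norm (f (X n - s) * g s) \<le> B * C * indicator {0..T} s"
      proof (cases "0 \<le> s \<and> s \<le> X n")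
        case True
        then have "\<bar>f (X n - s)\<bar> * \<bar>g s\<bar> \<le> B * C" using B C T(2)[of n] by (intro mult_mono) auto
        then show ?thesis using True T(2)[of n] by (simp add: abs_mult)
      next
        case False
        then have z: "f (X n - s) * g s = 0"
          using assms causal_neg[of f "X n - s"] causal_neg[of g s] by force
        show ?thesis unfolding z using B C by simp
      qed
    qed
  qed measurable
qed

text \<open>Fundamental theorem of calculus, since \<open>conv heaviside\<close> is integration from
  0. An identity between continuous causal functions can thus be proved after one integration, where
  it becomes an identity of convolutions.\<close>

lemma conv_heaviside_inj:
  assumes "causal f" "causal g" "continuous_on {0..} f" "continuous_on {0..} g"
    and eq: "\<And>t. t \<ge> 0 \<Longrightarrow> conv heaviside f t = conv heaviside g t"
  shows "f t = g t"
proof (cases "t < 0")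
  case True then show ?thesis using assms causal_neg by metis
next
  case False
  let ?h = "\<lambda>t. f t - g t"
  have h: "causal ?h" "continuous_on {0..} ?h"
    using assms by (auto intro!: causal_diff continuous_intros)
  have z: "integral {0..u} ?h = 0" if "u \<ge> 0" for u
  proof -
    have "set_integrable lborel {0..u} ?h"
      by (intro borel_integrable_atLeastAtMost' continuous_on_subset[OF h(2)]) auto
    then have "integral {0..u} ?h = (LBINT s:{0..u}. ?h s)"
      by (rule set_borel_integral_eq_integral(2)[symmetric])
    also have "\<dots> = conv heaviside ?h u" using h by (simp add: conv_heaviside)
    also have "\<dots> = 0" using assms(1,2) eq[OF that] by (simp add: conv_diff_right causal_heaviside)
    finally show ?thesis .
  qed
  \<comment> \<open>The right end t + 1 keeps the interval nondegenerate when t = 0, where the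
    derivative is one-sided.\<close>
  have t: "t \<in> cbox 0 (t + 1)" using False by auto
  have "((\<lambda>u. integral {0..u} ?h) has_vector_derivative ?h t) (at t within {0..t + 1})"
    by (rule integral_has_vector_derivative) (use t in \<open>auto intro!: continuous_on_subset[OF h(2)]\<close>)
  moreover have "((\<lambda>u. integral {0..u} ?h) has_vector_derivative 0) (at t within {0..t + 1})"
    by (rule has_vector_derivative_transform[of t _ _ "\<lambda>_. 0"]) (use t in \<open>auto simp: z\<close>)
  ultimately have "?h t = 0"
    using vector_derivative_unique_within_closed_interval[of 0 "t + 1" t _ "?h t" 0] t False by auto
  then show ?thesis by simp
qed

lemma filterlim_minus_const_at_top:
  fixes X :: "'a \<Rightarrow> real"
  assumes "filterlim X at_top F"
  shows "filterlim (\<lambda>n. X n - c) at_top F"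
  using filterlim_tendsto_add_at_top[OF tendsto_const[of "- c"] assms] by simp

lemma causal_tendsto_bounded:
  assumes "causal f" "(f \<longlongrightarrow> l) at_top"
  obtains B where "\<And>t. \<bar>f t\<bar> \<le> B"
proof -
  have "\<forall>\<^sub>F t in at_top. norm (f t - l) < 1"
    using tendstoD[OF assms(2), of 1] by (simp add: dist_norm)
  then obtain T where T: "\<And>t. t \<ge> T \<Longrightarrow> \<bar>f t - l\<bar> < 1"
    unfolding eventually_at_top_linorder by auto
  obtain B where B: "B > 0" "\<And>t. t \<le> T \<Longrightarrow> \<bar>f t\<bar> \<le> B" using causal_bound[OF assms(1)] by metis
  have "\<bar>f t\<bar> \<le> max B (\<bar>l\<bar> + 1)" for t
    using T[of t] B(2)[of t] by (cases "t \<le> T") auto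
  then show ?thesis using that by blast
qed

text \<open>Commutativity moves the time variable into the convergent factor, whose bound times |f|
  dominates.\<close>

lemma conv_tendsto:
  assumes "causal f" "causal g" "integrable lborel f" "(g \<longlongrightarrow> l) at_top" "\<And>t. \<bar>g t\<bar> \<le> B"
  shows "((\<lambda>t. conv f g t) \<longlongrightarrow> (LBINT s. f s) * l) at_top"
proof -
  have [measurable]: "f \<in> borel_measurable borel" "g \<in> borel_measurable borel"
    using assms by (auto simp: causal_measurable)
  have "((\<lambda>t. LBINT s. g (t - s) * f s) \<longlongrightarrow> (LBINT s. l * f s)) at_top"
  proof (rule integral_dominated_convergence_at_top[where w="\<lambda>s. B * \<bar>f s\<bar>"])
    show "AE x in lborel. ((\<lambda>i. g (i - x) * f x) \<longlongrightarrow> l * f x) at_top"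
    proof (rule AE_I2)
      fix x :: real
      have "filterlim (\<lambda>i. i - x) at_top at_top"
        by (rule filterlim_minus_const_at_top[OF filterlim_ident])
      then show "((\<lambda>i. g (i - x) * f x) \<longlongrightarrow> l * f x) at_top"
        by (intro tendsto_intros filterlim_compose[OF assms(4)])
    qed
    show "\<forall>\<^sub>F i in at_top. AE x in lborel. norm (g (i - x) * f x) \<le> B * \<bar>f x\<bar>"
      by (intro always_eventually allI AE_I2) (use assms(5) in \<open>auto simp: abs_mult intro!: mult_right_mono\<close>)
  qed (use assms in auto)
  then show ?thesis
    by (simp add: conv_commute[of f] conv_def[of g f] mult.commute)
qed

section \<open>Exponential decay\<close>

lemma exp_neg_tendsto_0:
  fixes c :: real
  assumes "c > 0" shows "((\<lambda>s. exp (- c * s)) \<longlongrightarrow> 0) at_top"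
proof -
  have "filterlim (\<lambda>s::real. - c * s) at_bot at_top"
    using assms by (intro filterlim_tendsto_neg_mult_at_bot[OF tendsto_const _ filterlim_ident]) auto
  then show ?thesis by (rule filterlim_compose[OF exp_at_bot])
qed

lemma has_bochner_integral_exp_atLeast:
  fixes a c :: real
  assumes "c > 0"
  shows "has_bochner_integral lborel (\<lambda>s. indicator {a..} s * exp (- c * s)) (exp (- c * a) / c)"
proof (rule has_bochner_integral_nn_integral)
  have "(\<integral>\<^sup>+s\<in>{a..}. ennreal (exp (- c * s)) \<partial>lborel) = ennreal (0 - (- exp (- c * a) / c))"
  proof (rule nn_integral_FTC_atLeast)
    show "((\<lambda>s. - exp (- c * s) / c) has_real_derivative exp (- c * s)) (at s)" for s
      using assms by (auto intro!: derivative_eq_intros)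
    from tendsto_divide[OF tendsto_minus[OF exp_neg_tendsto_0[OF assms]] tendsto_const[of c]]
    show "((\<lambda>s. - exp (- c * s) / c) \<longlongrightarrow> 0) at_top" using assms by simp
  qed auto
  also have "(\<integral>\<^sup>+s\<in>{a..}. ennreal (exp (- c * s)) \<partial>lborel) =
      (\<integral>\<^sup>+s. ennreal (indicator {a..} s * exp (- c * s)) \<partial>lborel)"
    by (intro nn_integral_cong) (auto simp: indicator_def)
  finally show "(\<integral>\<^sup>+s. ennreal (indicator {a..} s * exp (- c * s)) \<partial>lborel) = ennreal (exp (- c * a) / c)"
    by simp
qed (use assms in auto)

lemmas integrable_exp_atLeast = integrable.intros[OF has_bochner_integral_exp_atLeast]
lemmas integral_exp_atLeast = has_bochner_integral_integral_eq[OF has_bochner_integral_exp_atLeast]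

lemma exp_decay_integrable:
  fixes f :: "real \<Rightarrow> real"
  assumes "f \<in> borel_measurable borel" "\<And>t. t < a \<Longrightarrow> f t = 0" "\<And>t. \<bar>f t\<bar> \<le> C * exp (- c * t)" "c > 0"
  shows "integrable lborel f"
proof (rule Bochner_Integration.integrable_bound)
  show "integrable lborel (\<lambda>s. C * (indicator {a..} s * exp (- c * s)))"
    by (intro integrable_mult_right integrable_exp_atLeast assms)
  show "AE s in lborel. norm (f s) \<le> norm (C * (indicator {a..} s * exp (- c * s)))"
  proof (rule AE_I2)
    fix s show "norm (f s) \<le> norm (C * (indicator {a..} s * exp (- c * s)))"
      using assms(2)[of s] assms(3)[of s] by (cases "s < a") (auto simp: indicator_def)
  qed
qed (use assms in simp)

lemma exp_decay_tendsto_0: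
  fixes f :: "real \<Rightarrow> real"
  assumes "\<And>t. \<bar>f t\<bar> \<le> C * exp (- c * t)" "c > 0"
  shows "(f \<longlongrightarrow> 0) at_top"
proof (rule Lim_null_comparison)
  show "\<forall>\<^sub>F x in at_top. norm (f x) \<le> C * exp (- c * x)" using assms by auto
  show "((\<lambda>x. C * exp (- c * x)) \<longlongrightarrow> 0) at_top"
    using tendsto_mult_right_zero[OF exp_neg_tendsto_0[OF assms(2)]] .
qed

lemma exp_decay_bounded:
  fixes f :: "real \<Rightarrow> real"
  assumes "\<And>t. t < 0 \<Longrightarrow> f t = 0" "\<And>t. \<bar>f t\<bar> \<le> C * exp (- c * t)" "c > 0"
  shows "\<bar>f t\<bar> \<le> C"
proof -
  have "0 \<le> C" using assms(2)[of 0] by simp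
  show ?thesis
  proof (cases "t < 0")
    case False
    then have "exp (- c * t) \<le> 1" using assms by simp
    then have "C * exp (- c * t) \<le> C" using \<open>0 \<le> C\<close> by (rule mult_left_le)
    then show ?thesis using assms(2)[of t] by simp
  qed (use assms \<open>0 \<le> C\<close> in simp)
qed

section \<open>Renewal equations\<close>

text \<open>Absorption: for Y the supremum of |y| up to t, the step gives Y \<le> C + \<theta> Y,
  and Y is finite because y is locally bounded, so \<theta> Y may be subtracted.\<close>

lemma running_sup_bound:
  assumes "causal y" "0 \<le> \<theta>" "\<theta> < 1" "0 \<le> C"
    and step: "\<And>T Y t. (\<And>s. s \<le> T \<Longrightarrow> \<bar>y s\<bar> \<le> Y) \<Longrightarrow> t \<le> T \<Longrightarrow> \<bar>y t\<bar> \<le> C + \<theta> * Y"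
  shows "\<bar>y t\<bar> \<le> C / (1 - \<theta>)"
proof -
  define Y where "Y = (SUP s\<in>{..t}. \<bar>y s\<bar>)"
  obtain B where B: "\<And>s. s \<le> t \<Longrightarrow> \<bar>y s\<bar> \<le> B" using causal_bound[OF assms(1)] by metis
  have bdd: "bdd_above ((\<lambda>s. \<bar>y s\<bar>) ` {..t})" using B by (intro bdd_aboveI[of _ B]) auto
  have Y: "\<bar>y s\<bar> \<le> Y" if "s \<le> t" for s
    unfolding Y_def by (rule cSUP_upper[OF _ bdd]) (use that in auto)
  have "Y \<le> C + \<theta> * Y"
    unfolding Y_def by (rule cSUP_least) (use step[OF Y] in \<open>auto simp: Y_def\<close>)
  then have "Y * (1 - \<theta>) \<le> C" by (simp add: algebra_simps)
  then have "Y \<le> C / (1 - \<theta>)" using assms by (simp add: pos_le_divide_eq)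
  then show ?thesis using Y[of t] by simp
qed

text \<open>A probability density with exponential decay. Right continuity is the regularity that
  the square of G(r_t) still has when atoms of the measure move the jump of r at 0 to other
  times.\<close>

locale renewal_kernel =
  fixes k :: "real \<Rightarrow> real" and C c :: real
  assumes k_causal: "causal k"
    and k_nonneg: "\<And>t. 0 \<le> k t"
    and k_decay: "\<And>t. k t \<le> C * exp (- c * t)"
    and c_pos: "c > 0"
    and k_total: "(LBINT s. k s) = 1"
    and k_right_cont: "\<And>t. (k \<longlongrightarrow> k t) (at_right t)"
begin

lemma k_measurable[measurable]: "k \<in> borel_measurable borel"
  using k_causal by (rule causal_measurable)

lemma k_abs_decay: "\<bar>k t\<bar> \<le> C * exp (- c * t)"
  using k_nonneg k_decay by simp

lemma k_bounded: "k t \<le> C"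
  using exp_decay_bounded[of k C c t] causal_neg[OF k_causal] k_abs_decay c_pos k_nonneg[of t] by simp

lemma C_nonneg: "0 \<le> C" using k_bounded k_nonneg order_trans by metis

lemma k_integrable: "integrable lborel k"
  by (rule exp_decay_integrable[of _ 0, OF k_measurable causal_neg[OF k_causal] k_abs_decay c_pos])

lemma integrable_indicator_k: "A \<in> sets borel \<Longrightarrow> integrable lborel (\<lambda>s. indicator A s * k s)"
  using integrable_mult_indicator[OF _ k_integrable, of A] by simp

text \<open>Mass of \<open>k\<close> beyond t for t \<ge> 0, and zero before. Written as H - H * k
  with H = \<open>heaviside\<close>, so that it can be convolved without returning to the integral
  form.\<close>

definition tail :: "real \<Rightarrow> real" where
  "tail t = heaviside t - conv heaviside k t"

lemma tail_causal: "causal tail"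
  unfolding tail_def[abs_def] by (intro causal_diff causal_heaviside causal_conv k_causal)

lemma tail_measurable[measurable]: "tail \<in> borel_measurable borel"
  using tail_causal by (rule causal_measurable)

lemma tail_eq:
  assumes "t \<ge> 0"
  shows "tail t = (LBINT s. indicator {t<..} s * k s)"
proof -
  have "conv heaviside k t = (LBINT s. indicator {..t} s * k s)"
    unfolding conv_heaviside[OF k_causal] set_lebesgue_integral_def
  proof (intro Bochner_Integration.integral_cong refl)
    fix s show "indicator {0..t} s *\<^sub>R k s = indicator {..t} s * k s"
      using causal_neg[OF k_causal, of s] by (cases "s < 0") (auto simp: indicator_def)
  qed
  moreover have "(LBINT s. indicator {..t} s * k s) + (LBINT s. indicator {t<..} s * k s)
      = (LBINT s. indicator {..t} s * k s + indicator {t<..} s * k s)"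
    by (intro Bochner_Integration.integral_add[symmetric] integrable_indicator_k) auto
  moreover have "\<dots> = (LBINT s. k s)"
    by (intro Bochner_Integration.integral_cong refl) (auto simp: indicator_def)
  ultimately show ?thesis using assms k_total by (simp add: tail_def heaviside_def)
qed

lemma tail_nonneg: "0 \<le> tail t"
proof (cases "t < 0")
  case False
  then show ?thesis using k_nonneg by (simp add: tail_eq)
qed (use causal_neg[OF tail_causal] in auto)

lemma tail_decay: "tail t \<le> C / c * exp (- c * t)"
proof (cases "t < 0")
  case False
  then have "tail t = (LBINT s. indicator {t<..} s * k s)" by (intro tail_eq) simp
  also have "\<dots> \<le> (LBINT s. C * (indicator {t..} s * exp (- c * s)))"
  proof (rule integral_mono)
    show "integrable lborel (\<lambda>s. C * (indicat_real {t..} s * exp (- c * s)))"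
      by (intro integrable_mult_right integrable_exp_atLeast c_pos)
    fix s show "indicat_real {t<..} s * k s \<le> C * (indicat_real {t..} s * exp (- c * s))"
      using k_decay[of s] C_nonneg by (auto simp: indicator_def)
  qed (auto intro: integrable_indicator_k)
  also have "\<dots> = C / c * exp (- c * t)" using integral_exp_atLeast[OF c_pos, of t] by simp
  finally show ?thesis .
qed (use causal_neg[OF tail_causal] C_nonneg c_pos in auto)

lemma tail_integrable: "integrable lborel tail"
  by (rule exp_decay_integrable[of _ 0 "C / c" c])
     (use causal_neg[OF tail_causal] tail_nonneg tail_decay c_pos in auto)

lemma tail_tendsto_0: "(tail \<longlongrightarrow> 0) at_top"
  by (rule exp_decay_tendsto_0[of _ "C / c" c]) (use tail_nonneg tail_decay c_pos in auto)

lemma tail_antimono: "0 \<le> s \<Longrightarrow> s \<le> t \<Longrightarrow> tail t \<le> tail s"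
  using k_nonneg
  by (simp add: tail_eq, intro integral_mono integrable_indicator_k) (auto simp: indicator_def)

lemma tail_0: "tail 0 = 1"
proof -
  have "(LBINT s:{0..0}. k s) = 0"
    unfolding set_lebesgue_integral_def
    by (rule integral_eq_zero_AE, rule AE_mp[OF AE_lborel_singleton[of 0]]) auto
  then have "conv heaviside k 0 = 0" by (simp only: conv_heaviside[OF k_causal])
  then show ?thesis unfolding tail_def by (simp, simp add: heaviside_def)
qed

lemma tail_continuous: "continuous_on {0..} tail"
  unfolding tail_def[abs_def]
  by (intro continuous_on_diff continuous_on_conv heaviside_continuous causal_heaviside k_causal)

text \<open>Fubini for k(s) on the region 0 \<le> t < s: integrating over s first gives
  \<open>tail\<close>, over t first gives s k(s). Integrability of \<open>tail\<close> supplies that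
  of the double integral, hence a finite first moment.\<close>

lemma integral_tail: "(LBINT t. tail t) = (LBINT s. s * k s)"
  and moment_integrable: "integrable lborel (\<lambda>s. s * k s)"
proof -
  let ?g = "\<lambda>t s. indicator {0..<s} t * k s"
  have tail: "(LBINT s. ?g t s) = tail t" for t
  proof (cases "t < 0")
    case True
    then have "(LBINT s. ?g t s) = 0" by (intro integral_eq_zero_AE AE_I2) auto
    then show ?thesis using True causal_neg[OF tail_causal] by simp
  next
    case False
    then show ?thesis unfolding tail_eq[OF leI[OF False]]
      by (intro Bochner_Integration.integral_cong refl) (auto simp: indicator_def)
  qed
  have *: "integrable (lborel \<Otimes>\<^sub>M lborel) (\<lambda>(t, s). ?g t s)"
  proof (rule lborel_pair.Fubini_integrable)
    have [measurable]: "Measurable.pred (borel \<Otimes>\<^sub>M borel) (\<lambda>(t, s). t \<in> {0..<s::real})"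
      by (simp add: atLeastLessThan_iff split_beta')
    have "(\<lambda>(t, s). (if t \<in> {0..<s} then 1 else 0) * k s) \<in> borel_measurable (borel \<Otimes>\<^sub>M borel)"
      by (simp add: atLeastLessThan_iff split_beta') measurable
    then show "(\<lambda>(t, s). ?g t s) \<in> borel_measurable (lborel \<Otimes>\<^sub>M lborel)"
      by (simp add: indicator_def split_beta' cong: measurable_cong_sets)
    show "integrable lborel (\<lambda>t. LBINT s. norm (case (t, s) of (t, s) \<Rightarrow> ?g t s))"
      using tail_integrable k_nonneg by (simp add: tail)
    show "AE t in lborel. integrable lborel (\<lambda>s. case (t, s) of (t, s) \<Rightarrow> ?g t s)"
    proof (rule AE_I2, simp)
      fix t :: real
      have "integrable lborel (\<lambda>s. indicator {0..} t * (indicator {t<..} s * k s))"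
        by (intro integrable_mult_right integrable_indicator_k) auto
      then show "integrable lborel (\<lambda>s. indicator {0..<s} t * k s)"
        by (rule Bochner_Integration.integrable_cong[THEN iffD1, rotated 2]) (auto simp: indicator_def)
    qed
  qed
  have s: "(LBINT t. ?g t s) = s * k s" for s
    using causal_neg[OF k_causal, of s] by (cases "s < 0") auto
  have "(LBINT t. tail t) = (LBINT t. LBINT s. ?g t s)" by (simp add: tail)
  also have "\<dots> = (LBINT s. LBINT t. ?g t s)" by (rule lborel_pair.Fubini_integral[OF *, symmetric])
  finally show "(LBINT t. tail t) = (LBINT s. s * k s)" unfolding s .
  show "integrable lborel (\<lambda>s. s * k s)"
    using lborel_pair.integrable_snd[OF *] unfolding s .
qed

lemma moment_pos: "0 < (LBINT s. s * k s)"
proof (rule ccontr)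
  assume "\<not> 0 < (LBINT s. s * k s)"
  moreover have nn: "0 \<le> s * k s" for s
    using causal_neg[OF k_causal, of s] k_nonneg[of s] by (cases "s < 0") auto
  ultimately have "(LBINT s. s * k s) = 0" by (simp add: order_antisym integral_nonneg)
  then have "AE s in lborel. s * k s = 0"
    using integral_nonneg_eq_0_iff_AE[OF moment_integrable] nn by simp
  then have "AE s in lborel. k s = 0"
    using AE_lborel_singleton[of 0] by eventually_elim auto
  then have "(LBINT s. k s) = 0" by (rule integral_eq_zero_AE)
  then show False using k_total by simp
qed

text \<open>A density of mass 1 is positive at some point, and right continuity extends this to an
  interval on its right. An interval of positivity excludes a lattice kernel, for which y could
  oscillate for ever.\<close>

lemma k_pos_interval: obtains a b where "0 \<le> a" "a < b" "\<And>s. a < s \<Longrightarrow> s < b \<Longrightarrow> 0 < k s"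
proof -
  obtain s0 where s0: "k s0 \<noteq> 0"
  proof (rule ccontr)
    assume "\<not> thesis"
    then have "k s = 0" for s using that by blast
    then show False using k_total by simp
  qed
  then have "0 < k s0" "0 \<le> s0" using k_nonneg[of s0] causal_neg[OF k_causal, of s0] by force+
  moreover have "\<forall>\<^sub>F s in at_right s0. 0 < k s" by (rule order_tendstoD(1)[OF k_right_cont \<open>0 < k s0\<close>])
  then obtain b where "b > s0" "\<And>s. s0 < s \<Longrightarrow> s < b \<Longrightarrow> 0 < k s" unfolding eventually_at_right_field by blast
  ultimately show ?thesis using that by blast
qed

text \<open>Pointwise convergence is right continuity, because h tends to 0 from above; the
  exponential bound dominates.\<close>

lemma k_translation_tendsto:
  "((\<lambda>h. LBINT s. \<bar>k (s + h) - k s\<bar>) \<longlongrightarrow> 0) (at_right 0)"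
  unfolding tendsto_at_iff_sequentially comp_def
proof (intro allI impI)
  fix X :: "nat \<Rightarrow> real"
  assume "\<forall>i. X i \<in> {0<..} - {0}" and X: "X \<longlonglongrightarrow> 0"
  then have pos: "X i > 0" for i by auto
  have ne: "X i \<noteq> 0" for i using pos[of i] by simp
  have "Bseq X" using X by (intro convergent_imp_Bseq) (auto simp: convergent_def)
  then obtain H where H: "H > 0" "\<And>n. \<bar>X n\<bar> \<le> H" by (auto elim!: BseqE)
  have "(\<lambda>i. LBINT s. \<bar>k (s + X i) - k s\<bar>) \<longlonglongrightarrow> (LBINT s::real. 0::real)"
  \<comment> \<open>For 0 < h \<le> H the translated kernel starts no earlier than -H, and both
    terms are at most C exp(-c s); hence the factor 2 and the half-line from -H.\<close>
  proof (rule integral_dominated_convergence[where w="\<lambda>s. 2 * C * (indicator {- H..} s * exp (- c * s))"])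
    show "integrable lborel (\<lambda>s. 2 * C * (indicat_real {- H..} s * exp (- c * s)))"
      by (intro integrable_mult_right integrable_exp_atLeast c_pos)
    show "AE s in lborel. (\<lambda>i. \<bar>k (s + X i) - k s\<bar>) \<longlonglongrightarrow> 0"
    proof (rule AE_I2)
      fix s
      have "filterlim (\<lambda>i. s + X i) (at_right s) sequentially"
        unfolding filterlim_at using pos ne tendsto_add[OF tendsto_const X, of s] by auto
      then have "(\<lambda>i. k (s + X i)) \<longlonglongrightarrow> k s" by (rule filterlim_compose[OF k_right_cont])
      then show "(\<lambda>i. \<bar>k (s + X i) - k s\<bar>) \<longlonglongrightarrow> 0"
        by (metis LIM_zero tendsto_rabs_zero)
    qed
    fix i
    show "AE s in lborel. norm \<bar>k (s + X i) - k s\<bar> \<le> 2 * C * (indicator {- H..} s * exp (- c * s))"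
    proof (rule AE_I2)
      fix s
      show "norm \<bar>k (s + X i) - k s\<bar> \<le> 2 * C * (indicator {- H..} s * exp (- c * s))"
      proof (cases "s \<ge> - H")
        case True
        have "k (s + X i) \<le> C * exp (- c * s)"
        proof -
          have "k (s + X i) \<le> C * exp (- c * (s + X i))" by (rule k_decay)
          also have "\<dots> \<le> C * exp (- c * s)"
            using C_nonneg c_pos pos[of i] by (intro mult_left_mono) auto
          finally show ?thesis .
        qed
        then have "\<bar>k (s + X i) - k s\<bar> \<le> 2 * (C * exp (- c * s))"
          using k_decay[of s] k_nonneg[of s] k_nonneg[of "s + X i"] by linarith
        then show ?thesis using True by simp
      next
        case False
        then have "s + X i < 0" "s < 0" using H(2)[of i] H(1) by auto
        then show ?thesis using False causal_neg[OF k_causal] by simp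
      qed
    qed
  qed measurable
  then show "(\<lambda>i. LBINT s. \<bar>k (s + X i) - k s\<bar>) \<longlonglongrightarrow> 0" by simp
qed

end

section \<open>The limit of solutions of a proper renewal equation\<close>

locale renewal_solution = renewal_kernel +
  fixes f y :: "real \<Rightarrow> real"
  assumes f_causal: "causal f" and y_causal: "causal y"
    and renewal_eq: "\<And>t. y t = f t + conv k y t"
    and f_integrable: "integrable lborel f"
    and f_tendsto_0: "(f \<longlongrightarrow> 0) at_top"
begin

lemma y_measurable[measurable]: "y \<in> borel_measurable borel"
  using y_causal by (rule causal_measurable)

text \<open>Integrating the renewal equation gives H * y = H * f + (H * k) * y with H =
  \<open>heaviside\<close>; the last term is moved to the left.\<close>

lemma conv_tail: "conv tail y t = conv heaviside f t"
proof -
  have "(\<lambda>s. f s + conv k y s) = y" by (rule ext) (rule renewal_eq[symmetric])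
  then have "conv heaviside y t = conv heaviside (\<lambda>s. f s + conv k y s) t" by (simp only:)
  also have "\<dots> = conv heaviside f t + conv (conv heaviside k) y t"
    by (simp add: conv_add_right causal_heaviside causal_conv k_causal f_causal y_causal conv_assoc)
  finally show ?thesis
    unfolding tail_def[abs_def]
    by (simp add: conv_diff_left causal_heaviside causal_conv k_causal y_causal)
qed

lemma conv_tail_tendsto: "(conv tail y \<longlongrightarrow> (LBINT s. f s)) at_top"
proof -
  have "((\<lambda>t. conv f heaviside t) \<longlongrightarrow> (LBINT s. f s) * 1) at_top"
  proof (rule conv_tendsto[OF f_causal causal_heaviside f_integrable])
    show "(heaviside \<longlongrightarrow> 1) at_top"
      by (rule tendsto_eventually, rule eventually_mono[OF eventually_ge_at_top[of 0]])
         (simp add: heaviside_def)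
    show "\<bar>heaviside t\<bar> \<le> 1" for t by (simp add: heaviside_def indicator_def)
  qed
  moreover have "conv tail y = conv f heaviside" by (rule ext) (simp only: conv_tail conv_commute[of heaviside f])
  ultimately show ?thesis by simp
qed

text \<open>The increment of k * y is at most B times the L^1 distance of \<open>k\<close> from its
  translate and takes \<epsilon>/2. The values of f at the two times are already small for late t
  and take \<epsilon>/4 each.\<close>

lemma slow_oscillation:
  assumes B: "\<And>t. \<bar>y t\<bar> \<le> B" and "\<epsilon> > 0"
  obtains \<delta> T where "\<delta> > 0" "\<And>t h. t \<ge> T \<Longrightarrow> 0 \<le> h \<Longrightarrow> h \<le> \<delta> \<Longrightarrow> \<bar>y (t + h) - y t\<bar> \<le> \<epsilon>"
proof -
  have "B \<ge> 0" using B[of 0] by simp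
  have "\<forall>\<^sub>F h in at_right 0. (LBINT s. \<bar>k (s + h) - k s\<bar>) < \<epsilon> / (2 * (B + 1))"
    using \<open>\<epsilon> > 0\<close> \<open>B \<ge> 0\<close> by (intro order_tendstoD(2)[OF k_translation_tendsto]) simp
  then obtain d where d: "d > 0"
    "\<And>h. 0 < h \<Longrightarrow> h < d \<Longrightarrow> (LBINT s. \<bar>k (s + h) - k s\<bar>) < \<epsilon> / (2 * (B + 1))"
    unfolding eventually_at_right_field by auto
  have "\<forall>\<^sub>F t in at_top. norm (f t) < \<epsilon> / 4"
    using \<open>\<epsilon> > 0\<close> tendstoD[OF f_tendsto_0, of "\<epsilon> / 4"] by (simp add: dist_norm)
  then obtain T where T: "\<And>t. t \<ge> T \<Longrightarrow> \<bar>f t\<bar> < \<epsilon> / 4"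
    unfolding eventually_at_top_linorder by auto
  have "\<bar>y (t + h) - y t\<bar> \<le> \<epsilon>" if "t \<ge> T" "0 \<le> h" "h \<le> d / 2" for t h
  proof (cases "h = 0")
    case False
    have i: "integrable lborel (\<lambda>s. k (a - s))" for a
      using lborel_integrable_real_affine[OF k_integrable, of "-1" a] by simp
    have "\<bar>conv k y (t + h) - conv k y t\<bar> = \<bar>LBINT s. (k (t + h - s) - k (t - s)) * y s\<bar>"
      unfolding conv_def left_diff_distrib
      by (subst Bochner_Integration.integral_diff) (auto intro!: causal_integrable_conv k_causal y_causal)
    also have "\<dots> \<le> (LBINT s. \<bar>k (t + h - s) - k (t - s)\<bar> * B)"
    proof (rule Bochner_Integration.integral_abs_bound_integral)
      show "integrable lborel (\<lambda>s. (k (t + h - s) - k (t - s)) * y s)"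
        unfolding left_diff_distrib
        by (intro Bochner_Integration.integrable_diff causal_integrable_conv k_causal y_causal)
      show "integrable lborel (\<lambda>s. \<bar>k (t + h - s) - k (t - s)\<bar> * B)"
        by (intro integrable_mult_left integrable_abs Bochner_Integration.integrable_diff i)
    qed (auto simp: abs_mult intro!: mult_left_mono B)
    also have "\<dots> = B * (LBINT s. \<bar>k (s + h) - k s\<bar>)"
      by (subst lborel_integral_real_affine[where c="-1" and t=t]) (auto simp: algebra_simps)
    also have "\<dots> \<le> (B + 1) * (LBINT s. \<bar>k (s + h) - k s\<bar>)"
      by (intro mult_right_mono) auto
    also have "\<dots> \<le> (B + 1) * (\<epsilon> / (2 * (B + 1)))"
      using d(2)[of h] False that \<open>B \<ge> 0\<close> d(1) by (intro mult_left_mono) auto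
    also have "\<dots> = \<epsilon> / 2" using \<open>B \<ge> 0\<close> by (simp add: field_simps)
    finally show ?thesis
      using renewal_eq[of t] renewal_eq[of "t + h"] T[of t] T[of "t + h"] that by linarith
  qed (use \<open>\<epsilon> > 0\<close> in simp)
  then show ?thesis using that[of "d / 2" T] d by auto
qed

text \<open>
  If \<open>y\<close> is close to its upper limit \<open>L\<close> at time \<open>t\<close>, then, \<open>y t\<close> being almost an average of the past
  values with weights \<open>k\<close>, it is close to \<open>L\<close> at all times \<open>t - u\<close> with \<open>u\<close> in the support of \<open>k\<close>.
\<close>

lemma maximum_propagates:
  assumes B: "\<And>t. \<bar>y t\<bar> \<le> B"
    and upper: "\<And>\<epsilon>. \<epsilon> > 0 \<Longrightarrow> \<forall>\<^sub>F t in at_top. y t \<le> L + \<epsilon>"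
    and X: "filterlim X at_top sequentially" "(\<lambda>n. y (X n)) \<longlonglongrightarrow> L"
    and ab: "0 \<le> a" "\<And>s. a < s \<Longrightarrow> s < b \<Longrightarrow> 0 < k s" "a < u" "u < b"
  shows "(\<lambda>n. y (X n - u)) \<longlonglongrightarrow> L"
proof (rule order_tendstoI)
  note Xc = filterlim_minus_const_at_top[OF X(1)]
  fix q assume "q > L"
  then have "\<forall>\<^sub>F t in at_top. y t \<le> L + (q - L) / 2" by (intro upper) simp
  from eventually_compose_filterlim[OF this Xc[of u]]
  show "\<forall>\<^sub>F n in sequentially. y (X n - u) < q"
    by eventually_elim (use \<open>q > L\<close> in \<open>auto simp: field_simps\<close>)
next
  note Xc = filterlim_minus_const_at_top[OF X(1)]
  fix q assume "q < L"
  define \<epsilon> where "\<epsilon> = L - q"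
  have "\<epsilon> > 0" using \<open>q < L\<close> by (simp add: \<epsilon>_def)
  obtain \<delta> T0 where d: "\<delta> > 0" "\<And>t h. t \<ge> T0 \<Longrightarrow> 0 \<le> h \<Longrightarrow> h \<le> \<delta> \<Longrightarrow> \<bar>y (t + h) - y t\<bar> \<le> \<epsilon> / 2"
    using slow_oscillation[OF B, of "\<epsilon> / 2"] \<open>\<epsilon> > 0\<close> by (metis half_gt_zero)
  \<comment> \<open>Weight of the lags v in [u - \<delta>, u]. The window lies to the left of u
    because t - v is then later than t - u by at most \<delta>, the direction that slow oscillation
    controls.\<close>
  define p where "p = (LBINT s. indicator {u - \<delta>..u} s * k s)"
  have "p > 0"
  proof (rule ccontr)
    assume "\<not> p > 0"
    moreover have "0 \<le> p" unfolding p_def using k_nonneg by (intro integral_nonneg_AE) auto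
    ultimately have "(LBINT s. indicator {u - \<delta>..u} s * k s) = 0" by (simp add: p_def)
    then have "AE s in lborel. indicator {u - \<delta>..u} s * k s = 0"
      using integral_nonneg_eq_0_iff_AE[OF integrable_indicator_k[of "{u - \<delta>..u}"]] k_nonneg by simp
    then have "AE s in lborel. s \<notin> {max a (u - \<delta>)<..<u}"
    proof eventually_elim
      case (elim s)
      show ?case
      proof
        assume s: "s \<in> {max a (u - \<delta>)<..<u}"
        then have "0 < k s" using ab by (intro ab(2)) auto
        then show False using elim s by simp
      qed
    qed
    then have "{max a (u - \<delta>)<..<u} \<in> null_sets lborel"
      by (subst AE_iff_null_sets) auto
    then show False using d(1) ab by (auto simp: null_sets_def)
  qed
  \<comment> \<open>The window lowers the average by at least (\<epsilon>/2) p = 8 \<eta>, while the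
    upper bound on y, the remote past, f(t) and the gap between y(t) and L cost at most \<eta>
    each.\<close>
  define \<eta> where "\<eta> = \<epsilon> * p / 16"
  have "\<eta> > 0" using \<open>\<epsilon> > 0\<close> \<open>p > 0\<close> by (simp add: \<eta>_def)
  obtain T where T: "\<And>t. t \<ge> T \<Longrightarrow> y t \<le> L + \<eta>"
    using upper[OF \<open>\<eta> > 0\<close>] unfolding eventually_at_top_linorder by auto
  have "((\<lambda>t. (B + \<bar>L\<bar>) * tail t) \<longlongrightarrow> 0) at_top"
    using tendsto_mult_right_zero[OF tail_tendsto_0] .
  then have "((\<lambda>n. (B + \<bar>L\<bar>) * tail (X n - T)) \<longlonglongrightarrow> 0)" by (rule filterlim_compose[OF _ Xc])
  then have e1: "\<forall>\<^sub>F n in sequentially. (B + \<bar>L\<bar>) * tail (X n - T) < \<eta>"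
    using \<open>\<eta> > 0\<close> by (rule order_tendstoD)
  have "(\<lambda>n. f (X n)) \<longlonglongrightarrow> 0" by (rule filterlim_compose[OF f_tendsto_0 X(1)])
  then have e2: "\<forall>\<^sub>F n in sequentially. f (X n) < \<eta>" using \<open>\<eta> > 0\<close> by (rule order_tendstoD)
  have e3: "\<forall>\<^sub>F n in sequentially. L - \<eta> < y (X n)"
    using \<open>\<eta> > 0\<close> by (intro order_tendstoD(1)[OF X(2)]) simp
  have e4: "\<forall>\<^sub>F n in sequentially. max (max T0 T + u) T \<le> X n"
    using X(1) unfolding filterlim_at_top by blast
  show "\<forall>\<^sub>F n in sequentially. q < y (X n - u)"
    using e1 e2 e3 e4
  proof eventually_elim
    case (elim n)
    define t where "t = X n"
    have t: "(B + \<bar>L\<bar>) * tail (t - T) < \<eta>" "f t < \<eta>" "L - \<eta> < y t" "t \<ge> T0 + u" "t \<ge> T + u" "t \<ge> T"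
      using elim by (auto simp: t_def)
    show ?case
    proof (rule ccontr)
      assume "\<not> q < y (X n - u)"
      then have yu: "y (t - u) \<le> L - \<epsilon>" by (simp add: t_def \<epsilon>_def)
      \<comment> \<open>Three regimes for y(t - v): at most L - \<epsilon>/2 on the window, at most
        L + \<eta> for t - v \<ge> T, and only at most B for t - v < T, where the last term
        compensates.\<close>
      let ?w = "\<lambda>v. (L + \<eta>) * k v - (\<epsilon> / 2 + \<eta>) * (indicator {u - \<delta>..u} v * k v)
         + (B + \<bar>L\<bar>) * (indicator {t - T<..} v * k v)"
      have "conv y k t = (LBINT v. y (t - v) * k v)" by (simp add: conv_def)
      also have "\<dots> \<le> (LBINT v. ?w v)"
      proof (rule integral_mono)
        show "integrable lborel (\<lambda>v. y (t - v) * k v)" by (intro causal_integrable_conv k_causal y_causal)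
        show "integrable lborel ?w"
          by (intro Bochner_Integration.integrable_add Bochner_Integration.integrable_diff
              integrable_mult_right integrable_indicator_k k_integrable) auto
        fix v
        have "y (t - v) \<le> (L + \<eta>) - (\<epsilon> / 2 + \<eta>) * indicator {u - \<delta>..u} v + (B + \<bar>L\<bar>) * indicator {t - T<..} v"
        proof (cases "v \<in> {u - \<delta>..u}")
          case True
          then have "\<bar>y (t - u + (u - v)) - y (t - u)\<bar> \<le> \<epsilon> / 2" using t by (intro d) auto
          moreover have "t - u + (u - v) = t - v" by simp
          ultimately have "\<bar>y (t - v) - y (t - u)\<bar> \<le> \<epsilon> / 2" by metis
          then have "y (t - v) \<le> L - \<epsilon> / 2" using yu by linarith
          then show ?thesis using True t by (simp add: indicator_def)
        next
          case False
          then show ?thesis using T[of "t - v"] B[of "t - v"] \<open>\<eta> > 0\<close>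
            by (cases "v > t - T") (auto simp: abs_le_iff)
        qed
        then have "y (t - v) * k v \<le> ((L + \<eta>) - (\<epsilon> / 2 + \<eta>) * indicator {u - \<delta>..u} v
            + (B + \<bar>L\<bar>) * indicator {t - T<..} v) * k v"
          by (rule mult_right_mono[OF _ k_nonneg])
        then show "y (t - v) * k v \<le> ?w v" by (simp add: algebra_simps)
      qed
      also have "\<dots> = (L + \<eta>) * (LBINT v. k v) - (\<epsilon> / 2 + \<eta>) * p + (B + \<bar>L\<bar>) * (LBINT v. indicator {t - T<..} v * k v)"
        using k_integrable integrable_indicator_k[of "{u - \<delta>..u}"] integrable_indicator_k[of "{t - T<..}"]
        by (simp add: p_def)
      also have "\<dots> = (L + \<eta>) - (\<epsilon> / 2 + \<eta>) * p + (B + \<bar>L\<bar>) * tail (t - T)"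
        using t by (simp add: k_total tail_eq)
      finally have "y t - f t \<le> (L + \<eta>) - (\<epsilon> / 2 + \<eta>) * p + (B + \<bar>L\<bar>) * tail (t - T)"
        using renewal_eq[of t] by (simp add: conv_commute)
      moreover have "(\<epsilon> / 2 + \<eta>) * p = 8 * \<eta> + \<eta> * p" by (simp add: \<eta>_def field_simps)
      moreover have "\<eta> * p > 0" using \<open>\<eta> > 0\<close> \<open>p > 0\<close> by simp
      ultimately show False using t \<open>\<eta> > 0\<close> by linarith
    qed
  qed
qed

text \<open>Iterated propagation reaches all lags m u with a < u < b, and the intervals (m a, m b)
  cover a half-line. So y is close to L on the whole distant past of X n, and the limit of
  \<open>conv tail y\<close> along these times, computed in two ways, is an equation for L.\<close>

lemma upper_limit_value:
  assumes B: "\<And>t. \<bar>y t\<bar> \<le> B"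
    and upper: "\<And>\<epsilon>. \<epsilon> > 0 \<Longrightarrow> \<forall>\<^sub>F t in at_top. y t \<le> L + \<epsilon>"
    and X: "filterlim X at_top sequentially" "(\<lambda>n. y (X n)) \<longlonglongrightarrow> L"
  shows "L * (LBINT s. s * k s) = (LBINT s. f s)"
proof -
  obtain a b where ab: "0 \<le> a" "a < b" "\<And>s. a < s \<Longrightarrow> s < b \<Longrightarrow> 0 < k s"
    using k_pos_interval by metis
  note Xc = filterlim_minus_const_at_top[OF X(1)]
  have mult: "(\<lambda>n. y (X n - real m * u)) \<longlonglongrightarrow> L" if "a < u" "u < b" for m u
  proof (induction m)
    case (Suc m)
    from maximum_propagates[OF B upper Xc Suc ab(1) ab(3) that]
    show ?case by (simp add: algebra_simps)
  qed (use X in simp)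
  \<comment> \<open>If s > a b / (b - a) and m is the least integer with s < m b, then m \<le> s / b
    + 1 gives m a < s, so s / m lies in (a, b). The summand 1 makes the inequality strict and s
    positive.\<close>
  define S where "S = a * b / (b - a) + 1"
  have conv_S: "(\<lambda>n. y (X n - s)) \<longlonglongrightarrow> L" if "s \<ge> S" for s
  proof -
    have "0 \<le> a * b / (b - a)" using ab by simp
    then have "s > 0" using that by (simp add: S_def)
    define m where "m = nat (\<lfloor>s / b\<rfloor> + 1)"
    have "0 \<le> s / b" using \<open>s > 0\<close> ab by simp
    then have m: "real m = of_int \<lfloor>s / b\<rfloor> + 1" unfolding m_def by simp
    have m1: "s / b < real m" unfolding m by linarith
    have m2: "real m \<le> s / b + 1" unfolding m by linarith
    have "real m > 0" using m1 \<open>0 \<le> s / b\<close> by linarith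
    have "a * b / (b - a) < s" using that by (simp add: S_def)
    then have "a * b < s * (b - a)" using ab by (simp add: pos_divide_less_eq)
    then have "a * (s / b + 1) < s" using ab by (simp add: field_simps)
    moreover have "a * real m \<le> a * (s / b + 1)" using m2 ab by (intro mult_left_mono) auto
    ultimately have "a < s / real m" using \<open>real m > 0\<close> by (simp add: pos_less_divide_eq)
    moreover have "s / real m < b"
      using m1 \<open>real m > 0\<close> ab by (simp add: field_simps)
    ultimately show ?thesis using mult[of "s / real m" m] \<open>real m > 0\<close> by simp
  qed
  \<comment> \<open>Evaluating at X n - S keeps every argument with v \<ge> 0 at a lag of at least S
    from X n.\<close>
  have "(\<lambda>n. LBINT v. y (X n - S - v) * tail v) \<longlonglongrightarrow> (LBINT v. L * tail v)"
  proof (rule integral_dominated_convergence[where w="\<lambda>v. B * tail v"])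
    show "integrable lborel (\<lambda>v. B * tail v)" using tail_integrable by simp
    show "AE v in lborel. (\<lambda>n. y (X n - S - v) * tail v) \<longlonglongrightarrow> L * tail v"
    proof (rule AE_I2)
      fix v show "(\<lambda>n. y (X n - S - v) * tail v) \<longlonglongrightarrow> L * tail v"
      proof (cases "v < 0")
        case False
        then show ?thesis using conv_S[of "S + v"] by (intro tendsto_intros) (simp add: algebra_simps)
      qed (simp add: causal_neg[OF tail_causal])
    qed
    show "AE v in lborel. norm (y (X n - S - v) * tail v) \<le> B * tail v" for n
      using B tail_nonneg by (intro AE_I2) (auto simp: abs_mult intro!: mult_right_mono)
  qed measurable
  then have "(\<lambda>n. conv tail y (X n - S)) \<longlonglongrightarrow> L * (LBINT s. s * k s)"
    by (simp add: conv_commute[of tail] conv_def[of y] integral_tail)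
  moreover have "(\<lambda>n. conv tail y (X n - S)) \<longlonglongrightarrow> (LBINT s. f s)"
    by (rule filterlim_compose[OF conv_tail_tendsto Xc])
  ultimately show ?thesis by (rule LIMSEQ_unique)
qed

text \<open>L is the upper limit of y, as the infimum of its eventual upper bounds. Minimality gives
  late times with values near L, and \<open>upper_limit_value\<close> identifies L.\<close>

lemma eventually_le_limit:
  assumes B: "\<And>t. \<bar>y t\<bar> \<le> B" and "\<epsilon> > 0"
  shows "\<forall>\<^sub>F t in at_top. y t \<le> (LBINT s. f s) / (LBINT s. s * k s) + \<epsilon>"
proof -
  define A where "A = {a. \<forall>\<^sub>F t in at_top. y t \<le> a}"
  define L where "L = Inf A"
  have "B \<in> A" using B unfolding A_def by (simp add: abs_le_iff)
  have lower: "- B \<le> a" if a: "a \<in> A" for a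
  proof -
    obtain T where "\<forall>t\<ge>T. y t \<le> a"
      using a unfolding A_def eventually_at_top_linorder by auto
    then have "y T \<le> a" by simp
    then show ?thesis using B[of T] by (simp add: abs_le_iff)
  qed
  then have bdd: "bdd_below A" by (rule bdd_belowI)
  have upper: "\<forall>\<^sub>F t in at_top. y t \<le> L + e" if "e > 0" for e
  proof -
    have "Inf A < L + e" using that by (simp add: L_def)
    then obtain a where "a \<in> A" "a < L + e" using \<open>B \<in> A\<close> bdd by (subst (asm) cInf_less_iff) auto
    then show ?thesis unfolding A_def by (auto elim!: eventually_mono)
  qed
  have "\<exists>t\<ge>real n. L - 1 / real (Suc n) < y t" for n
  proof (rule ccontr)
    assume "\<not> ?thesis"
    then have "\<forall>t\<ge>real n. y t \<le> L - 1 / real (Suc n)" by (auto simp: not_less)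
    then have "L - 1 / real (Suc n) \<in> A" unfolding A_def eventually_at_top_linorder by blast
    then have "L \<le> L - 1 / real (Suc n)" unfolding L_def by (rule cInf_lower[OF _ bdd])
    then show False by simp
  qed
  then obtain X where X: "\<And>n. X n \<ge> real n" "\<And>n. L - 1 / real (Suc n) < y (X n)" by metis
  have Xt: "filterlim X at_top sequentially"
    by (rule filterlim_at_top_mono[OF filterlim_real_sequentially]) (use X in auto)
  have "(\<lambda>n. y (X n)) \<longlonglongrightarrow> L"
  proof (rule order_tendstoI)
    fix q assume "q < L"
    moreover have "(\<lambda>n. L - 1 / real (Suc n)) \<longlonglongrightarrow> L - 0"
      using LIMSEQ_Suc[OF lim_1_over_n] by (intro tendsto_intros) simp
    ultimately have "\<forall>\<^sub>F n in sequentially. q < L - 1 / real (Suc n)" by (intro order_tendstoD(1)) auto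
    then show "\<forall>\<^sub>F n in sequentially. q < y (X n)"
      by eventually_elim (use X(2) less_trans in blast)
  next
    fix q assume "q > L"
    then have "\<forall>\<^sub>F t in at_top. y t \<le> L + (q - L) / 2" by (intro upper) simp
    from eventually_compose_filterlim[OF this Xt]
    show "\<forall>\<^sub>F n in sequentially. y (X n) < q"
      by eventually_elim (use \<open>q > L\<close> in \<open>auto simp: field_simps\<close>)
  qed
  from upper_limit_value[OF B upper Xt this]
  have "L = (LBINT s. f s) / (LBINT s. s * k s)" using moment_pos by (simp add: field_simps)
  then show ?thesis using upper[OF \<open>\<epsilon> > 0\<close>] by simp
qed

text \<open>The pair -f, -y satisfies the equation with the same kernel, so the estimate of its
  upper limit bounds the lower limit of y from below by the same number.\<close>

lemma bounded_solution_tendsto: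
  assumes B: "\<And>t. \<bar>y t\<bar> \<le> B"
  shows "(y \<longlongrightarrow> (LBINT s. f s) / (LBINT s. s * k s)) at_top"
proof -
  interpret neg: renewal_solution k C c "\<lambda>t. - f t" "\<lambda>t. - y t"
  proof
    show "causal (\<lambda>t. - f t)" "causal (\<lambda>t. - y t)"
      using causal_cmult[OF f_causal, of "-1"] causal_cmult[OF y_causal, of "-1"] by auto
    show "- y t = - f t + conv k (\<lambda>t. - y t) t" for t
      using renewal_eq[of t] conv_cmult_right[of k "-1" y t] by simp
    show "integrable lborel (\<lambda>t. - f t)" using f_integrable by simp
    show "((\<lambda>t. - f t) \<longlongrightarrow> 0) at_top" using tendsto_minus[OF f_tendsto_0] by simp
  qed
  define l where "l = (LBINT s. f s) / (LBINT s. s * k s)"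
  have nl: "(LBINT s. - f s) / (LBINT s. s * k s) = - l" by (simp add: l_def)
  have nB: "\<bar>- y t\<bar> \<le> B" for t using B by simp
  show ?thesis
    unfolding l_def[symmetric]
  proof (rule tendstoI)
    fix e :: real assume "e > 0"
    then have "e / 2 > 0" by simp
    from eventually_le_limit[OF B this] neg.eventually_le_limit[OF nB this]
    show "\<forall>\<^sub>F t in at_top. dist (y t) l < e"
      unfolding nl l_def[symmetric]
    proof eventually_elim
      case (elim t)
      then show ?case using \<open>e > 0\<close> unfolding dist_real_def abs_less_iff by linarith
    qed
  qed
qed

text \<open>Total mass 1 gives no contraction, so the kernel is cut at its median \<delta>. Lags
  beyond \<delta> carry mass 1/2 and contract. For lags up to \<delta> the tail is at least 1/2,
  hence k \<le> C \<le> 2 C \<open>tail\<close>, and their share is bounded through the conserved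
  quantity, which never exceeds the integral of f.\<close>

lemma nonneg_solution_bounded:
  assumes "\<And>t. 0 \<le> y t" "\<And>t. 0 \<le> f t" "\<And>t. f t \<le> B"
  obtains K where "\<And>t. \<bar>y t\<bar> \<le> K"
proof -
  have "\<forall>\<^sub>F t in at_top. tail t < 1 / 2" by (rule order_tendstoD(2)[OF tail_tendsto_0]) simp
  then obtain T where T: "\<And>t. t \<ge> T \<Longrightarrow> tail t < 1 / 2" unfolding eventually_at_top_linorder by auto
  have "\<exists>\<delta>\<ge>0. \<delta> \<le> \<bar>T\<bar> \<and> tail \<delta> = 1 / 2"
  proof (intro IVT2')
    show "tail \<bar>T\<bar> \<le> 1 / 2" using T[OF abs_ge_self] by simp
  qed (auto simp: tail_0 intro: continuous_on_subset[OF tail_continuous])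
  then obtain \<delta> where \<delta>: "\<delta> \<ge> 0" "tail \<delta> = 1 / 2" by auto
  define F where "F = (LBINT s. f s)"
  have "0 \<le> F" unfolding F_def using assms by simp
  have "0 \<le> B" using assms(2,3)[of 0] by simp
  have tail_y: "conv tail y t \<le> F" for t
    unfolding conv_tail conv_heaviside[OF f_causal] F_def set_lebesgue_integral_def
    using assms f_integrable by (intro integral_mono integrable_mult_indicator) (auto simp: indicator_def)
  have "\<bar>y t\<bar> \<le> (B + 2 * C * F) / (1 - 1 / 2)" for t
  proof (rule running_sup_bound[OF y_causal])
    show "0 \<le> B + 2 * C * F" using \<open>0 \<le> B\<close> \<open>0 \<le> F\<close> C_nonneg by simp
    fix T Y t assume Y: "\<And>s. s \<le> T \<Longrightarrow> \<bar>y s\<bar> \<le> Y" and "t \<le> T"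
    have ind: "integrable lborel (\<lambda>s. indicator {\<delta><..} (t - s) * k (t - s))"
      using lborel_integrable_real_affine[OF integrable_indicator_k[of "{\<delta><..}"], of "-1" t] by simp
    have "conv k y t = (LBINT s. k (t - s) * y s)" by (simp add: conv_def)
    also have "\<dots> \<le> (LBINT s. 2 * C * (tail (t - s) * y s) + Y * (indicator {\<delta><..} (t - s) * k (t - s)))"
    proof (rule integral_mono)
      show "integrable lborel (\<lambda>s. k (t - s) * y s)" by (intro causal_integrable_conv k_causal y_causal)
      show "integrable lborel (\<lambda>s. 2 * C * (tail (t - s) * y s) + Y * (indicator {\<delta><..} (t - s) * k (t - s)))"
        by (intro Bochner_Integration.integrable_add integrable_mult_right ind
            causal_integrable_conv tail_causal y_causal)
      fix s
      have "0 \<le> Y" using Y[of t] \<open>t \<le> T\<close> by simp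
      consider "t - s < 0" | "0 \<le> t - s" "t - s \<le> \<delta>" | "t - s > \<delta>" by linarith
      then show "k (t - s) * y s \<le> 2 * C * (tail (t - s) * y s) + Y * (indicator {\<delta><..} (t - s) * k (t - s))"
      proof cases
        case 1
        then show ?thesis using \<delta> causal_neg[OF k_causal, of "t - s"] causal_neg[OF tail_causal, of "t - s"] by simp
      next
        case 2
        then have "1 \<le> 2 * tail (t - s)" using tail_antimono[of "t - s" \<delta>] \<delta> by simp
        then have "C * 1 \<le> C * (2 * tail (t - s))" using C_nonneg by (rule mult_left_mono)
        then have "k (t - s) \<le> 2 * C * tail (t - s)" using k_bounded[of "t - s"] by simp
        then have "k (t - s) * y s \<le> 2 * C * tail (t - s) * y s" using assms(1) by (rule mult_right_mono)
        then show ?thesis using 2 by (simp add: mult.assoc)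
      next
        case 3
        then have "s \<le> T" using \<open>t \<le> T\<close> \<delta> by simp
        then have "y s \<le> Y" using Y[of s] by simp
        then have "k (t - s) * y s \<le> Y * k (t - s)"
          using k_nonneg by (subst mult.commute) (rule mult_right_mono)
        moreover have "0 \<le> 2 * C * (tail (t - s) * y s)" using C_nonneg tail_nonneg assms(1) by simp
        moreover have "indicator {\<delta><..} (t - s) = (1 :: real)" using 3 by simp
        ultimately show ?thesis by (metis add_increasing mult_1)
      qed
    qed
    also have "\<dots> = 2 * C * conv tail y t + Y * (LBINT s. indicator {\<delta><..} (t - s) * k (t - s))"
      unfolding conv_def using causal_integrable_conv[OF tail_causal y_causal, of t] ind by simp
    also have "(LBINT s. indicator {\<delta><..} (t - s) * k (t - s)) = tail \<delta>"
      unfolding tail_eq[OF \<delta>(1)]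
      by (subst lborel_integral_real_affine[where c="-1" and t=t]) auto
    finally have "conv k y t \<le> 2 * C * F + Y / 2"
      using mult_left_mono[OF tail_y[of t], of "2 * C"] C_nonneg \<delta> by simp
    then show "\<bar>y t\<bar> \<le> B + 2 * C * F + 1 / 2 * Y"
      using renewal_eq[of t] assms(1)[of t] assms(3)[of t] by simp
  qed auto
  then show ?thesis using that by blast
qed

theorem nonneg_solution_tendsto:
  assumes "\<And>t. 0 \<le> y t" "\<And>t. 0 \<le> f t" "\<And>t. f t \<le> B"
  shows "(y \<longlongrightarrow> (LBINT s. f s) / (LBINT s. s * k s)) at_top"
  using nonneg_solution_bounded[OF assms] bounded_solution_tendsto by metis

end

section \<open>The trichotomy for renewal equations\<close>

text \<open>exp(\<kappa> t) is the product of exp(\<kappa> (t - s)) and exp(\<kappa> s), so an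
  exponential weight distributes over the two factors.\<close>

lemma conv_exp: "conv (\<lambda>t. exp (\<kappa> * t) * f t) (\<lambda>t. exp (\<kappa> * t) * g t) t = exp (\<kappa> * t) * conv f g t"
proof -
  have e: "exp (\<kappa> * (t - s)) * f (t - s) * (exp (\<kappa> * s) * g s) = exp (\<kappa> * t) * (f (t - s) * g s)" for s
  proof -
    have "exp (\<kappa> * (t - s)) * exp (\<kappa> * s) = exp (\<kappa> * t)"
      by (simp add: exp_add[symmetric] algebra_simps)
    then show ?thesis by (metis mult.assoc mult.left_commute)
  qed
  show ?thesis unfolding conv_def e by simp
qed

text \<open>In the application k = G(r)^2, f = G(x)^2, q = r^2 and y = E G(X)^2, so that E X^2 is
  x^2 + q * y. The total mass of k is left open here.\<close>

locale renewal_trichotomy =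
  fixes k f q y :: "real \<Rightarrow> real" and C c :: real
  assumes c_pos: "c > 0"
    and k: "causal k" "\<And>t. 0 \<le> k t" "\<And>t. k t \<le> C * exp (- c * t)"
    and f: "causal f" "\<And>t. 0 \<le> f t" "\<And>t. f t \<le> C * exp (- c * t)"
    and q: "causal q" "\<And>t. 0 \<le> q t" "\<And>t. q t \<le> C * exp (- c * t)"
    and y: "causal y" "\<And>t. 0 \<le> y t" "\<And>t. y t = f t + conv k y t"
    and k_right_cont: "\<And>t. (k \<longlongrightarrow> k t) (at_right t)"
begin

lemma C_nonneg: "0 \<le> C"
  using k(2,3)[of 0] by simp

lemma k_measurable[measurable]: "k \<in> borel_measurable borel" using k(1) by (rule causal_measurable)

lemma weighted_decay:
  assumes "causal h" "\<And>t. 0 \<le> h t" "\<And>t. h t \<le> C * exp (- c * t)"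
  shows "causal (\<lambda>t. exp (\<kappa> * t) * h t)" "\<And>t. 0 \<le> exp (\<kappa> * t) * h t"
    "\<And>t. exp (\<kappa> * t) * h t \<le> C * exp (- (c - \<kappa>) * t)"
    "\<kappa> < c \<Longrightarrow> integrable lborel (\<lambda>t. exp (\<kappa> * t) * h t)"
proof -
  show c1: "causal (\<lambda>t. exp (\<kappa> * t) * h t)" by (rule causal_exp_mult[OF assms(1)])
  show c2: "0 \<le> exp (\<kappa> * t) * h t" for t using assms(2) by simp
  show c3: "exp (\<kappa> * t) * h t \<le> C * exp (- (c - \<kappa>) * t)" for t
  proof -
    have "exp (\<kappa> * t) * h t \<le> exp (\<kappa> * t) * (C * exp (- c * t))" by (intro mult_left_mono assms) simp
    also have "\<dots> = C * exp (- (c - \<kappa>) * t)" by (simp add: algebra_simps exp_add exp_diff exp_minus divide_inverse)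
    finally show ?thesis .
  qed
  show "integrable lborel (\<lambda>t. exp (\<kappa> * t) * h t)" if "\<kappa> < c"
    by (rule exp_decay_integrable[of _ 0 C "c - \<kappa>"])
       (use that c2 c3 causal_measurable[OF c1] causal_neg[OF c1] in auto)
qed

lemma integrable_decay:
  assumes "causal h" "\<And>t. 0 \<le> h t" "\<And>t. h t \<le> C * exp (- c * t)"
  shows "integrable lborel h"
  using weighted_decay(4)[OF assms, of 0] c_pos by simp

text \<open>\<open>a\<close> stands for x^2 and dies out; \<open>conv q y\<close> tends to the limit
  of y times the integral of q.\<close>

lemma tendsto_of_total_one:
  assumes "(LBINT s. k s) = 1" and a: "\<And>t. 0 \<le> t \<Longrightarrow> \<bar>a t\<bar> \<le> A * exp (- d * t)" "d > 0"
  shows "((\<lambda>t. a t + conv q y t) \<longlongrightarrow> (LBINT s. f s) * (LBINT s. q s) / (LBINT s. s * k s)) at_top"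
    and "integrable lborel (\<lambda>s. s * k s)" and "0 < (LBINT s. s * k s)"
proof -
  interpret renewal_solution k C c f y
  proof
    show "(f \<longlongrightarrow> 0) at_top" by (rule exp_decay_tendsto_0[of _ C c]) (use f c_pos in auto)
  qed (use k f y c_pos assms k_right_cont integrable_decay[OF f] in auto)
  have "f t \<le> C" for t
    using exp_decay_bounded[of f C c t] causal_neg[OF f(1)] f c_pos by simp
  then have lim: "(y \<longlongrightarrow> (LBINT s. f s) / (LBINT s. s * k s)) at_top"
    by (intro nonneg_solution_tendsto y(2) f(2))
  obtain B where B: "\<And>t. \<bar>y t\<bar> \<le> B" using causal_tendsto_bounded[OF y(1) lim] by metis
  have "((\<lambda>t. conv q y t) \<longlongrightarrow> (LBINT s. q s) * ((LBINT s. f s) / (LBINT s. s * k s))) at_top"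
    by (rule conv_tendsto[OF q(1) y(1) integrable_decay[OF q] lim B])
  moreover have "(a \<longlongrightarrow> 0) at_top"
  proof (rule Lim_null_comparison)
    show "\<forall>\<^sub>F t in at_top. norm (a t) \<le> A * exp (- d * t)"
      using eventually_ge_at_top[of 0] by eventually_elim (use a in auto)
    show "((\<lambda>t. A * exp (- d * t)) \<longlongrightarrow> 0) at_top"
      using tendsto_mult_right_zero[OF exp_neg_tendsto_0[OF a(2)]] .
  qed
  ultimately have "((\<lambda>t. a t + conv q y t) \<longlongrightarrow> 0 + (LBINT s. q s) * ((LBINT s. f s) / (LBINT s. s * k s))) at_top"
    by (intro tendsto_add)
  then show "((\<lambda>t. a t + conv q y t) \<longlongrightarrow> (LBINT s. f s) * (LBINT s. q s) / (LBINT s. s * k s)) at_top"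
    by (simp add: mult.commute)
  show "integrable lborel (\<lambda>s. s * k s)" "0 < (LBINT s. s * k s)"
    by (rule moment_integrable, rule moment_pos)
qed

text \<open>For t \<ge> 0 the weight is at most 1 and for t < 0 everything vanishes, so the
  constants C and c survive.\<close>

lemma weighted:
  assumes "\<kappa> \<ge> 0"
  shows "renewal_trichotomy (\<lambda>t. exp (- \<kappa> * t) * k t) (\<lambda>t. exp (- \<kappa> * t) * f t)
    (\<lambda>t. exp (- \<kappa> * t) * q t) (\<lambda>t. exp (- \<kappa> * t) * y t) C c"
proof
  have decay: "exp (- \<kappa> * t) * h t \<le> C * exp (- c * t)"
    if "causal h" "\<And>t. 0 \<le> h t" "\<And>t. h t \<le> C * exp (- c * t)" for h t
  proof (cases "t < 0")
    case False
    then have "exp (- \<kappa> * t) * h t \<le> h t" using that assms by (intro mult_left_le_one_le) auto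
    then show ?thesis using that(3)[of t] by linarith
  qed (simp add: causal_neg[OF that(1)] C_nonneg)
  fix t
  show "exp (- \<kappa> * t) * k t \<le> C * exp (- c * t)" by (rule decay[OF k])
  show "exp (- \<kappa> * t) * f t \<le> C * exp (- c * t)" by (rule decay[OF f])
  show "exp (- \<kappa> * t) * q t \<le> C * exp (- c * t)" by (rule decay[OF q])
  show "exp (- \<kappa> * t) * y t = exp (- \<kappa> * t) * f t + conv (\<lambda>t. exp (- \<kappa> * t) * k t) (\<lambda>t. exp (- \<kappa> * t) * y t) t"
    unfolding conv_exp using y(3)[of t] by (simp add: distrib_left[symmetric])
  have "((\<lambda>t. exp (- \<kappa> * t)) \<longlongrightarrow> exp (- \<kappa> * t)) (at_right t)" by (intro tendsto_intros)
  then show "((\<lambda>t. exp (- \<kappa> * t) * k t) \<longlongrightarrow> exp (- \<kappa> * t) * k t) (at_right t)"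
    by (rule tendsto_mult[OF _ k_right_cont])
qed (use k(2) f(2) q(2) y(2) c_pos causal_exp_mult[OF k(1), of "- \<kappa>"] causal_exp_mult[OF f(1), of "- \<kappa>"]
    causal_exp_mult[OF q(1), of "- \<kappa>"] causal_exp_mult[OF y(1), of "- \<kappa>"] in simp_all)

text \<open>Intermediate value theorem for the Laplace transform of k, which exceeds 1 at 0 and is
  continuous by dominated convergence.\<close>

lemma exists_malthusian:
  assumes "(LBINT s. k s) > 1"
  obtains \<kappa> where "\<kappa> > 0" "(LBINT s. exp (- \<kappa> * s) * k s) = 1"
proof -
  define \<phi> where "\<phi> = (\<lambda>\<kappa>. LBINT s. exp (- \<kappa> * s) * k s)"
  have bound: "norm (exp (- \<kappa> * s) * k s) \<le> k s" if "\<kappa> \<ge> 0" for \<kappa> s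
  proof (cases "s < 0")
    case False
    then show ?thesis using k(2)[of s] that by (simp add: abs_mult mult_left_le_one_le)
  qed (use causal_neg[OF k(1)] in auto)
  have cont: "continuous_on {0..} \<phi>"
    unfolding continuous_on_sequentially comp_def \<phi>_def
  proof (intro allI ballI impI)
    fix X :: "nat \<Rightarrow> real" and \<kappa>
    assume "\<kappa> \<in> {0..}" and X: "(\<forall>n. X n \<in> {0..}) \<and> X \<longlonglongrightarrow> \<kappa>"
    show "(\<lambda>n. LBINT s. exp (- X n * s) * k s) \<longlonglongrightarrow> (LBINT s. exp (- \<kappa> * s) * k s)"
    proof (rule integral_dominated_convergence[where w=k])
      show "integrable lborel k" by (rule integrable_decay[OF k])
      show "AE s in lborel. (\<lambda>n. exp (- X n * s) * k s) \<longlonglongrightarrow> exp (- \<kappa> * s) * k s"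
        using X by (intro AE_I2 tendsto_intros) auto
      show "AE s in lborel. norm (exp (- X n * s) * k s) \<le> k s" for n
        using X bound[of "X n"] by (intro AE_I2) auto
    qed measurable
  qed
  \<comment> \<open>Since k \<le> C on the half-line, the transform at \<kappa> is at most C /
    \<kappa>; at C + 1 this is below 1, also when C = 0.\<close>
  have "\<phi> (C + 1) \<le> C / (C + 1)"
  proof -
    have "\<phi> (C + 1) \<le> (LBINT s. C * (indicator {0..} s * exp (- (C + 1) * s)))"
      unfolding \<phi>_def
    proof (rule integral_mono)
      show "integrable lborel (\<lambda>s. exp (- (C + 1) * s) * k s)"
        by (rule Bochner_Integration.integrable_bound[OF integrable_decay[OF k]])
           (use bound[of "C + 1"] C_nonneg k(2) in auto)
      show "integrable lborel (\<lambda>s. C * (indicat_real {0..} s * exp (- (C + 1) * s)))"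
        using C_nonneg by (intro integrable_mult_right integrable_exp_atLeast) simp
      fix s
      have "k s \<le> C" using exp_decay_bounded[of k C c s] causal_neg[OF k(1)] k c_pos by simp
      then show "exp (- (C + 1) * s) * k s \<le> C * (indicator {0..} s * exp (- (C + 1) * s))"
        using causal_neg[OF k(1), of s] by (cases "s < 0") auto
    qed
    also have "\<dots> = C / (C + 1)" using integral_exp_atLeast[of "C + 1" 0] C_nonneg by simp
    finally show ?thesis .
  qed
  also have "\<dots> \<le> 1" using C_nonneg by simp
  finally have "\<exists>\<kappa>\<ge>0. \<kappa> \<le> C + 1 \<and> \<phi> \<kappa> = 1"
  proof (intro IVT2')
    show "1 \<le> \<phi> 0" using assms by (simp add: \<phi>_def)
    show "continuous_on {0..C + 1} \<phi>" by (rule continuous_on_subset[OF cont]) auto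
  qed (use C_nonneg in auto)
  then obtain \<kappa> where "\<kappa> \<ge> 0" "\<phi> \<kappa> = 1" by auto
  moreover have "\<kappa> \<noteq> 0" using assms \<open>\<phi> \<kappa> = 1\<close> by (auto simp: \<phi>_def)
  ultimately show ?thesis using that[of \<kappa>] by (simp add: \<phi>_def)
qed

text \<open>A mass below 1 stays below 1 under a weight exp(\<kappa> t) with small \<kappa>. The
  weighted renewal equation is then a contraction and bounds exp(\<kappa> t) y(t); half of the rate
  is given up to pass from boundedness to convergence to 0.\<close>

lemma tendsto_of_total_less_one:
  assumes "(LBINT s. k s) < 1" and a: "\<And>t. 0 \<le> t \<Longrightarrow> \<bar>a t\<bar> \<le> A * exp (- d * t)" "d > 0"
  obtains \<kappa> where "\<kappa> > 0" "((\<lambda>t. exp (\<kappa> * t) * (a t + conv q y t)) \<longlongrightarrow> 0) at_top"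
proof -
  \<comment> \<open>The rate must stay below c, so that exp(e s) k(s) is integrable and dominates
    the weights K n, and must not exceed the rate d of \<open>a\<close>.\<close>
  define e where "e = min (c / 2) d"
  have e: "e > 0" "e \<le> c / 2" "e \<le> d" using c_pos a(2) by (auto simp: e_def)
  define K where "K = (\<lambda>n. e / real (Suc n))"
  have K: "K n > 0" "K n \<le> e" for n
    using e by (auto simp: K_def field_simps)
  have "(\<lambda>n. LBINT s. exp (K n * s) * k s) \<longlonglongrightarrow> (LBINT s. exp (0 * s) * k s)"
  proof (rule integral_dominated_convergence[where w="\<lambda>s. exp (e * s) * k s"])
    show "integrable lborel (\<lambda>s. exp (e * s) * k s)" using e c_pos by (intro weighted_decay(4)[OF k]) auto
    have "K \<longlonglongrightarrow> 0" unfolding K_def by (rule LIMSEQ_Suc[OF lim_const_over_n])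
    then show "AE s in lborel. (\<lambda>n. exp (K n * s) * k s) \<longlonglongrightarrow> exp (0 * s) * k s"
      by (intro AE_I2 tendsto_intros)
    show "AE s in lborel. norm (exp (K n * s) * k s) \<le> exp (e * s) * k s" for n
    proof (rule AE_I2)
      fix s show "norm (exp (K n * s) * k s) \<le> exp (e * s) * k s"
      proof (cases "s < 0")
        case False
        then have "K n * s \<le> e * s" using K by (intro mult_right_mono) auto
        then show ?thesis using k(2)[of s] by (simp add: abs_mult mult_right_mono)
      qed (use causal_neg[OF k(1)] in auto)
    qed
  qed measurable
  then have "\<forall>\<^sub>F n in sequentially. (LBINT s. exp (K n * s) * k s) < 1"
    using assms(1) by (intro order_tendstoD(2)) auto
  then obtain n where n: "(LBINT s. exp (K n * s) * k s) < 1"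
    using eventually_happens'[OF sequentially_bot] by blast
  define \<kappa> where "\<kappa> = K n"
  have \<kappa>: "\<kappa> > 0" "\<kappa> < c" "\<kappa> \<le> d" using K[of n] e c_pos by (auto simp: \<kappa>_def)
  define \<theta> where "\<theta> = (LBINT s. exp (\<kappa> * s) * k s)"
  note wk = weighted_decay[OF k, of \<kappa>] and wf = weighted_decay[OF f, of \<kappa>] and wq = weighted_decay[OF q, of \<kappa>]
  have "0 \<le> \<theta>" "\<theta> < 1" using n k(2) by (auto simp: \<theta>_def \<kappa>_def intro!: integral_nonneg_AE)
  define w where "w = (\<lambda>t. exp (\<kappa> * t) * y t)"
  have w: "causal w" "\<And>t. 0 \<le> w t" unfolding w_def using causal_exp_mult[OF y(1)] y(2) by auto
  have w_eq: "w t = exp (\<kappa> * t) * f t + conv (\<lambda>t. exp (\<kappa> * t) * k t) w t" for t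
    unfolding w_def conv_exp using y(3)[of t] by (simp add: distrib_left[symmetric])
  have conv_le: "conv h w t \<le> (LBINT s. h s) * Y"
    if h: "causal h" "\<And>t. 0 \<le> h t" "integrable lborel h" and Y: "\<And>s. s \<le> t \<Longrightarrow> w s \<le> Y" for h t Y
  proof -
    have i: "integrable lborel (\<lambda>s. h (t - s))"
      using lborel_integrable_real_affine[OF h(3), of "-1" t] by simp
    have "conv h w t \<le> (LBINT s. h (t - s) * Y)"
      unfolding conv_def
    proof (rule integral_mono)
      show "integrable lborel (\<lambda>s. h (t - s) * w s)" by (intro causal_integrable_conv h w)
      show "integrable lborel (\<lambda>s. h (t - s) * Y)" using i by simp
      fix s show "h (t - s) * w s \<le> h (t - s) * Y"
        using Y[of s] h(2)[of "t - s"] causal_neg[OF h(1), of "t - s"]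
        by (cases "s \<le> t") (auto intro: mult_left_mono)
    qed
    also have "\<dots> = (LBINT s. h s) * Y"
      by (subst (2) lborel_integral_real_affine[where c="-1" and t=t]) auto
    finally show ?thesis .
  qed
  have w_bound: "\<bar>w t\<bar> \<le> C / (1 - \<theta>)" for t
  proof (rule running_sup_bound[OF w(1) \<open>0 \<le> \<theta>\<close> \<open>\<theta> < 1\<close> C_nonneg])
    fix T Y t assume Y: "\<And>s. s \<le> T \<Longrightarrow> \<bar>w s\<bar> \<le> Y" and "t \<le> T"
    have "conv (\<lambda>t. exp (\<kappa> * t) * k t) w t \<le> \<theta> * Y"
      unfolding \<theta>_def using Y \<open>t \<le> T\<close> \<kappa> by (intro conv_le wk) (force simp: abs_le_iff)+
    moreover have "exp (\<kappa> * t) * f t \<le> C"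
      using exp_decay_bounded[of "\<lambda>t. exp (\<kappa> * t) * f t" C "c - \<kappa>" t] causal_neg[OF wf(1)] wf(2,3) \<kappa> by simp
    ultimately show "\<bar>w t\<bar> \<le> C + \<theta> * Y" using w_eq[of t] w(2)[of t] by simp
  qed
  define B where "B = \<bar>A\<bar> + (LBINT s. exp (\<kappa> * s) * q s) * (C / (1 - \<theta>))"
  have bound: "\<bar>exp (\<kappa> * t) * (a t + conv q y t)\<bar> \<le> B" if "t \<ge> 0" for t
  proof -
    have "\<bar>exp (\<kappa> * t) * a t\<bar> \<le> exp (\<kappa> * t) * (A * exp (- d * t))"
      using a(1)[OF that] by (simp add: abs_mult)
    also have "\<dots> = A * exp ((\<kappa> - d) * t)" by (simp add: algebra_simps exp_add exp_diff exp_minus divide_inverse)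
    also have "\<dots> \<le> \<bar>A\<bar> * 1"
      using \<kappa> that by (intro mult_mono) (auto simp: mult_nonpos_nonneg)
    finally have "\<bar>exp (\<kappa> * t) * a t\<bar> \<le> \<bar>A\<bar>" by simp
    moreover have "exp (\<kappa> * t) * conv q y t = conv (\<lambda>t. exp (\<kappa> * t) * q t) w t"
      by (simp add: w_def conv_exp)
    moreover have "conv (\<lambda>t. exp (\<kappa> * t) * q t) w t \<le> (LBINT s. exp (\<kappa> * s) * q s) * (C / (1 - \<theta>))"
      using w_bound \<kappa> by (intro conv_le wq) (auto simp: abs_le_iff)
    moreover have "0 \<le> conv (\<lambda>t. exp (\<kappa> * t) * q t) w t"
      unfolding conv_def using wq(2) w(2) by (intro integral_nonneg_AE) auto
    ultimately show ?thesis unfolding B_def distrib_left by linarith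
  qed
  have "((\<lambda>t. exp (\<kappa> / 2 * t) * (a t + conv q y t)) \<longlongrightarrow> 0) at_top"
  proof (rule Lim_null_comparison)
    show "\<forall>\<^sub>F t in at_top. norm (exp (\<kappa> / 2 * t) * (a t + conv q y t)) \<le> B * exp (- (\<kappa> / 2) * t)"
      using eventually_ge_at_top[of 0]
    proof eventually_elim
      case (elim t)
      have "exp (\<kappa> / 2 * t) = exp (- (\<kappa> / 2) * t) * exp (\<kappa> * t)"
        by (simp add: exp_add[symmetric])
      then have "norm (exp (\<kappa> / 2 * t) * (a t + conv q y t))
          = exp (- (\<kappa> / 2) * t) * \<bar>exp (\<kappa> * t) * (a t + conv q y t)\<bar>"
        by (simp add: abs_mult mult.assoc)
      also have "\<dots> \<le> exp (- (\<kappa> / 2) * t) * B" by (intro mult_left_mono bound elim) simp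
      finally show ?case by (simp add: mult.commute)
    qed
    show "((\<lambda>t. B * exp (- (\<kappa> / 2) * t)) \<longlongrightarrow> 0) at_top"
      using \<kappa> by (intro tendsto_mult_right_zero exp_neg_tendsto_0) simp
  qed
  then show ?thesis using that[of "\<kappa> / 2"] \<kappa> by simp
qed

text \<open>With the \<kappa> that gives exp(-\<kappa> s) k(s) total mass 1, the weighted data form
  a proper renewal problem; \<open>conv_exp\<close> translates its limit back.\<close>

lemma tendsto_of_total_greater_one:
  assumes "(LBINT s. k s) > 1" and a: "\<And>t. 0 \<le> t \<Longrightarrow> \<bar>a t\<bar> \<le> A * exp (- d * t)" "d > 0"
  obtains \<kappa> where "\<kappa> > 0"
    "integrable lborel (\<lambda>s. exp (- \<kappa> * s) * f s)" "integrable lborel (\<lambda>s. exp (- \<kappa> * s) * q s)"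
    "integrable lborel (\<lambda>s. s * (exp (- \<kappa> * s) * k s))" "0 < (LBINT s. s * (exp (- \<kappa> * s) * k s))"
    "((\<lambda>t. exp (- \<kappa> * t) * (a t + conv q y t)) \<longlongrightarrow>
      (LBINT s. exp (- \<kappa> * s) * f s) * (LBINT s. exp (- \<kappa> * s) * q s)
        / (LBINT s. s * (exp (- \<kappa> * s) * k s))) at_top"
proof -
  obtain \<kappa> where \<kappa>: "\<kappa> > 0" "(LBINT s. exp (- \<kappa> * s) * k s) = 1"
    using exists_malthusian[OF assms(1)] by metis
  interpret w: renewal_trichotomy "\<lambda>t. exp (- \<kappa> * t) * k t" "\<lambda>t. exp (- \<kappa> * t) * f t"
    "\<lambda>t. exp (- \<kappa> * t) * q t" "\<lambda>t. exp (- \<kappa> * t) * y t" C c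
    by (rule weighted) (use \<kappa> in simp)
  have a': "\<bar>exp (- \<kappa> * t) * a t\<bar> \<le> A * exp (- d * t)" if "0 \<le> t" for t
  proof -
    have "\<bar>exp (- \<kappa> * t) * a t\<bar> \<le> \<bar>a t\<bar>"
      using \<kappa> that by (simp add: abs_mult mult_left_le_one_le)
    then show ?thesis using a(1)[OF that] by linarith
  qed
  note lim = w.tendsto_of_total_one[OF \<kappa>(2) a' a(2)]
  have "(\<lambda>t. exp (- \<kappa> * t) * a t + conv (\<lambda>t. exp (- \<kappa> * t) * q t) (\<lambda>t. exp (- \<kappa> * t) * y t) t)
      = (\<lambda>t. exp (- \<kappa> * t) * (a t + conv q y t))"
    unfolding conv_exp by (simp add: distrib_left)
  then show ?thesis
    using that[OF \<kappa>(1) w.integrable_decay[OF w.f] w.integrable_decay[OF w.q] lim(2,3)] lim(1) by simp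
qed

end

section \<open>Measures on a delay interval\<close>

text \<open>The measure lives on the whole line and is concentrated on [-\<alpha>, 0] almost
  everywhere, so functions on the line are integrated against it without restriction and joint
  measurability is that of Borel functions.\<close>

locale delay_measure = finite_measure m for m :: "real measure" +
  fixes \<alpha> :: real
  assumes sets_m[measurable_cong]: "sets m = sets borel"
    and support: "AE u in m. - \<alpha> \<le> u \<and> u \<le> 0"
    and delay_nonneg: "0 \<le> \<alpha>"
begin

definition mass :: real where "mass = measure m UNIV"

text \<open>The functional of m applied to the segment of f at s, in other words the convolution of
  f with the reflection of m.\<close>

definition shift :: "(real \<Rightarrow> real) \<Rightarrow> real \<Rightarrow> real" where
  "shift f s = (\<integral>u. f (s + u) \<partial>m)"

lemma space_m: "space m = UNIV"
  using sets_eq_imp_space_eq[OF sets_m] by simp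

lemma mass_nonneg: "0 \<le> mass" by (simp add: mass_def)

lemma integral_const_m: "(\<integral>u. (c::real) \<partial>m) = mass * c"
  by (simp add: mass_def space_m)

lemma shift_integrable_bound:
  assumes [measurable]: "f \<in> borel_measurable borel"
    and B: "\<And>v. s - \<alpha> \<le> v \<Longrightarrow> v \<le> s \<Longrightarrow> \<bar>f v\<bar> \<le> B"
  shows "integrable m (\<lambda>u. f (s + u))" "\<bar>shift f s\<bar> \<le> mass * B"
proof -
  have ae: "AE u in m. norm (f (s + u)) \<le> B"
    using support by eventually_elim (auto intro!: B)
  show i: "integrable m (\<lambda>u. f (s + u))"
    by (rule integrable_const_bound[OF ae]) measurable
  have "norm (shift f s) \<le> (\<integral>u. norm (f (s + u)) \<partial>m)"
    unfolding shift_def by (rule integral_norm_bound)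
  also have "\<dots> \<le> (\<integral>u. B \<partial>m)"
    by (rule integral_mono_AE) (use i ae in auto)
  finally show "\<bar>shift f s\<bar> \<le> mass * B" by (simp only: integral_const_m real_norm_def)
qed

lemma shift_integrable:
  assumes "causal f"
  shows "integrable m (\<lambda>u. f (s + u))"
proof -
  obtain B where "B > 0" "\<And>t. t \<le> s \<Longrightarrow> \<bar>f t\<bar> \<le> B" using causal_bound[OF assms] by metis
  then show ?thesis by (intro shift_integrable_bound causal_measurable[OF assms]) auto
qed

lemma shift_neg:
  assumes "\<And>t. t < 0 \<Longrightarrow> f t = 0" "s < 0"
  shows "shift f s = 0"
  unfolding shift_def using support
  by (intro integral_eq_zero_AE, elim eventually_mono) (use assms in auto)

lemma shift_measurable:
  assumes [measurable]: "f \<in> borel_measurable borel"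
  shows "shift f \<in> borel_measurable borel"
  unfolding shift_def[abs_def] by measurable

lemma causal_shift:
  assumes "causal f"
  shows "causal (shift f)"
proof (rule causalI)
  fix T :: real
  obtain B where "B > 0" "\<And>t. t \<le> T \<Longrightarrow> \<bar>f t\<bar> \<le> B" using causal_bound[OF assms] by metis
  then have "\<bar>shift f t\<bar> \<le> mass * B" if "t \<le> T" for t
    using that by (intro shift_integrable_bound causal_measurable[OF assms]) auto
  then show "\<exists>B. \<forall>t. 0 \<le> t \<and> t \<le> T \<longrightarrow> \<bar>shift f t\<bar> \<le> B" by blast
qed (use assms shift_measurable causal_measurable shift_neg causal_neg in blast)+

text \<open>\<open>shift\<close> is itself a convolution with a measure, so this is associativity.
  Absolute integrability for Fubini is read off from \<open>shift\<close> of |f|.\<close>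

lemma conv_shift:
  assumes "causal f" "causal g"
  shows "conv (shift f) g t = shift (conv f g) t"
proof -
  have [measurable]: "f \<in> borel_measurable borel" "g \<in> borel_measurable borel"
    using assms by (auto simp: causal_measurable)
  interpret pair_sigma_finite lborel m ..
  obtain B where B: "B > 0" "\<And>s. s \<le> t \<Longrightarrow> \<bar>f s\<bar> \<le> B" using causal_bound[OF assms(1)] by metis
  obtain C where C: "C > 0" "\<And>s. s \<le> t \<Longrightarrow> \<bar>g s\<bar> \<le> C" using causal_bound[OF assms(2)] by metis
  let ?F = "\<lambda>s u. f (t - s + u) * g s"
  have abs_shift: "(\<integral>u. norm (?F s u) \<partial>m) = shift (\<lambda>v. \<bar>f v\<bar>) (t - s) * \<bar>g s\<bar>" for s
    by (simp add: shift_def abs_mult)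
  have f': "causal (\<lambda>v. \<bar>f v\<bar>)" "causal (\<lambda>v. \<bar>g v\<bar>)"
    using assms by (auto simp: causal_def)
  have "integrable (lborel \<Otimes>\<^sub>M m) (\<lambda>(s, u). ?F s u)"
  proof (rule Fubini_integrable)
    show "integrable lborel (\<lambda>s. \<integral>u. norm (case (s, u) of (s, u) \<Rightarrow> ?F s u) \<partial>m)"
      using causal_integrable_conv[OF causal_shift[OF f'(1)] f'(2)] by (simp only: prod.case abs_shift)
    show "AE s in lborel. integrable m (\<lambda>u. case (s, u) of (s, u) \<Rightarrow> ?F s u)"
      using shift_integrable[OF assms(1)] by simp
  qed measurable
  from Fubini_integral[OF this]
  have "(LBINT s. (\<integral>u. ?F s u \<partial>m)) = (\<integral>u. (LBINT s. ?F s u) \<partial>m)" by simp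
  then show ?thesis
    by (simp add: conv_def shift_def algebra_simps)
qed

lemma shift_tendsto_0:
  assumes "causal f" "(f \<longlongrightarrow> 0) at_top"
  shows "(shift f \<longlongrightarrow> 0) at_top"
proof (rule tendstoI)
  fix e :: real assume "e > 0"
  define d where "d = e / (2 * (mass + 1))"
  have "d > 0" using \<open>e > 0\<close> mass_nonneg by (simp add: d_def)
  from tendstoD[OF assms(2) this] obtain T where T: "\<And>t. t \<ge> T \<Longrightarrow> \<bar>f t\<bar> < d"
    unfolding eventually_at_top_linorder by (auto simp: dist_norm)
  have "dist (shift f t) 0 < e" if "t \<ge> T + \<alpha>" for t
  proof -
    have "\<bar>shift f t\<bar> \<le> mass * d"
    proof (rule shift_integrable_bound(2)[OF causal_measurable[OF assms(1)]])
      fix v assume "t - \<alpha> \<le> v"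
      then have "T \<le> v" using that by simp
      then show "\<bar>f v\<bar> \<le> d" using T[of v] by simp
    qed
    also have "\<dots> \<le> (mass + 1) * d" using \<open>d > 0\<close> by simp
    also have "\<dots> = e / 2" using mass_nonneg by (simp add: d_def field_simps)
    finally show ?thesis using \<open>e > 0\<close> by simp
  qed
  then show "\<forall>\<^sub>F t in at_top. dist (shift f t) 0 < e" unfolding eventually_at_top_linorder by blast
qed

lemma shift_exp_decay:
  assumes "f \<in> borel_measurable borel" "\<And>v. - \<alpha> \<le> v \<Longrightarrow> \<bar>f v\<bar> \<le> C * exp (- c * v)" "c > 0" "t \<ge> 0"
  shows "\<bar>shift f t\<bar> \<le> mass * C * exp (c * \<alpha>) * exp (- c * t)"
proof -
  have "0 \<le> C * exp (- c * 0)" using assms(2)[of 0] delay_nonneg by (metis abs_ge_zero neg_le_0_iff_le order_trans)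
  then have "0 \<le> C" by simp
  have "\<bar>shift f t\<bar> \<le> mass * (C * exp (- c * (t - \<alpha>)))"
  proof (rule shift_integrable_bound)
    fix v assume v: "t - \<alpha> \<le> v" "v \<le> t"
    then have "\<bar>f v\<bar> \<le> C * exp (- c * v)" using assms by (intro assms(2)) auto
    also have "\<dots> \<le> C * exp (- c * (t - \<alpha>))" using v \<open>0 \<le> C\<close> \<open>c > 0\<close> by (intro mult_left_mono) auto
    finally show "\<bar>f v\<bar> \<le> C * exp (- c * (t - \<alpha>))" .
  qed (use assms in auto)
  then show ?thesis by (simp add: algebra_simps exp_add exp_diff exp_minus divide_inverse)
qed

text \<open>A causal function continuous on [0, \<infinity>) is right continuous everywhere, also at
  its possible jump at 0, and dominated convergence passes this on to the average. Continuity from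
  the left can fail where an atom of m moves that jump.\<close>

lemma shift_right_continuous:
  assumes "causal f" "continuous_on {0..} f"
  shows "(shift f \<longlongrightarrow> shift f t) (at_right t)"
  unfolding tendsto_at_iff_sequentially comp_def
proof (intro allI impI)
  fix X :: "nat \<Rightarrow> real"
  assume "\<forall>i. X i \<in> {t<..} - {t}" and X: "X \<longlonglongrightarrow> t"
  then have pos: "X i > t" for i by auto
  have [measurable]: "f \<in> borel_measurable borel" using assms by (simp add: causal_measurable)
  have right: "(f \<longlongrightarrow> f v) (at_right v)" for v
  proof (cases "v = 0")
    case True
    have "(f \<longlongrightarrow> f 0) (at 0 within {0..})" using assms(2) by (simp add: continuous_on_def)
    then have "(f \<longlongrightarrow> f 0) (at_right 0)" by (rule tendsto_within_subset) auto
    then show ?thesis using True by simp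
  next
    case False
    then have "isCont f v" by (rule causal_isCont[OF assms])
    then show ?thesis unfolding isCont_def by (rule tendsto_within_subset) simp
  qed
  have "Bseq X" using X by (intro convergent_imp_Bseq) (auto simp: convergent_def)
  then obtain T where T: "T > 0" "\<And>n. \<bar>X n\<bar> \<le> T" by (auto elim!: BseqE)
  obtain B where B: "B > 0" "\<And>s. s \<le> T \<Longrightarrow> \<bar>f s\<bar> \<le> B" using causal_bound[OF assms(1)] by metis
  show "(\<lambda>n. shift f (X n)) \<longlonglongrightarrow> shift f t"
    unfolding shift_def
  proof (rule integral_dominated_convergence[where w="\<lambda>_. B"])
    show "AE u in m. (\<lambda>n. f (X n + u)) \<longlonglongrightarrow> f (t + u)"
    proof (rule AE_I2)
      fix u
      have ne: "X i \<noteq> t" for i using pos[of i] by simp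
      have "filterlim (\<lambda>i. X i + u) (at_right (t + u)) sequentially"
        unfolding filterlim_at using pos ne tendsto_add[OF X tendsto_const, of u] by auto
      then show "(\<lambda>n. f (X n + u)) \<longlonglongrightarrow> f (t + u)" by (rule filterlim_compose[OF right])
    qed
    show "AE u in m. norm (f (X n + u)) \<le> B" for n
      using support
    proof eventually_elim
      case (elim u)
      moreover have "X n \<le> T" using T(2)[of n] by (simp add: abs_le_iff)
      ultimately show ?case using B(2)[of "X n + u"] by simp
    qed
  qed auto
qed

end

section \<open>Delay functionals\<close>

locale delay_functional =
  p: delay_measure mp \<alpha> + n: delay_measure mn \<alpha> for mp mn :: "real measure" and \<alpha> :: real
begin

text \<open>An upper bound of the total variation of the difference, since the two parts may
  overlap.\<close>

definition Mass :: real where "Mass = p.mass + n.mass"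

definition Shift :: "(real \<Rightarrow> real) \<Rightarrow> real \<Rightarrow> real" where
  "Shift f s = p.shift f s - n.shift f s"

lemma Mass_nonneg: "0 \<le> Mass" using p.mass_nonneg n.mass_nonneg by (simp add: Mass_def)

lemma Shift_measurable: "f \<in> borel_measurable borel \<Longrightarrow> Shift f \<in> borel_measurable borel"
  unfolding Shift_def[abs_def] using p.shift_measurable n.shift_measurable by auto

lemma causal_Shift: "causal f \<Longrightarrow> causal (Shift f)"
  unfolding Shift_def[abs_def] by (intro causal_diff p.causal_shift n.causal_shift)

lemma Shift_bound:
  assumes "f \<in> borel_measurable borel" "\<And>v. s - \<alpha> \<le> v \<Longrightarrow> v \<le> s \<Longrightarrow> \<bar>f v\<bar> \<le> B"
  shows "\<bar>Shift f s\<bar> \<le> Mass * B"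
  using p.shift_integrable_bound(2)[where s=s, OF assms] n.shift_integrable_bound(2)[where s=s, OF assms]
  unfolding Shift_def Mass_def by (simp add: distrib_right)

lemma conv_Shift:
  assumes "causal f" "causal g"
  shows "conv (Shift f) g t = Shift (conv f g) t"
  unfolding Shift_def[abs_def]
  using assms by (simp add: conv_diff_left p.causal_shift n.causal_shift p.conv_shift n.conv_shift)

text \<open>Both sides are \<open>Shift\<close> of the convolution of f and g.\<close>

lemma conv_Shift_swap:
  assumes "causal f" "causal g"
  shows "conv f (Shift g) t = conv (Shift f) g t"
proof -
  have "conv f (Shift g) t = Shift (conv g f) t" using assms by (simp add: conv_commute[of f] conv_Shift)
  also have "conv g f = conv f g" by (rule ext) (rule conv_commute)
  finally show ?thesis using assms by (simp add: conv_Shift)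
qed

lemma Shift_exp_decay:
  assumes "f \<in> borel_measurable borel" "\<And>v. - \<alpha> \<le> v \<Longrightarrow> \<bar>f v\<bar> \<le> C * exp (- c * v)" "c > 0" "t \<ge> 0"
  shows "\<bar>Shift f t\<bar> \<le> Mass * C * exp (c * \<alpha>) * exp (- c * t)"
  using p.shift_exp_decay[OF assms] n.shift_exp_decay[OF assms]
  unfolding Shift_def Mass_def by (simp add: distrib_right)

lemma Shift_right_continuous:
  "causal f \<Longrightarrow> continuous_on {0..} f \<Longrightarrow> (Shift f \<longlongrightarrow> Shift f t) (at_right t)"
  unfolding Shift_def by (intro tendsto_diff p.shift_right_continuous n.shift_right_continuous)

lemma Shift_cong:
  assumes [measurable]: "f \<in> borel_measurable borel" "g \<in> borel_measurable borel"
    and "\<And>v. s - \<alpha> \<le> v \<Longrightarrow> v \<le> s \<Longrightarrow> f v = g v"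
  shows "Shift f s = Shift g s"
proof -
  have "p.shift f s = p.shift g s" unfolding p.shift_def
  proof (rule integral_cong_AE)
    show "AE u in mp. f (s + u) = g (s + u)"
      using p.support by eventually_elim (auto intro: assms(3))
  qed measurable
  moreover have "n.shift f s = n.shift g s" unfolding n.shift_def
  proof (rule integral_cong_AE)
    show "AE u in mn. f (s + u) = g (s + u)"
      using n.support by eventually_elim (auto intro: assms(3))
  qed measurable
  ultimately show ?thesis by (simp add: Shift_def)
qed

end

section \<open>The deterministic delay equation\<close>

text \<open>The integrated equation r = H + H * F(r) with H = \<open>heaviside\<close>, an identity
  on the whole line because both sides vanish for negative times.\<close>

locale delay_equation = delay_functional +
  fixes r :: "real \<Rightarrow> real"
  assumes r_causal: "causal r" and r_continuous: "continuous_on {0..} r"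
    and r_eq: "\<And>t. r t = heaviside t + conv heaviside (Shift r) t"
begin

lemma r_measurable[measurable]: "r \<in> borel_measurable borel"
  using r_causal by (rule causal_measurable)

lemma conv_heaviside_Shift_r: "conv heaviside (Shift r) = (\<lambda>s. r s - heaviside s)"
proof (rule ext)
  fix s show "conv heaviside (Shift r) s = r s - heaviside s" using r_eq[of s] by simp
qed

text \<open>Convolve D = N + H * F(D) with r. Moving F across and using the equation of r, the last
  term becomes H * F(r) * D = (r - H) * D, so r * D cancels and H * D remains.\<close>

lemma resolvent:
  assumes D: "causal D" and N: "causal N"
    and eq: "\<And>t. D t = N t + conv heaviside (Shift D) t"
  shows "conv r N t = conv heaviside D t"
proof -
  note c = r_causal causal_heaviside causal_Shift causal_conv D
  have "conv r (conv heaviside (Shift D)) t = conv (conv r heaviside) (Shift D) t"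
    by (simp add: conv_assoc c)
  also have "conv r heaviside = conv heaviside r" by (rule ext) (rule conv_commute)
  also have "conv (conv heaviside r) (Shift D) t = conv heaviside (conv r (Shift D)) t"
    by (simp add: conv_assoc c)
  also have "conv r (Shift D) = conv (Shift r) D" by (rule ext) (rule conv_Shift_swap[OF r_causal D])
  also have "conv heaviside (conv (Shift r) D) t = conv (conv heaviside (Shift r)) D t"
    by (simp add: conv_assoc c)
  also note conv_heaviside_Shift_r
  finally have *: "conv r (conv heaviside (Shift D)) t = conv r D t - conv heaviside D t"
    by (simp add: conv_diff_left c)
  have "N = (\<lambda>s. D s - conv heaviside (Shift D) s)" by (rule ext) (simp add: eq)
  then have "conv r N t = conv r (\<lambda>s. D s - conv heaviside (Shift D) s) t" by simp
  also have "\<dots> = conv heaviside D t" by (simp add: conv_diff_right c *)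
  finally show ?thesis .
qed

text \<open>F(r) is the rate of change of r after time 0, so this is the integral of r(t - s) dN(s)
  after integration by parts, meaningful for paths N of unbounded variation. Both sides agree after
  one integration, by \<open>resolvent\<close>.\<close>

lemma variation_of_constants:
  assumes D: "causal D" "continuous_on {0..} D" and N: "causal N" "continuous_on {0..} N"
    and eq: "\<And>t. D t = N t + conv heaviside (Shift D) t"
  shows "D t = N t + conv (Shift r) N t"
proof (rule conv_heaviside_inj[where f=D and g="\<lambda>t. N t + conv (Shift r) N t"])
  note c = r_causal causal_heaviside causal_Shift causal_conv N(1)
  show "causal (\<lambda>t. N t + conv (Shift r) N t)" by (intro causal_add c)
  have "conv (Shift r) N = conv N (Shift r)" by (rule ext) (rule conv_commute)
  then have "continuous_on {0..} (conv (Shift r) N)" using continuous_on_conv[OF N] by (simp add: c)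
  then show "continuous_on {0..} (\<lambda>t. N t + conv (Shift r) N t)" by (intro continuous_on_add N)
  fix t
  have "conv heaviside (\<lambda>t. N t + conv (Shift r) N t) t
      = conv heaviside N t + conv (conv heaviside (Shift r)) N t"
    by (simp add: conv_add_right conv_assoc c)
  also have "\<dots> = conv r N t" unfolding conv_heaviside_Shift_r by (simp add: conv_diff_left c)
  also have "\<dots> = conv heaviside D t" by (rule resolvent[OF D(1) N(1) eq])
  finally show "conv heaviside D t = conv heaviside (\<lambda>t. N t + conv (Shift r) N t) t" ..
qed (use D in auto)

text \<open>Growth factor of a solution whose initial segment is at most 1 in absolute value: |r(t)|
  carries the value at time 0, the integral of |r| over [t - \<alpha>, t] the influence of the
  earlier part of the segment.\<close>

definition window :: "real \<Rightarrow> real" where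
  "window t = \<bar>r t\<bar> + Mass * (LBINT s. indicator {0..\<alpha>} s * \<bar>r (t - s)\<bar>)"

lemma r_abs_causal: "causal (\<lambda>t. \<bar>r t\<bar>)"
  using r_causal by (auto simp: causal_def)

lemma window_indicator_causal: "causal (indicator {0..\<alpha>} :: real \<Rightarrow> real)"
  by (rule causal_bounded[of _ 1]) (auto simp: indicator_def)

lemma window_eq_conv: "window t = \<bar>r t\<bar> + Mass * conv (\<lambda>t. \<bar>r t\<bar>) (indicator {0..\<alpha>}) t"
  unfolding window_def conv_def by (simp add: mult.commute)

text \<open>The history on [-\<alpha>, 0) acts on [0, \<infinity>) as a forcing h, bounded by
  \<open>Mass\<close> times B and zero after time \<alpha>. The solution is then x(0) r + r * h, and
  its two terms correspond to those of \<open>window\<close>.\<close>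

lemma solution_le_window:
  assumes [measurable]: "x \<in> borel_measurable borel"
    and cont: "continuous_on {0..} x"
    and B: "\<And>v. - \<alpha> \<le> v \<Longrightarrow> v \<le> 0 \<Longrightarrow> \<bar>x v\<bar> \<le> B"
    and eq: "\<And>t. t \<ge> 0 \<Longrightarrow> x t = x 0 + (LBINT s:{0..t}. Shift x s)"
    and "t \<ge> 0"
  shows "\<bar>x t\<bar> \<le> B * window t"
proof -
  have "0 \<le> B" using B[of 0] p.delay_nonneg by simp
  define D where "D = (\<lambda>t. heaviside t * x t)"
  \<comment> \<open>Time 0 is left to \<open>D\<close>, so that \<open>D\<close> and
    \<open>past\<close> add up to x on [-\<alpha>, \<infinity>) without counting it twice.\<close>
  define past where "past = (\<lambda>v. indicator {- \<alpha>..<0} v * x v)"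
  define h where "h = (\<lambda>s. heaviside s * Shift past s)"
  have D: "causal D" unfolding D_def by (rule causal_continuous_on[OF cont])
  have Dc: "continuous_on {0..} D"
    by (rule continuous_on_eq[OF cont]) (auto simp: D_def heaviside_def)
  have [measurable]: "past \<in> borel_measurable borel" "D \<in> borel_measurable borel"
    using causal_measurable[OF D] unfolding past_def by auto
  have past_bound: "\<bar>past v\<bar> \<le> B" for v
    using B[of v] \<open>0 \<le> B\<close> by (auto simp: past_def indicator_def)
  have hB: "\<bar>h s\<bar> \<le> Mass * B" for s
  proof -
    have "\<bar>Shift past s\<bar> \<le> Mass * B" by (rule Shift_bound) (auto intro: past_bound)
    then show ?thesis using \<open>0 \<le> B\<close> Mass_nonneg by (auto simp: h_def heaviside_def indicator_def)
  qed
  have h0: "h s = 0" if "s > \<alpha>" for s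
  proof -
    have "Shift past s = Shift (\<lambda>_. 0) s"
      by (rule Shift_cong) (use that in \<open>auto simp: past_def\<close>)
    then show ?thesis by (simp add: h_def Shift_def p.shift_def n.shift_def)
  qed
  have [measurable]: "h \<in> borel_measurable borel"
    using Shift_measurable[of past] causal_measurable[OF causal_heaviside] unfolding h_def by auto
  have h: "causal h"
    by (rule causal_bounded[of _ "Mass * B"]) (auto simp: hB, auto simp: h_def heaviside_def)
  have Shift_x: "Shift x s = Shift D s + h s" if "s \<ge> 0" for s
  proof -
    have "Shift x s = Shift (\<lambda>v. D v + past v) s"
      by (rule Shift_cong) (use that in \<open>auto simp: D_def past_def heaviside_def indicator_def\<close>)
    also have "\<dots> = Shift D s + Shift past s"
      using p.shift_integrable[OF D] n.shift_integrable[OF D]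
        p.shift_integrable_bound(1)[of past s B] n.shift_integrable_bound(1)[of past s B] past_bound
      by (simp add: Shift_def p.shift_def n.shift_def)
    finally show ?thesis using that by (simp add: h_def heaviside_def)
  qed
  define N where "N = (\<lambda>t. x 0 * heaviside t + conv heaviside h t)"
  note c = causal_heaviside causal_Shift causal_conv h D causal_cmult r_causal
  have N: "causal N" unfolding N_def by (intro causal_add c)
  have D_eq: "D t = N t + conv heaviside (Shift D) t" for t
  proof (cases "t < 0")
    case True
    then show ?thesis using causal_neg[OF D] causal_neg[OF N] causal_neg[OF causal_conv[OF causal_heaviside causal_Shift[OF D]]]
      by simp
  next
    case False
    have "(LBINT s:{0..t}. Shift x s) = (LBINT s:{0..t}. Shift D s + h s)"
      using Shift_x by (intro set_lebesgue_integral_cong) auto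
    also have "\<dots> = conv heaviside (\<lambda>s. Shift D s + h s) t"
      by (subst conv_heaviside) (auto intro!: causal_add c)
    also have "\<dots> = conv heaviside (Shift D) t + conv heaviside h t"
      by (simp add: conv_add_right c)
    finally show ?thesis using False eq[of t] by (simp add: D_def N_def heaviside_def)
  qed
  \<comment> \<open>Checked after integration: convolving r with x(0) H + H * h gives H convolved
    with the right-hand side, and by \<open>resolvent\<close> it also gives H * D.\<close>
  have "D t = x 0 * r t + conv r h t"
  proof (rule conv_heaviside_inj[OF D _ Dc])
    show "causal (\<lambda>t. x 0 * r t + conv r h t)" by (intro causal_add c)
    show "continuous_on {0..} (\<lambda>t. x 0 * r t + conv r h t)"
      by (intro continuous_intros r_continuous continuous_on_conv r_causal h)
    fix t
    have "conv heaviside D t = conv r N t" by (rule resolvent[OF D N D_eq, symmetric])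
    also have "\<dots> = x 0 * conv r heaviside t + conv r (conv heaviside h) t"
      unfolding N_def by (simp add: conv_add_right conv_cmult_right c)
    also have "conv r (conv heaviside h) t = conv (conv heaviside r) h t"
      by (simp add: conv_assoc c, rule arg_cong[where f="\<lambda>g. conv g h t"], rule ext, rule conv_commute)
    also have "conv r heaviside t = conv heaviside r t" by (rule conv_commute)
    finally show "conv heaviside D t = conv heaviside (\<lambda>t. x 0 * r t + conv r h t) t"
      by (simp add: conv_add_right conv_cmult_right conv_assoc c)
  qed
  then have "x t = x 0 * r t + conv r h t" using \<open>t \<ge> 0\<close> by (simp add: D_def heaviside_def)
  moreover have "\<bar>x 0 * r t\<bar> \<le> B * \<bar>r t\<bar>"
    using B[of 0] p.delay_nonneg by (simp add: abs_mult mult_right_mono)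
  moreover have "\<bar>conv r h t\<bar> \<le> B * (Mass * (LBINT s. indicator {0..\<alpha>} s * \<bar>r (t - s)\<bar>))"
  proof -
    have "\<bar>conv r h t\<bar> \<le> (LBINT s. Mass * B * (indicator {0..\<alpha>} s * \<bar>r (t - s)\<bar>))"
      unfolding conv_def
    proof (rule Bochner_Integration.integral_abs_bound_integral)
      show "integrable lborel (\<lambda>s. r (t - s) * h s)" by (intro causal_integrable_conv c)
      show "integrable lborel (\<lambda>s. Mass * B * (indicator {0..\<alpha>} s * \<bar>r (t - s)\<bar>))"
        using causal_integrable_conv[OF r_abs_causal window_indicator_causal, of t]
        by (intro integrable_mult_right) (simp add: mult.commute)
      fix s
      show "\<bar>r (t - s) * h s\<bar> \<le> Mass * B * (indicator {0..\<alpha>} s * \<bar>r (t - s)\<bar>)"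
      proof (cases "s \<in> {0..\<alpha>}")
        case True
        then show ?thesis using mult_right_mono[OF hB[of s], of "\<bar>r (t - s)\<bar>"] by (simp add: abs_mult mult.commute)
      next
        case False
        then have "h s = 0" using h0[of s] causal_neg[OF h, of s] by force
        then show ?thesis using False by simp
      qed
    qed
    then show ?thesis by (simp add: mult_ac)
  qed
  ultimately show ?thesis unfolding window_def distrib_left by linarith
qed

end

section \<open>From square integrability to exponential decay of the fundamental solution\<close>

context delay_equation begin

text \<open>Square integrability makes the averages of |r| over unit intervals tend to 0. The
  increment of r over a unit interval is an integral of F(r_s), controlled by averages of |r| over
  shifted unit intervals. So r stays close to its own averages.\<close>

lemma r_tendsto_0:
  assumes "integrable lborel (\<lambda>t. (r t)\<^sup>2)"
  shows "(r \<longlongrightarrow> 0) at_top"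
proof -
  let ?a = "\<lambda>t. \<bar>r t\<bar>"
  define b :: "real \<Rightarrow> real" where "b = indicator {0..1}"
  have b: "causal b" unfolding b_def by (rule causal_bounded[of _ 1]) (auto simp: indicator_def)
  have b_lim: "(b \<longlongrightarrow> 0) at_top"
    by (rule tendsto_eventually, rule eventually_mono[OF eventually_gt_at_top[of 1]]) (simp add: b_def)
  have b_int: "integrable lborel b" "(LBINT s. b s) = 1"
    unfolding b_def by (auto simp: emeasure_lborel_Icc_eq)
  define A where "A = conv ?a b"
  define R where "R = (\<lambda>s. p.shift ?a s + n.shift ?a s)"
  note c = causal_conv r_abs_causal b causal_add p.causal_shift n.causal_shift causal_heaviside causal_Shift
    r_causal causal_power2
  have A: "causal A" unfolding A_def by (intro c)
  have R: "causal R" unfolding R_def by (intro c)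
  have A_nonneg: "0 \<le> A t" for t
    unfolding A_def conv_def by (intro integral_nonneg_AE) (auto simp: b_def)
  have sq_lim: "((\<lambda>t. conv (\<lambda>t. (r t)\<^sup>2) b t) \<longlongrightarrow> 0) at_top"
    using conv_tendsto[OF causal_power2[OF r_causal] b assms b_lim, of 1] by (simp add: b_def indicator_def)
  \<comment> \<open>Pointwise |v| \<le> e + v^2 / e, by cases on |v| \<le> e; integrated over a unit
    interval this does the work of the Cauchy-Schwarz inequality.\<close>
  have A_le: "A t \<le> e + (1 / e) * conv (\<lambda>t. (r t)\<^sup>2) b t" if "e > 0" for e t
  proof -
    have "A t \<le> (LBINT s. e * b s + (1 / e) * ((r (t - s))\<^sup>2 * b s))"
      unfolding A_def conv_def
    proof (rule integral_mono)
      show "integrable lborel (\<lambda>s. \<bar>r (t - s)\<bar> * b s)" by (intro causal_integrable_conv c)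
      show "integrable lborel (\<lambda>s. e * b s + (1 / e) * ((r (t - s))\<^sup>2 * b s))"
        using causal_integrable_conv[OF causal_power2[OF r_causal] b, of t] b_int
        by (intro Bochner_Integration.integrable_add integrable_mult_right) auto
      fix s
      have "\<bar>v\<bar> \<le> e + (1 / e) * v\<^sup>2" for v :: real
      proof (cases "\<bar>v\<bar> \<le> e")
        case False
        then have "e * \<bar>v\<bar> \<le> v\<^sup>2" using mult_right_mono[of e "\<bar>v\<bar>" "\<bar>v\<bar>"]
          by (simp add: power2_eq_square)
        then have "\<bar>v\<bar> \<le> (1 / e) * v\<^sup>2" using that by (simp add: field_simps)
        then show ?thesis using that by linarith
      qed (use that in \<open>simp add: add_increasing2\<close>)
      from mult_right_mono[OF this, of "b s"]
      show "\<bar>r (t - s)\<bar> * b s \<le> e * b s + (1 / e) * ((r (t - s))\<^sup>2 * b s)"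
        by (simp add: b_def distrib_right)
    qed
    also have "\<dots> = e + (1 / e) * conv (\<lambda>t. (r t)\<^sup>2) b t"
      using causal_integrable_conv[OF causal_power2[OF r_causal] b, of t] b_int
      by (simp add: conv_def)
    finally show ?thesis .
  qed
  have A_lim: "(A \<longlongrightarrow> 0) at_top"
  proof (rule tendstoI)
    fix e :: real assume "e > 0"
    \<comment> \<open>Threshold for which \<open>A_le\<close> with e/2 in place of e gives e/2 +
      e/2.\<close>
    then have "e / 2 * (e / 2) > 0" by simp
    from order_tendstoD(2)[OF sq_lim this]
    show "\<forall>\<^sub>F t in at_top. dist (A t) 0 < e"
    proof eventually_elim
      case (elim t)
      have "A t \<le> e / 2 + (1 / (e / 2)) * conv (\<lambda>t. (r t)\<^sup>2) b t"
        by (rule A_le) (use \<open>e > 0\<close> in simp)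
      also have "\<dots> < e / 2 + (1 / (e / 2)) * (e / 2 * (e / 2))"
        using elim \<open>e > 0\<close> by (intro add_strict_left_mono mult_strict_left_mono) auto
      also have "\<dots> = e" using \<open>e > 0\<close> by simp
      finally show ?case using A_nonneg[of t] by simp
    qed
  qed
  have conv_R: "conv R b t = p.shift A t + n.shift A t" for t
    unfolding R_def A_def by (simp add: conv_add_left p.conv_shift n.conv_shift c)
  have R_ge: "\<bar>Shift r s\<bar> \<le> R s" for s
    unfolding Shift_def R_def p.shift_def n.shift_def
    using integral_abs_bound[of mp "\<lambda>u. r (s + u)"] integral_abs_bound[of mn "\<lambda>u. r (s + u)"] by linarith
  \<comment> \<open>Both times lie in [t, t + 1], and \<open>conv R b (t + 1)\<close> is the
    integral of R over exactly this interval.\<close>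
  have increment: "\<bar>r s - r t\<bar> \<le> conv R b (t + 1)" if "0 \<le> t" "t \<le> s" "s \<le> t + 1" for s t
  proof -
    have "r s - r t = conv heaviside (Shift r) s - conv heaviside (Shift r) t"
      using that r_eq[of s] r_eq[of t] by (simp add: heaviside_def)
    also have "\<dots> = (LBINT v. heaviside (s - v) * Shift r v - heaviside (t - v) * Shift r v)"
      unfolding conv_def
      by (rule Bochner_Integration.integral_diff[symmetric]) (intro causal_integrable_conv c)+
    finally have "\<bar>r s - r t\<bar> = \<bar>LBINT v. heaviside (s - v) * Shift r v - heaviside (t - v) * Shift r v\<bar>" by simp
    also have "\<dots> \<le> (LBINT v. b (t + 1 - v) * R v)"
    proof (rule Bochner_Integration.integral_abs_bound_integral)
      show "integrable lborel (\<lambda>v. heaviside (s - v) * Shift r v - heaviside (t - v) * Shift r v)"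
        by (intro Bochner_Integration.integrable_diff causal_integrable_conv c)
      show "integrable lborel (\<lambda>v. b (t + 1 - v) * R v)" by (intro causal_integrable_conv b R)
      fix v
      have "0 \<le> R v" using R_ge[of v] by linarith
      then show "\<bar>heaviside (s - v) * Shift r v - heaviside (t - v) * Shift r v\<bar> \<le> b (t + 1 - v) * R v"
        using R_ge[of v] that by (auto simp: heaviside_def b_def indicator_def)
    qed
    also have "\<dots> = conv R b (t + 1)" by (subst conv_commute) (simp add: conv_def)
    finally show ?thesis .
  qed
  have r_le: "\<bar>r t\<bar> \<le> A (t + 1) + (p.shift A (t + 1) + n.shift A (t + 1))" if "t \<ge> 0" for t
  proof -
    have i: "integrable lborel (\<lambda>w. \<bar>r (t + 1 - w)\<bar> * b w)" by (intro causal_integrable_conv c)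
    \<comment> \<open>The constant |r(t)| is averaged over w in [0, 1] and compared with |r(t + 1 -
      w)|, whose average is A(t + 1).\<close>
    have "\<bar>r t\<bar> = (LBINT w. \<bar>r t\<bar> * b w)" using b_int by simp
    also have "\<dots> \<le> (LBINT w. \<bar>r (t + 1 - w)\<bar> * b w + conv R b (t + 1) * b w)"
    proof (rule integral_mono)
      fix w
      show "\<bar>r t\<bar> * b w \<le> \<bar>r (t + 1 - w)\<bar> * b w + conv R b (t + 1) * b w"
      proof (cases "w \<in> {0..1}")
        case True
        then have "\<bar>r (t + 1 - w) - r t\<bar> \<le> conv R b (t + 1)" using that by (intro increment) auto
        then show ?thesis using True by (simp add: b_def)
      qed (simp add: b_def)
    qed (use i b_int in auto)
    also have "\<dots> = A (t + 1) + conv R b (t + 1)"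
      using i b_int by (simp add: A_def conv_def[of ?a b])
    finally show ?thesis by (simp add: conv_R)
  qed
  have "((\<lambda>t. A t + (p.shift A t + n.shift A t)) \<longlongrightarrow> 0 + (0 + 0)) at_top"
    by (intro tendsto_add A_lim p.shift_tendsto_0 n.shift_tendsto_0 A)
  moreover have "filterlim (\<lambda>t::real. t + 1) at_top at_top"
    using filterlim_tendsto_add_at_top[OF tendsto_const[of "1::real"] filterlim_ident[of at_top]]
    by (simp add: add.commute)
  ultimately have lim: "((\<lambda>t. A (t + 1) + (p.shift A (t + 1) + n.shift A (t + 1))) \<longlongrightarrow> 0) at_top"
    using filterlim_compose[of _ "nhds 0" at_top "\<lambda>t::real. t + 1" at_top] by force
  show ?thesis
    by (rule Lim_null_comparison[OF _ lim], rule eventually_mono[OF eventually_ge_at_top[of 0]])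
       (use r_le in auto)
qed

text \<open>The translate of r solves the equation from time T on, with its own past as initial
  segment; that past may contain the jump of r, and \<open>solution_le_window\<close> asks only that
  it be measurable and bounded.\<close>

lemma r_restart:
  assumes "T \<ge> 0" "\<And>v. T - \<alpha> \<le> v \<Longrightarrow> v \<le> T \<Longrightarrow> \<bar>r v\<bar> \<le> B" "t \<ge> 0"
  shows "\<bar>r (T + t)\<bar> \<le> B * window t"
proof (rule solution_le_window[where x="\<lambda>v. r (T + v)"])
  show "continuous_on {0..} (\<lambda>v. r (T + v))"
    by (rule continuous_on_compose2[OF r_continuous]) (use assms in \<open>auto intro!: continuous_intros\<close>)
  show "\<bar>r (T + v)\<bar> \<le> B" if "- \<alpha> \<le> v" "v \<le> 0" for v using that by (intro assms) auto
  fix t :: real assume "t \<ge> 0"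
  have [measurable]: "Shift r \<in> borel_measurable borel" by (intro Shift_measurable r_measurable)
  have sh: "Shift (\<lambda>v. r (T + v)) s = Shift r (T + s)" for s
    by (simp add: Shift_def p.shift_def n.shift_def add.assoc)
  have i: "integrable lborel (\<lambda>s. indicator {0..a} s * Shift r s)" for a
  proof -
    obtain B where B: "B > 0" "\<And>t. t \<le> a \<Longrightarrow> \<bar>Shift r t\<bar> \<le> B"
      using causal_bound[OF causal_Shift[OF r_causal]] by metis
    show ?thesis by (rule integrable_bounded_support[of _ 0 a B]) (use B in auto)
  qed
  have "r (T + t) - r T = conv heaviside (Shift r) (T + t) - conv heaviside (Shift r) T"
    using assms \<open>t \<ge> 0\<close> r_eq[of "T + t"] r_eq[of T] by (simp add: heaviside_def)
  also have "\<dots> = (LBINT s. indicator {0..T + t} s * Shift r s - indicator {0..T} s * Shift r s)"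
    using i by (simp add: conv_heaviside causal_Shift r_causal set_lebesgue_integral_def)
  also have "\<dots> = (LBINT s. indicator {0..T + t} (T + s) * Shift r (T + s) - indicator {0..T} (T + s) * Shift r (T + s))"
    by (subst lborel_integral_real_affine[where c=1 and t=T]) auto
  also have "\<dots> = (LBINT s. indicator {0..t} s * Shift r (T + s))"
  proof (rule integral_cong_AE)
    \<comment> \<open>The difference of the two indicators is that of (0, t], so the two integrands
      can differ only at s = 0.\<close>
    show "AE s in lborel. indicator {0..T + t} (T + s) * Shift r (T + s) - indicator {0..T} (T + s) * Shift r (T + s)
        = indicator {0..t} s * Shift r (T + s)"
      by (rule AE_mp[OF AE_lborel_singleton[of 0]])
         (use assms \<open>t \<ge> 0\<close> in \<open>auto intro!: AE_I2 simp: indicator_def\<close>)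
  qed measurable
  finally show "r (T + t) = r (T + 0) + (LBINT s:{0..t}. Shift (\<lambda>v. r (T + v)) s)"
    by (simp add: sh set_lebesgue_integral_def)
qed (use assms in auto)

lemma window_tendsto_0:
  assumes "(r \<longlongrightarrow> 0) at_top"
  shows "(window \<longlongrightarrow> 0) at_top"
proof -
  obtain B where B: "\<And>t. \<bar>r t\<bar> \<le> B"
    using causal_tendsto_bounded[OF r_causal assms] by metis
  have abs: "((\<lambda>t. \<bar>r t\<bar>) \<longlongrightarrow> 0) at_top" using assms by (rule tendsto_rabs_zero)
  have "((\<lambda>t. conv (indicator {0..\<alpha>}) (\<lambda>t. \<bar>r t\<bar>) t) \<longlongrightarrow> (LBINT s. indicator {0..\<alpha>} s) * 0) at_top"
    by (rule conv_tendsto[OF window_indicator_causal r_abs_causal _ abs, of B])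
       (use B in \<open>auto simp: emeasure_lborel_Icc_eq\<close>)
  then have "((\<lambda>t. conv (\<lambda>t. \<bar>r t\<bar>) (indicator {0..\<alpha>}) t) \<longlongrightarrow> 0) at_top"
    by (subst conv_commute) simp
  from tendsto_add[OF abs tendsto_mult_right_zero[OF this, of Mass]]
  show ?thesis unfolding window_eq_conv[abs_def] by simp
qed

text \<open>
  Restarting the equation at time \<open>T\<close> bounds \<open>r\<close> after \<open>T\<close> by its supremum over the delay interval
  before \<open>T\<close>, times \<open>window\<close>. Once \<open>window\<close> is below \<open>1 / 2\<close>, this bound halves over a fixed time.
\<close>

lemma r_exp_decay:
  assumes "(r \<longlongrightarrow> 0) at_top"
  obtains C c where "c > 0" "\<And>t. \<bar>r t\<bar> \<le> C * exp (- c * t)"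
proof -
  obtain B where B: "\<And>t. \<bar>r t\<bar> \<le> B"
    using causal_tendsto_bounded[OF r_causal assms] by metis
  have "0 \<le> B" using B[of 0] by simp
  have "\<forall>\<^sub>F t in at_top. window t < 1 / 2"
    by (rule order_tendstoD(2)[OF window_tendsto_0[OF assms]]) simp
  then obtain T1 where T1: "\<And>t. t \<ge> T1 \<Longrightarrow> window t < 1 / 2"
    unfolding eventually_at_top_linorder by auto
  \<comment> \<open>A restart at n T uses the bound on [n T - \<alpha>, n T]. For s \<ge> (n + 1) T
    - \<alpha> the elapsed time is at least T - \<alpha> \<ge> T1, so the window factor is below
    1/2. The summand 1 keeps T positive.\<close>
  define T where "T = \<bar>T1\<bar> + \<alpha> + 1"
  have "T > 0" using p.delay_nonneg by (simp add: T_def)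
  have halve: "\<bar>r s\<bar> \<le> B / 2 ^ n" if "s \<ge> real n * T - \<alpha>" for n s
    using that
  proof (induction n arbitrary: s)
    case (Suc n)
    have "\<bar>r (real n * T + (s - real n * T))\<bar> \<le> B / 2 ^ n * window (s - real n * T)"
      using Suc p.delay_nonneg \<open>T > 0\<close> by (intro r_restart) (auto simp: T_def algebra_simps)
    also have "\<dots> \<le> B / 2 ^ n * (1 / 2)"
    proof (rule mult_left_mono)
      have "T1 \<le> s - real n * T" using Suc.prems by (simp add: T_def algebra_simps)
      from T1[OF this] show "window (s - real n * T) \<le> 1 / 2" by simp
    qed (use \<open>0 \<le> B\<close> in simp)
    finally show ?case by simp
  qed (use B in auto)
  \<comment> \<open>Halving in each period T is decay at rate ln 2 / T; rounding t / T down to n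
    costs the factor 2 below.\<close>
  define c where "c = ln 2 / T"
  have "\<bar>r t\<bar> \<le> 2 * B * exp (- c * t)" for t
  proof (cases "t < 0")
    case False
    define n where "n = nat \<lfloor>t / T\<rfloor>"
    have "0 \<le> t / T" using False \<open>T > 0\<close> by simp
    then have n: "real n = of_int \<lfloor>t / T\<rfloor>" unfolding n_def by simp
    have n1: "real n \<le> t / T" unfolding n by linarith
    have n2: "t / T \<le> real n + 1" unfolding n by linarith
    have "real n * T \<le> t" using n1 \<open>T > 0\<close> by (simp add: pos_le_divide_eq)
    have e2: "exp (real n * ln 2) = (2::real) ^ n" by (simp add: exp_of_nat_mult)
    have "\<bar>r t\<bar> \<le> B / 2 ^ n" using \<open>real n * T \<le> t\<close> p.delay_nonneg by (intro halve) simp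
    also have "B / 2 ^ n = 2 * B * exp (- ln 2 * (real n + 1))"
      by (simp add: e2 exp_diff exp_minus algebra_simps exp_add divide_simps)
    also have "\<dots> \<le> 2 * B * exp (- ln 2 * (t / T))"
      using mult_left_mono[OF n2, of "ln 2"] \<open>0 \<le> B\<close> by (intro mult_left_mono) auto
    finally show ?thesis by (simp add: c_def)
  qed (use causal_neg[OF r_causal] \<open>0 \<le> B\<close> in simp)
  moreover have "c > 0" using \<open>T > 0\<close> by (simp add: c_def)
  ultimately show ?thesis using that by blast
qed

text \<open>On [t - \<alpha>, t] the exponential bound is largest at the left end, which costs exp(c
  \<alpha>).\<close>

lemma window_exp_decay:
  assumes "\<And>t. \<bar>r t\<bar> \<le> C * exp (- c * t)" "c > 0"
  shows "window t \<le> C * (1 + Mass * \<alpha> * exp (c * \<alpha>)) * exp (- c * t)"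
proof -
  have "0 \<le> C" using assms(1)[of 0] by simp
  have "(LBINT s. indicator {0..\<alpha>} s * \<bar>r (t - s)\<bar>) \<le> (LBINT s. (C * exp (c * \<alpha>) * exp (- c * t)) * indicator {0..\<alpha>} s)"
  proof (rule integral_mono)
    show "integrable lborel (\<lambda>s. indicator {0..\<alpha>} s * \<bar>r (t - s)\<bar>)"
      using causal_integrable_conv[OF r_abs_causal window_indicator_causal, of t] by (simp add: mult.commute)
    show "integrable lborel (\<lambda>s. (C * exp (c * \<alpha>) * exp (- c * t)) * indicat_real {0..\<alpha>} s)"
      by (intro integrable_mult_right integrable_real_indicator) (auto simp: emeasure_lborel_Icc_eq)
    fix s
    show "indicator {0..\<alpha>} s * \<bar>r (t - s)\<bar> \<le> (C * exp (c * \<alpha>) * exp (- c * t)) * indicator {0..\<alpha>} s"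
    proof (cases "s \<in> {0..\<alpha>}")
      case True
      have "\<bar>r (t - s)\<bar> \<le> C * exp (- c * (t - s))" by (rule assms)
      also have "\<dots> \<le> C * exp (c * \<alpha> + - c * t)"
        using True \<open>0 \<le> C\<close> assms(2) by (intro mult_left_mono) (auto simp: algebra_simps)
      finally show ?thesis using True unfolding exp_add by (simp add: mult.assoc)
    qed simp
  qed
  also have "\<dots> = (C * exp (c * \<alpha>) * exp (- c * t)) * \<alpha>" using p.delay_nonneg by simp
  finally have "Mass * (LBINT s. indicator {0..\<alpha>} s * \<bar>r (t - s)\<bar>) \<le> Mass * ((C * exp (c * \<alpha>) * exp (- c * t)) * \<alpha>)"
    using Mass_nonneg by (rule mult_left_mono)
  then show ?thesis using assms(1)[of t] unfolding window_def by (simp add: algebra_simps)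
qed

end

section \<open>Limits of inner products\<close>

lemma integrable_mult_of_squares:
  fixes f g :: "'a \<Rightarrow> real"
  assumes [measurable]: "f \<in> borel_measurable M" "g \<in> borel_measurable M"
    and "integrable M (\<lambda>x. (f x)\<^sup>2)" "integrable M (\<lambda>x. (g x)\<^sup>2)"
  shows "integrable M (\<lambda>x. f x * g x)"
proof (rule Bochner_Integration.integrable_bound)
  show "integrable M (\<lambda>x. (f x)\<^sup>2 + (g x)\<^sup>2)" using assms by simp
  show "AE x in M. norm (f x * g x) \<le> norm ((f x)\<^sup>2 + (g x)\<^sup>2)"
  proof (rule AE_I2)
    fix x
    have "2 * (\<bar>f x\<bar> * \<bar>g x\<bar>) \<le> \<bar>f x\<bar>\<^sup>2 + \<bar>g x\<bar>\<^sup>2"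
      using zero_le_power2[of "\<bar>f x\<bar> - \<bar>g x\<bar>"] by (simp add: power2_diff)
    moreover have "0 \<le> \<bar>f x\<bar> * \<bar>g x\<bar>" by simp
    ultimately have "\<bar>f x\<bar> * \<bar>g x\<bar> \<le> (f x)\<^sup>2 + (g x)\<^sup>2" unfolding power2_abs by linarith
    then show "norm (f x * g x) \<le> norm ((f x)\<^sup>2 + (g x)\<^sup>2)" by (simp add: abs_mult)
  qed
qed simp

lemma integrable_square_of_close:
  fixes f g :: "'a \<Rightarrow> real"
  assumes [measurable]: "f \<in> borel_measurable M" "g \<in> borel_measurable M"
    and "integrable M (\<lambda>x. (f x)\<^sup>2)" "(\<integral>\<^sup>+x. ennreal ((f x - g x)\<^sup>2) \<partial>M) < \<infinity>"
  shows "integrable M (\<lambda>x. (f x - g x)\<^sup>2)" "integrable M (\<lambda>x. (g x)\<^sup>2)"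
proof -
  show d: "integrable M (\<lambda>x. (f x - g x)\<^sup>2)"
    using assms(4) by (intro integrableI_nonneg) auto
  show "integrable M (\<lambda>x. (g x)\<^sup>2)"
  proof (rule Bochner_Integration.integrable_bound)
    show "integrable M (\<lambda>x. 2 * (f x)\<^sup>2 + 2 * (f x - g x)\<^sup>2)" using d assms(3) by simp
    show "AE x in M. norm ((g x)\<^sup>2) \<le> norm (2 * (f x)\<^sup>2 + 2 * (f x - g x)\<^sup>2)"
    proof (rule AE_I2)
      fix x
      have "2 * (f x)\<^sup>2 + 2 * (f x - g x)\<^sup>2 - (g x)\<^sup>2 = (2 * f x - g x)\<^sup>2"
        by (simp add: power2_eq_square algebra_simps)
      then have "(g x)\<^sup>2 \<le> 2 * (f x)\<^sup>2 + 2 * (f x - g x)\<^sup>2"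
        using zero_le_power2[of "2 * f x - g x"] by linarith
      then show "norm ((g x)\<^sup>2) \<le> norm (2 * (f x)\<^sup>2 + 2 * (f x - g x)\<^sup>2)" by simp
    qed
  qed simp
qed

text \<open>The distances are nonnegative integrals and may be infinite at first. Being eventually
  finite, they make the limit square integrable and can be rewritten as Bochner integrals.\<close>

lemma L2_limit_square_integrable:
  fixes f :: "nat \<Rightarrow> 'a \<Rightarrow> real"
  assumes "\<And>k. f k \<in> borel_measurable M" "g \<in> borel_measurable M"
    and "\<And>k. integrable M (\<lambda>x. (f k x)\<^sup>2)"
    and lim: "(\<lambda>k. \<integral>\<^sup>+x. ennreal ((f k x - g x)\<^sup>2) \<partial>M) \<longlonglongrightarrow> 0"
  shows "integrable M (\<lambda>x. (g x)\<^sup>2)"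
    and "\<forall>\<^sub>F k in sequentially. integrable M (\<lambda>x. (f k x - g x)\<^sup>2)"
    and "(\<lambda>k. \<integral>x. (f k x - g x)\<^sup>2 \<partial>M) \<longlonglongrightarrow> 0"
proof -
  have ev: "\<forall>\<^sub>F k in sequentially. (\<integral>\<^sup>+x. ennreal ((f k x - g x)\<^sup>2) \<partial>M) < \<infinity>"
    using order_tendstoD(2)[OF lim, of \<infinity>] by simp
  obtain k where "(\<integral>\<^sup>+x. ennreal ((f k x - g x)\<^sup>2) \<partial>M) < \<infinity>"
    using eventually_happens'[OF sequentially_bot ev] by blast
  then show "integrable M (\<lambda>x. (g x)\<^sup>2)"
    by (rule integrable_square_of_close(2)[OF assms(1,2,3)])
  show i: "\<forall>\<^sub>F k in sequentially. integrable M (\<lambda>x. (f k x - g x)\<^sup>2)"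
    using ev by eventually_elim (rule integrable_square_of_close(1)[OF assms(1,2,3)])
  have "\<forall>\<^sub>F k in sequentially. (\<integral>\<^sup>+x. ennreal ((f k x - g x)\<^sup>2) \<partial>M) = ennreal (\<integral>x. (f k x - g x)\<^sup>2 \<partial>M)"
    using i by eventually_elim (intro nn_integral_eq_integral, auto)
  from Lim_transform_eventually[OF lim this]
  have "(\<lambda>k. ennreal (\<integral>x. (f k x - g x)\<^sup>2 \<partial>M)) \<longlonglongrightarrow> ennreal 0" by simp
  then show "(\<lambda>k. \<integral>x. (f k x - g x)\<^sup>2 \<partial>M) \<longlonglongrightarrow> 0"
    by (subst (asm) tendsto_ennreal_iff) auto
qed

text \<open>With u and v the errors of the two factors, the difference of the products is u v + g' u
  + f' v, and the mixed terms are split by p q \<le> e p^2 + q^2 / e. For fixed e the terms with u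
  and v vanish in the limit, and e K can be made small.\<close>

lemma L2_limit_inner_product:
  fixes f g :: "nat \<Rightarrow> 'a \<Rightarrow> real"
  assumes f: "\<And>k. f k \<in> borel_measurable M" "f' \<in> borel_measurable M" "\<And>k. integrable M (\<lambda>x. (f k x)\<^sup>2)"
      "(\<lambda>k. \<integral>\<^sup>+x. ennreal ((f k x - f' x)\<^sup>2) \<partial>M) \<longlonglongrightarrow> 0"
    and g: "\<And>k. g k \<in> borel_measurable M" "g' \<in> borel_measurable M" "\<And>k. integrable M (\<lambda>x. (g k x)\<^sup>2)"
      "(\<lambda>k. \<integral>\<^sup>+x. ennreal ((g k x - g' x)\<^sup>2) \<partial>M) \<longlonglongrightarrow> 0"
  shows "(\<lambda>k. \<integral>x. f k x * g k x \<partial>M) \<longlonglongrightarrow> (\<integral>x. f' x * g' x \<partial>M)"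
proof -
  note [measurable] = f(1,2) g(1,2)
  note F = L2_limit_square_integrable[OF f] and G = L2_limit_square_integrable[OF g]
  define a where "a = (\<lambda>k. (\<integral>x. (f k x - f' x)\<^sup>2 \<partial>M) + (\<integral>x. (g k x - g' x)\<^sup>2 \<partial>M))"
  define K where "K = (\<integral>x. (f' x)\<^sup>2 \<partial>M) + (\<integral>x. (g' x)\<^sup>2 \<partial>M)"
  have "0 \<le> K" by (simp add: K_def)
  have a: "a \<longlonglongrightarrow> 0" unfolding a_def using tendsto_add[OF F(3) G(3)] by simp
  have bound: "\<forall>\<^sub>F k in sequentially. \<forall>e>0. \<bar>(\<integral>x. f k x * g k x \<partial>M) - (\<integral>x. f' x * g' x \<partial>M)\<bar>
      \<le> (1 + 1 / e) * a k + e * K"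
    using F(2) G(2)
  proof (eventually_elim, intro allI impI)
    fix k and e :: real
    assume i: "integrable M (\<lambda>x. (f k x - f' x)\<^sup>2)" "integrable M (\<lambda>x. (g k x - g' x)\<^sup>2)" and "e > 0"
    have p: "integrable M (\<lambda>x. f k x * g k x)" "integrable M (\<lambda>x. f' x * g' x)"
      by (intro integrable_mult_of_squares f g F(1) G(1); measurable)+
    have "\<bar>(\<integral>x. f k x * g k x \<partial>M) - (\<integral>x. f' x * g' x \<partial>M)\<bar> = \<bar>\<integral>x. f k x * g k x - f' x * g' x \<partial>M\<bar>"
      using p by simp
    also have "\<dots> \<le> (\<integral>x. \<bar>f k x * g k x - f' x * g' x\<bar> \<partial>M)" by (rule integral_abs_bound)
    also have "\<dots> \<le> (\<integral>x. (1 + 1 / e) * ((f k x - f' x)\<^sup>2 + (g k x - g' x)\<^sup>2) + e * ((f' x)\<^sup>2 + (g' x)\<^sup>2) \<partial>M)"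
    proof (rule integral_mono)
      fix x
      define u v where "u = f k x - f' x" and "v = g k x - g' x"
      have amgm: "\<bar>p * q\<bar> \<le> e * p\<^sup>2 + (1 / e) * q\<^sup>2" for p q
      proof -
        have "0 \<le> (e * \<bar>p\<bar> - \<bar>q\<bar>)\<^sup>2" by simp
        then have "2 * e * \<bar>p * q\<bar> \<le> e\<^sup>2 * p\<^sup>2 + q\<^sup>2"
          by (simp add: power2_diff power_mult_distrib abs_mult)
        moreover have "0 \<le> e * \<bar>p * q\<bar>" using \<open>e > 0\<close> by simp
        ultimately have "e * \<bar>p * q\<bar> \<le> e\<^sup>2 * p\<^sup>2 + q\<^sup>2" by linarith
        then have "(1 / e) * (e * \<bar>p * q\<bar>) \<le> (1 / e) * (e\<^sup>2 * p\<^sup>2 + q\<^sup>2)"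
          using \<open>e > 0\<close> by (intro mult_left_mono) auto
        then show ?thesis using \<open>e > 0\<close> by (simp add: power2_eq_square distrib_left)
      qed
      have uv: "\<bar>u * v\<bar> \<le> u\<^sup>2 + v\<^sup>2"
      proof -
        have "0 \<le> (\<bar>u\<bar> - \<bar>v\<bar>)\<^sup>2" by simp
        then have "2 * \<bar>u * v\<bar> \<le> u\<^sup>2 + v\<^sup>2" by (simp add: power2_diff abs_mult)
        then show ?thesis using abs_ge_zero[of "u * v"] by linarith
      qed
      have "f k x * g k x - f' x * g' x = u * v + g' x * u + f' x * v"
        by (simp add: u_def v_def algebra_simps)
      then have "\<bar>f k x * g k x - f' x * g' x\<bar> \<le> \<bar>u * v\<bar> + \<bar>g' x * u\<bar> + \<bar>f' x * v\<bar>" by linarith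
      also have "\<dots> \<le> (u\<^sup>2 + v\<^sup>2) + (e * (g' x)\<^sup>2 + (1 / e) * u\<^sup>2) + (e * (f' x)\<^sup>2 + (1 / e) * v\<^sup>2)"
        by (intro add_mono uv amgm)
      finally show "\<bar>f k x * g k x - f' x * g' x\<bar>
          \<le> (1 + 1 / e) * ((f k x - f' x)\<^sup>2 + (g k x - g' x)\<^sup>2) + e * ((f' x)\<^sup>2 + (g' x)\<^sup>2)"
        unfolding u_def[symmetric] v_def[symmetric] by (simp add: algebra_simps)
    qed (use p i F(1) G(1) in auto)
    also have "\<dots> = (1 + 1 / e) * a k + e * K" using i F(1) G(1) by (simp add: a_def K_def)
    finally show "\<bar>(\<integral>x. f k x * g k x \<partial>M) - (\<integral>x. f' x * g' x \<partial>M)\<bar> \<le> (1 + 1 / e) * a k + e * K" .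
  qed
  show ?thesis
  proof (rule tendstoI)
    fix \<epsilon> :: real assume "\<epsilon> > 0"
    define e where "e = \<epsilon> / (2 * (K + 1))"
    have "e > 0" using \<open>\<epsilon> > 0\<close> \<open>0 \<le> K\<close> by (simp add: e_def)
    have "e * K \<le> e * (K + 1)" using \<open>e > 0\<close> by simp
    also have "e * (K + 1) = \<epsilon> / 2" using \<open>0 \<le> K\<close> by (simp add: e_def field_simps)
    finally have eK: "e * K \<le> \<epsilon> / 2" .
    have "(\<lambda>k. (1 + 1 / e) * a k) \<longlonglongrightarrow> 0" using tendsto_mult_right_zero[OF a] .
    then have "\<forall>\<^sub>F k in sequentially. (1 + 1 / e) * a k < \<epsilon> / 2"
      using \<open>\<epsilon> > 0\<close> by (intro order_tendstoD(2)) auto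
    with bound show "\<forall>\<^sub>F k in sequentially. dist (\<integral>x. f k x * g k x \<partial>M) (\<integral>x. f' x * g' x \<partial>M) < \<epsilon>"
    proof eventually_elim
      case (elim k)
      have "\<bar>(\<integral>x. f k x * g k x \<partial>M) - (\<integral>x. f' x * g' x \<partial>M)\<bar> \<le> (1 + 1 / e) * a k + e * K"
        using elim(1) \<open>e > 0\<close> by blast
      then show ?case using elim(2) eK unfolding dist_real_def by linarith
    qed
  qed
qed

section \<open>The bilinear Ito isometry\<close>

locale wiener_space = prob_space M for M :: "'a measure" +
  fixes Fil :: "real \<Rightarrow> 'a measure" and W :: "real \<Rightarrow> 'a \<Rightarrow> real"
  assumes filtration: "usual_filtration M Fil" and wiener: "wiener_process M Fil W"
begin

lemma Fil_subalgebra: "0 \<le> t \<Longrightarrow> subalgebra M (Fil t)"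
  using filtration by (simp add: usual_filtration_def)

lemma Fil_mono: "0 \<le> s \<Longrightarrow> s \<le> t \<Longrightarrow> subalgebra (Fil t) (Fil s)"
  using filtration Fil_subalgebra[of s] Fil_subalgebra[of t]
  unfolding usual_filtration_def subalgebra_def by (metis order_trans)

lemma Fil_measurable: "0 \<le> t \<Longrightarrow> f \<in> borel_measurable (Fil t) \<Longrightarrow> f \<in> borel_measurable M"
  using measurable_from_subalg[OF Fil_subalgebra] by blast

lemma Fil_measurable_mono:
  "0 \<le> s \<Longrightarrow> s \<le> t \<Longrightarrow> f \<in> borel_measurable (Fil s) \<Longrightarrow> f \<in> borel_measurable (Fil t)"
  using measurable_from_subalg[OF Fil_mono] by blast

definition incr :: "real \<Rightarrow> real \<Rightarrow> 'a \<Rightarrow> real" where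
  "incr s t \<omega> = W t \<omega> - W s \<omega>"

lemma incr_Fil_measurable: "0 \<le> s \<Longrightarrow> s \<le> t \<Longrightarrow> incr s t \<in> borel_measurable (Fil t)"
  using wiener Fil_measurable_mono[of s t "W s"] unfolding wiener_process_def incr_def[abs_def]
  by (intro borel_measurable_diff) auto

lemma incr_measurable: "0 \<le> s \<Longrightarrow> s \<le> t \<Longrightarrow> incr s t \<in> borel_measurable M"
  using incr_Fil_measurable Fil_measurable[of t] by auto

lemma incr_moments:
  assumes "0 \<le> s" "s < t"
  shows "integrable M (incr s t)" "expectation (incr s t) = 0"
    "integrable M (\<lambda>\<omega>. (incr s t \<omega>)\<^sup>2)" "expectation (\<lambda>\<omega>. (incr s t \<omega>)\<^sup>2) = t - s"
proof -
  have D: "distributed M lborel (incr s t) (normal_density 0 (sqrt (t - s)))"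
    using wiener assms unfolding wiener_process_def incr_def[abs_def] by auto
  have pos: "0 < sqrt (t - s)" using assms by simp
  have i: "integrable M (\<lambda>\<omega>. incr s t \<omega> ^ k)" for k
    using distributed_integrable[OF D, of "\<lambda>x. x ^ k"] integrable_normal_moment[OF pos, of 0 k] by simp
  from i[of 1] i[of 2] show "integrable M (incr s t)" "integrable M (\<lambda>\<omega>. (incr s t \<omega>)\<^sup>2)" by simp_all
  show "expectation (incr s t) = 0"
    using distributed_integral[OF D, of "\<lambda>x. x"] integral_normal_moment_odd[OF pos, of 0 0] by simp
  have "expectation (\<lambda>\<omega>. (incr s t \<omega>)\<^sup>2) = (LBINT x. normal_density 0 (sqrt (t - s)) x * (x - 0) ^ (2 * 1))"
    using distributed_integral[OF D, of "\<lambda>x. x ^ 2"] by simp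
  also have "\<dots> = t - s"
    using assms by (subst integral_normal_moment_even[OF pos]) (simp add: fact_numeral)
  finally show "expectation (\<lambda>\<omega>. (incr s t \<omega>)\<^sup>2) = t - s" .
qed

lemma incr_indep:
  assumes "0 \<le> s" "s < t" "Z \<in> borel_measurable (Fil s)"
  shows "indep_var borel Z borel (incr s t)"
  unfolding indep_var_eq
proof (intro conjI)
  show "Z \<in> borel_measurable M" "incr s t \<in> borel_measurable M"
    using assms Fil_measurable incr_measurable by auto
  have i: "indep_set (sets (Fil s)) (sets (vimage_algebra (space M) (incr s t) borel))"
    using wiener assms unfolding wiener_process_def incr_def[abs_def] by auto
  have sp: "space (Fil s) = space M" using Fil_subalgebra[OF assms(1)] by (simp add: subalgebra_def)
  have sub: "sigma_sets (space M) {Z -` A \<inter> space M |A. A \<in> sets borel} \<subseteq> sets (Fil s)"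
    unfolding sp[symmetric] using measurable_sets[OF assms(3)] by (intro sets.sigma_sets_subset) auto
  show "indep_set (sigma_sets (space M) {Z -` A \<inter> space M |A. A \<in> sets borel})
     (sigma_sets (space M) {incr s t -` A \<inter> space M |A. A \<in> sets borel})"
    using i unfolding indep_set_def sets_vimage_algebra
    by (rule indep_sets_mono_sets) (use sub in \<open>auto split: bool.split\<close>)
qed

text \<open>Independence of the increment from \<open>Fil s\<close> and its Gaussian moments. The
  case s = t is separate because \<open>wiener_process\<close> describes only increments over
  nondegenerate intervals.\<close>

lemma expectation_mult_incr:
  assumes "0 \<le> s" "s \<le> t" and Z: "Z \<in> borel_measurable (Fil s)" "integrable M Z"
  shows "integrable M (\<lambda>\<omega>. Z \<omega> * incr s t \<omega>)" "expectation (\<lambda>\<omega>. Z \<omega> * incr s t \<omega>) = 0"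
    "integrable M (\<lambda>\<omega>. Z \<omega> * (incr s t \<omega>)\<^sup>2)"
    "expectation (\<lambda>\<omega>. Z \<omega> * (incr s t \<omega>)\<^sup>2) = (t - s) * expectation Z"
proof -
  have "integrable M (\<lambda>\<omega>. Z \<omega> * incr s t \<omega>) \<and> expectation (\<lambda>\<omega>. Z \<omega> * incr s t \<omega>) = 0 \<and>
    integrable M (\<lambda>\<omega>. Z \<omega> * (incr s t \<omega>)\<^sup>2) \<and>
    expectation (\<lambda>\<omega>. Z \<omega> * (incr s t \<omega>)\<^sup>2) = (t - s) * expectation Z"
  proof (cases "s = t")
    case True
    then show ?thesis by (simp add: incr_def)
  next
    case False
    then have "s < t" using assms by simp
    note m = incr_moments[OF assms(1) this]
    note ind = incr_indep[OF assms(1) \<open>s < t\<close> Z(1)]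
    have ind2: "indep_var borel Z borel (\<lambda>\<omega>. (incr s t \<omega>)\<^sup>2)"
      using indep_var_compose[OF ind, of "\<lambda>x. x" borel "\<lambda>x. x\<^sup>2" borel] by (simp add: comp_def)
    show ?thesis
      using indep_var_integrable[OF ind Z(2) m(1)] indep_var_lebesgue_integral[OF ind Z(2) m(1)]
        indep_var_integrable[OF ind2 Z(2) m(3)] indep_var_lebesgue_integral[OF ind2 Z(2) m(3)] m
      by simp
  qed
  then show "integrable M (\<lambda>\<omega>. Z \<omega> * incr s t \<omega>)" "expectation (\<lambda>\<omega>. Z \<omega> * incr s t \<omega>) = 0"
    "integrable M (\<lambda>\<omega>. Z \<omega> * (incr s t \<omega>)\<^sup>2)"
    "expectation (\<lambda>\<omega>. Z \<omega> * (incr s t \<omega>)\<^sup>2) = (t - s) * expectation Z" by auto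
qed

definition bounded_at :: "real \<Rightarrow> ('a \<Rightarrow> real) \<Rightarrow> bool" where
  "bounded_at s \<xi> \<longleftrightarrow> \<xi> \<in> borel_measurable (Fil s) \<and> (\<exists>C. \<forall>\<omega>\<in>space M. \<bar>\<xi> \<omega>\<bar> \<le> C)"

lemma bounded_at_mono: "0 \<le> s \<Longrightarrow> s \<le> t \<Longrightarrow> bounded_at s \<xi> \<Longrightarrow> bounded_at t \<xi>"
  unfolding bounded_at_def using Fil_measurable_mono by blast

lemma bounded_at_mult:
  assumes "bounded_at s \<xi>" "bounded_at s \<eta>"
  shows "bounded_at s (\<lambda>\<omega>. \<xi> \<omega> * \<eta> \<omega>)"
proof -
  obtain C D where "\<forall>\<omega>\<in>space M. \<bar>\<xi> \<omega>\<bar> \<le> C" "\<forall>\<omega>\<in>space M. \<bar>\<eta> \<omega>\<bar> \<le> D"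
    using assms unfolding bounded_at_def by blast
  then have "\<forall>\<omega>\<in>space M. \<bar>\<xi> \<omega> * \<eta> \<omega>\<bar> \<le> \<bar>C\<bar> * \<bar>D\<bar>"
    by (auto simp: abs_mult intro!: mult_mono)
  then show ?thesis using assms unfolding bounded_at_def by auto
qed

lemma bounded_at_integrable_mult:
  assumes "0 \<le> s" "bounded_at s \<xi>" "integrable M f"
  shows "integrable M (\<lambda>\<omega>. \<xi> \<omega> * f \<omega>)"
proof -
  obtain C where C: "\<forall>\<omega>\<in>space M. \<bar>\<xi> \<omega>\<bar> \<le> C" using assms unfolding bounded_at_def by blast
  have [measurable]: "\<xi> \<in> borel_measurable M" "f \<in> borel_measurable M"
    using assms Fil_measurable unfolding bounded_at_def by auto
  show ?thesis
  proof (rule Bochner_Integration.integrable_bound)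
    show "integrable M (\<lambda>\<omega>. C * f \<omega>)" using assms by simp
    show "AE \<omega> in M. norm (\<xi> \<omega> * f \<omega>) \<le> norm (C * f \<omega>)"
    proof (rule AE_I2)
      fix \<omega> assume "\<omega> \<in> space M"
      then have "\<bar>\<xi> \<omega>\<bar> \<le> \<bar>C\<bar>" using C by fastforce
      then show "norm (\<xi> \<omega> * f \<omega>) \<le> norm (C * f \<omega>)" by (simp add: abs_mult mult_right_mono)
    qed
  qed measurable
qed

lemma bounded_at_integrable: "0 \<le> s \<Longrightarrow> bounded_at s \<xi> \<Longrightarrow> integrable M \<xi>"
  using bounded_at_integrable_mult[of s \<xi> "\<lambda>_. 1"] by simp

text \<open>The product is split at c and at the end of the overlap. An increment that starts when
  the rest of its term is already known is independent of that rest and has mean 0, so only the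
  squared increment over the overlap contributes.\<close>

lemma expectation_incr_incr_aux:
  assumes "0 \<le> a" "a \<le> b" "c \<le> d" "a \<le> c" "bounded_at a \<xi>" "bounded_at c \<eta>"
  shows "integrable M (\<lambda>\<omega>. (\<xi> \<omega> * incr a b \<omega>) * (\<eta> \<omega> * incr c d \<omega>)) \<and>
    expectation (\<lambda>\<omega>. (\<xi> \<omega> * incr a b \<omega>) * (\<eta> \<omega> * incr c d \<omega>))
      = expectation (\<lambda>\<omega>. \<xi> \<omega> * \<eta> \<omega>) * max 0 (min b d - max a c)"
proof -
  define \<zeta> where "\<zeta> = (\<lambda>\<omega>. \<xi> \<omega> * \<eta> \<omega>)"
  have z: "bounded_at c \<zeta>" unfolding \<zeta>_def
    using assms bounded_at_mono[of a c \<xi>] by (intro bounded_at_mult) auto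
  have zm: "\<zeta> \<in> borel_measurable (Fil c)" using z by (simp add: bounded_at_def)
  have i_incr: "integrable M (incr s t)" if "0 \<le> s" "s \<le> t" for s t
    using incr_moments(1)[of s t] that by (cases "s = t") (auto simp: incr_def[abs_def])
  show ?thesis
  proof (cases "b \<le> c")
    case True
    let ?Z = "\<lambda>\<omega>. \<zeta> \<omega> * incr a b \<omega>"
    have "?Z \<in> borel_measurable (Fil c)"
      using assms True Fil_measurable_mono[of b c "incr a b"] incr_Fil_measurable[of a b]
      by (intro borel_measurable_times zm) auto
    moreover have "integrable M ?Z" using assms by (intro bounded_at_integrable_mult[OF _ z] i_incr) auto
    ultimately have "integrable M (\<lambda>\<omega>. ?Z \<omega> * incr c d \<omega>)" "expectation (\<lambda>\<omega>. ?Z \<omega> * incr c d \<omega>) = 0"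
      using assms expectation_mult_incr(1,2)[of c d ?Z] by auto
    moreover have "(\<lambda>\<omega>. ?Z \<omega> * incr c d \<omega>) = (\<lambda>\<omega>. (\<xi> \<omega> * incr a b \<omega>) * (\<eta> \<omega> * incr c d \<omega>))"
      by (simp add: \<zeta>_def mult_ac)
    ultimately show ?thesis using True assms by simp
  next
    case False
    \<comment> \<open>e ends the overlap and g is the later of the two ends: one of the increments
      from c is \<open>incr c e\<close>, the other adds \<open>incr e g\<close>. This treats b \<le>
      d and d < b alike.\<close>
    define e g where "e = min b d" and "g = max b d"
    let ?Z1 = "\<lambda>\<omega>. \<zeta> \<omega> * incr a c \<omega>" and ?Z2 = "\<lambda>\<omega>. \<zeta> \<omega> * incr c e \<omega>"
    have e: "0 \<le> c" "c \<le> e" "e \<le> g" using assms False by (auto simp: e_def g_def)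
    have "?Z1 \<in> borel_measurable (Fil c)"
      using assms by (intro borel_measurable_times zm incr_Fil_measurable) auto
    moreover have "integrable M ?Z1" using assms by (intro bounded_at_integrable_mult[OF _ z] i_incr) auto
    ultimately have 1: "integrable M (\<lambda>\<omega>. ?Z1 \<omega> * incr c d \<omega>)" "expectation (\<lambda>\<omega>. ?Z1 \<omega> * incr c d \<omega>) = 0"
      using assms e expectation_mult_incr(1,2)[of c d ?Z1] by auto
    have "?Z2 \<in> borel_measurable (Fil e)"
      using e Fil_measurable_mono[of c e \<zeta>] zm by (intro borel_measurable_times incr_Fil_measurable) auto
    moreover have "integrable M ?Z2" using e by (intro bounded_at_integrable_mult[OF _ z] i_incr) auto
    ultimately have 2: "integrable M (\<lambda>\<omega>. ?Z2 \<omega> * incr e g \<omega>)" "expectation (\<lambda>\<omega>. ?Z2 \<omega> * incr e g \<omega>) = 0"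
      using e expectation_mult_incr(1,2)[of e g ?Z2] by auto
    note 3 = expectation_mult_incr(3,4)[OF e(1,2) zm bounded_at_integrable[OF e(1) z]]
    have eq: "(\<lambda>\<omega>. (\<xi> \<omega> * incr a b \<omega>) * (\<eta> \<omega> * incr c d \<omega>))
        = (\<lambda>\<omega>. ?Z1 \<omega> * incr c d \<omega> + (\<zeta> \<omega> * (incr c e \<omega>)\<^sup>2 + ?Z2 \<omega> * incr e g \<omega>))"
    proof (rule ext)
      fix \<omega>
      have "incr c b \<omega> * incr c d \<omega> = incr c e \<omega> * (incr c e \<omega> + incr e g \<omega>)"
        by (cases "b \<le> d") (auto simp: e_def g_def incr_def min_def max_def algebra_simps)
      moreover have "incr a b \<omega> = incr a c \<omega> + incr c b \<omega>" by (simp add: incr_def)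
      ultimately have "incr a b \<omega> * incr c d \<omega>
          = incr a c \<omega> * incr c d \<omega> + incr c e \<omega> * (incr c e \<omega> + incr e g \<omega>)" by (simp add: distrib_right)
      then have "\<zeta> \<omega> * (incr a b \<omega> * incr c d \<omega>)
          = \<zeta> \<omega> * (incr a c \<omega> * incr c d \<omega> + incr c e \<omega> * (incr c e \<omega> + incr e g \<omega>))" by simp
      then show "(\<xi> \<omega> * incr a b \<omega>) * (\<eta> \<omega> * incr c d \<omega>)
        = ?Z1 \<omega> * incr c d \<omega> + (\<zeta> \<omega> * (incr c e \<omega>)\<^sup>2 + ?Z2 \<omega> * incr e g \<omega>)"
        by (simp add: \<zeta>_def power2_eq_square algebra_simps)
    qed
    have "max 0 (min b d - max a c) = e - c" using assms e by (simp add: e_def max_def)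
    then show ?thesis unfolding eq using 1 2 3 by (simp add: \<zeta>_def[symmetric])
  qed
qed

text \<open>The length of the overlap becomes an integral of indicators, the form in which it
  matches the product of two simple processes.\<close>

lemma expectation_incr_incr:
  assumes "0 \<le> a" "a \<le> b" "0 \<le> c" "c \<le> d" "bounded_at a \<xi>" "bounded_at c \<eta>"
  shows "integrable M (\<lambda>\<omega>. (\<xi> \<omega> * incr a b \<omega>) * (\<eta> \<omega> * incr c d \<omega>))"
    and "expectation (\<lambda>\<omega>. (\<xi> \<omega> * incr a b \<omega>) * (\<eta> \<omega> * incr c d \<omega>))
      = expectation (\<lambda>\<omega>. \<xi> \<omega> * \<eta> \<omega>) * (LBINT u. indicator {a<..b} u * indicator {c<..d} u)"
proof -
  have "(LBINT u. indicator {a<..b} u * indicator {c<..d} u) = (LBINT u. indicat_real {max a c<..min b d} u)"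
    by (intro Bochner_Integration.integral_cong refl) (auto simp: indicator_def)
  also have "\<dots> = max 0 (min b d - max a c)"
    by (cases "max a c \<le> min b d") (auto simp: max_def)
  finally have *: "(LBINT u. indicator {a<..b} u * indicator {c<..d} u) = max 0 (min b d - max a c)" .
  have "integrable M (\<lambda>\<omega>. (\<xi> \<omega> * incr a b \<omega>) * (\<eta> \<omega> * incr c d \<omega>)) \<and>
    expectation (\<lambda>\<omega>. (\<xi> \<omega> * incr a b \<omega>) * (\<eta> \<omega> * incr c d \<omega>))
      = expectation (\<lambda>\<omega>. \<xi> \<omega> * \<eta> \<omega>) * max 0 (min b d - max a c)"
  proof (cases "a \<le> c")
    case True
    then show ?thesis using assms expectation_incr_incr_aux[of a b c d \<xi> \<eta>] by auto
  next
    case False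
    then show ?thesis using assms expectation_incr_incr_aux[of c d a b \<eta> \<xi>]
      by (simp add: mult.commute min.commute max.commute)
  qed
  then show "integrable M (\<lambda>\<omega>. (\<xi> \<omega> * incr a b \<omega>) * (\<eta> \<omega> * incr c d \<omega>))"
    and "expectation (\<lambda>\<omega>. (\<xi> \<omega> * incr a b \<omega>) * (\<eta> \<omega> * incr c d \<omega>))
      = expectation (\<lambda>\<omega>. \<xi> \<omega> * \<eta> \<omega>) * (LBINT u. indicator {a<..b} u * indicator {c<..d} u)"
    unfolding * by auto
qed

end

lemma integral_double_sum:
  fixes c :: "nat \<Rightarrow> nat \<Rightarrow> 'a \<Rightarrow> real"
  assumes c: "\<And>i j. i < n \<Longrightarrow> j < n' \<Longrightarrow> integrable N (c i j)"
  shows "(\<integral>x. (\<Sum>i<n. \<Sum>j<n'. c i j x) \<partial>N) = (\<Sum>i<n. \<Sum>j<n'. \<integral>x. c i j x \<partial>N)"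
proof -
  have "(\<integral>x. (\<Sum>i<n. \<Sum>j<n'. c i j x) \<partial>N) = (\<Sum>i<n. \<integral>x. (\<Sum>j<n'. c i j x) \<partial>N)"
    by (rule Bochner_Integration.integral_sum) (use c in \<open>auto intro!: Bochner_Integration.integrable_sum\<close>)
  also have "\<dots> = (\<Sum>i<n. \<Sum>j<n'. \<integral>x. c i j x \<partial>N)"
    by (intro sum.cong refl Bochner_Integration.integral_sum) (use c in auto)
  finally show ?thesis .
qed

section \<open>The isometry for simple processes and its passage to mean square limits\<close>

context wiener_space begin

interpretation prd: pair_sigma_finite M lborel ..

lemma integrable_product_lborel:
  fixes f :: "'a \<Rightarrow> real" and g :: "real \<Rightarrow> real"
  assumes "integrable M f" "integrable lborel g"
  shows "integrable (M \<Otimes>\<^sub>M lborel) (\<lambda>x. f (fst x) * g (snd x))"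
    and "(\<integral>x. f (fst x) * g (snd x) \<partial>(M \<Otimes>\<^sub>M lborel)) = expectation f * (LBINT u. g u)"
proof -
  have [measurable]: "f \<in> borel_measurable M" "g \<in> borel_measurable borel" using assms by auto
  show i: "integrable (M \<Otimes>\<^sub>M lborel) (\<lambda>x. f (fst x) * g (snd x))"
  proof (rule prd.Fubini_integrable)
    show "integrable M (\<lambda>\<omega>. LBINT u. norm (f (fst (\<omega>, u)) * g (snd (\<omega>, u))))"
      using assms(1) by (simp add: abs_mult)
  qed (use assms in auto)
  have "(\<integral>x. f (fst x) * g (snd x) \<partial>(M \<Otimes>\<^sub>M lborel)) = (\<integral>\<omega>. (LBINT u. f \<omega> * g u) \<partial>M)"
    using prd.integral_fst'[OF i] by simp
  then show "(\<integral>x. f (fst x) * g (snd x) \<partial>(M \<Otimes>\<^sub>M lborel)) = expectation f * (LBINT u. g u)"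
    by simp
qed

lemma simple_integrandD:
  assumes "simple_integrand M Fil t n \<tau> \<xi>" "i < n"
  shows "0 \<le> \<tau> i" "\<tau> i \<le> \<tau> (Suc i)" "\<tau> (Suc i) \<le> t" "bounded_at (\<tau> i) (\<xi> i)"
  using assms unfolding simple_integrand_def bounded_at_def by auto

lemma simple_ito_integral_eq:
  "simple_ito_integral W n \<tau> \<xi> \<omega> = (\<Sum>i<n. \<xi> i \<omega> * incr (\<tau> i) (\<tau> (Suc i)) \<omega>)"
  by (simp add: simple_ito_integral_def incr_def)

lemma simple_ito_integral_measurable:
  assumes "simple_integrand M Fil t n \<tau> \<xi>"
  shows "simple_ito_integral W n \<tau> \<xi> \<in> borel_measurable M"
  unfolding simple_ito_integral_eq[abs_def]
proof (intro borel_measurable_sum borel_measurable_times)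
  fix i assume "i \<in> {..<n}"
  then show "\<xi> i \<in> borel_measurable M" "incr (\<tau> i) (\<tau> (Suc i)) \<in> borel_measurable M"
    using simple_integrandD[OF assms, of i] Fil_measurable incr_measurable unfolding bounded_at_def by auto
qed

lemma simple_process_measurable:
  assumes "simple_integrand M Fil t n \<tau> \<xi>"
  shows "(\<lambda>x. simple_process n \<tau> \<xi> (snd x) (fst x)) \<in> borel_measurable (M \<Otimes>\<^sub>M lborel)"
  unfolding simple_process_def
proof (intro borel_measurable_sum borel_measurable_times)
  fix i assume "i \<in> {..<n}"
  then have [measurable]: "\<xi> i \<in> borel_measurable M"
    using simple_integrandD[OF assms, of i] Fil_measurable unfolding bounded_at_def by auto
  show "(\<lambda>x. \<xi> i (fst x)) \<in> borel_measurable (M \<Otimes>\<^sub>M lborel)" by measurable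
  show "(\<lambda>x. indicator {\<tau> i<..\<tau> (Suc i)} (snd x) :: real) \<in> borel_measurable (M \<Otimes>\<^sub>M lborel)" by measurable
qed

lemma simple_process_outside:
  assumes "simple_integrand M Fil t n \<tau> \<xi>" "u \<notin> {0..t}"
  shows "simple_process n \<tau> \<xi> u \<omega> = 0"
  unfolding simple_process_def
proof (rule sum.neutral, intro ballI)
  fix i assume "i \<in> {..<n}"
  then have "u \<notin> {\<tau> i<..\<tau> (Suc i)}" using simple_integrandD[OF assms(1), of i] assms(2) by auto
  then show "\<xi> i \<omega> * indicator {\<tau> i<..\<tau> (Suc i)} u = 0" by simp
qed

lemma expectation_simple_ito_integral:
  assumes "simple_integrand M Fil t n \<tau> \<xi>"
  shows "expectation (simple_ito_integral W n \<tau> \<xi>) = 0"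
proof -
  have i: "integrable M (\<lambda>\<omega>. \<xi> i \<omega> * incr (\<tau> i) (\<tau> (Suc i)) \<omega>)
      \<and> expectation (\<lambda>\<omega>. \<xi> i \<omega> * incr (\<tau> i) (\<tau> (Suc i)) \<omega>) = 0" if "i < n" for i
  proof -
    note D = simple_integrandD[OF assms that]
    have "\<xi> i \<in> borel_measurable (Fil (\<tau> i))" using D by (simp add: bounded_at_def)
    then show ?thesis
      using expectation_mult_incr(1,2)[OF D(1,2) _ bounded_at_integrable[OF D(1,4)]] by simp
  qed
  have "expectation (simple_ito_integral W n \<tau> \<xi>)
      = (\<Sum>i<n. expectation (\<lambda>\<omega>. \<xi> i \<omega> * incr (\<tau> i) (\<tau> (Suc i)) \<omega>))"
    unfolding simple_ito_integral_eq[abs_def]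
    by (rule Bochner_Integration.integral_sum) (use i in auto)
  then show ?thesis using i by simp
qed

text \<open>Both sides are double sums over pairs of steps and agree pair by pair, so partitions and
  horizons may differ and no common refinement is formed.\<close>

lemma simple_ito_isometry:
  assumes S: "simple_integrand M Fil s n \<tau> \<xi>" and T: "simple_integrand M Fil t n' \<tau>' \<xi>'"
  shows "integrable M (\<lambda>\<omega>. simple_ito_integral W n \<tau> \<xi> \<omega> * simple_ito_integral W n' \<tau>' \<xi>' \<omega>)" (is ?I1)
    and "integrable (M \<Otimes>\<^sub>M lborel) (\<lambda>x. simple_process n \<tau> \<xi> (snd x) (fst x) * simple_process n' \<tau>' \<xi>' (snd x) (fst x))" (is ?I2)
    and "expectation (\<lambda>\<omega>. simple_ito_integral W n \<tau> \<xi> \<omega> * simple_ito_integral W n' \<tau>' \<xi>' \<omega>)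
      = (\<integral>x. simple_process n \<tau> \<xi> (snd x) (fst x) * simple_process n' \<tau>' \<xi>' (snd x) (fst x) \<partial>(M \<Otimes>\<^sub>M lborel))" (is ?E)
proof -
  define a where "a = (\<lambda>i j \<omega>. (\<xi> i \<omega> * incr (\<tau> i) (\<tau> (Suc i)) \<omega>) * (\<xi>' j \<omega> * incr (\<tau>' j) (\<tau>' (Suc j)) \<omega>))"
  define b where "b = (\<lambda>i j x. (\<xi> i (fst x) * \<xi>' j (fst x))
    * (indicator {\<tau> i<..\<tau> (Suc i)} (snd x) * indicator {\<tau>' j<..\<tau>' (Suc j)} (snd x)) :: real)"
  have ab: "integrable M (a i j) \<and> integrable (M \<Otimes>\<^sub>M lborel) (b i j)
      \<and> expectation (a i j) = (\<integral>x. b i j x \<partial>(M \<Otimes>\<^sub>M lborel))" if "i < n" "j < n'" for i j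
  proof -
    note D = simple_integrandD[OF S that(1)] and D' = simple_integrandD[OF T that(2)]
    define m where "m = max (\<tau> i) (\<tau>' j)"
    have "bounded_at m (\<lambda>\<omega>. \<xi> i \<omega> * \<xi>' j \<omega>)"
      using D D' bounded_at_mono[of "\<tau> i" m "\<xi> i"] bounded_at_mono[of "\<tau>' j" m "\<xi>' j"]
      by (intro bounded_at_mult) (auto simp: m_def)
    then have "integrable M (\<lambda>\<omega>. \<xi> i \<omega> * \<xi>' j \<omega>)"
      using D by (intro bounded_at_integrable[of m]) (auto simp: m_def)
    note 1 = this
    have 2: "integrable lborel (\<lambda>u. indicator {\<tau> i<..\<tau> (Suc i)} u * indicator {\<tau>' j<..\<tau>' (Suc j)} u :: real)"
      using D D' by (intro integrable_real_mult_indicator integrable_real_indicator)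
        (auto simp: emeasure_lborel_Ioc)
    show ?thesis
      using expectation_incr_incr[OF D(1,2) D'(1,2) D(4) D'(4)] integrable_product_lborel[OF 1 2]
      unfolding a_def b_def by simp
  qed
  have I: "simple_ito_integral W n \<tau> \<xi> \<omega> * simple_ito_integral W n' \<tau>' \<xi>' \<omega> = (\<Sum>i<n. \<Sum>j<n'. a i j \<omega>)" for \<omega>
    unfolding simple_ito_integral_eq a_def by (simp add: sum_product)
  have P: "simple_process n \<tau> \<xi> (snd x) (fst x) * simple_process n' \<tau>' \<xi>' (snd x) (fst x) = (\<Sum>i<n. \<Sum>j<n'. b i j x)" for x
    unfolding simple_process_def b_def sum_product by (intro sum.cong refl) (simp only: mult_ac)
  show ?I1 ?I2 unfolding I P using ab by (auto intro!: Bochner_Integration.integrable_sum)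
  have "expectation (\<lambda>\<omega>. \<Sum>i<n. \<Sum>j<n'. a i j \<omega>) = (\<Sum>i<n. \<Sum>j<n'. expectation (a i j))"
    using ab by (intro integral_double_sum) auto
  also have "\<dots> = (\<Sum>i<n. \<Sum>j<n'. \<integral>x. b i j x \<partial>(M \<Otimes>\<^sub>M lborel))" using ab by simp
  also have "\<dots> = (\<integral>x. (\<Sum>i<n. \<Sum>j<n'. b i j x) \<partial>(M \<Otimes>\<^sub>M lborel))"
    using ab by (intro integral_double_sum[symmetric]) auto
  finally show ?E unfolding I P .
qed

text \<open>\<open>H\<close> is replaced by a process \<open>Z\<close> measurable on the whole
  product space that agrees with it on [0, t] off a null set. Simple processes vanish outside
  [0, t], so the iterated integral becomes an integral over the product.\<close>

lemma ito_approximation: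
  assumes J: "has_ito_integral M Fil W t H J"
    and Z[measurable]: "(\<lambda>x. Z (snd x) (fst x)) \<in> borel_measurable (M \<Otimes>\<^sub>M lborel)"
    and HZ: "AE \<omega> in M. \<forall>u\<in>{0..t}. H u \<omega> = Z u \<omega>"
  obtains n \<tau> \<xi> where "\<And>k. simple_integrand M Fil t (n k) (\<tau> k) (\<xi> k)"
    and "(\<lambda>k. \<integral>\<^sup>+x. ennreal ((simple_process (n k) (\<tau> k) (\<xi> k) (snd x) (fst x)
        - indicator {0..t} (snd x) * Z (snd x) (fst x))\<^sup>2) \<partial>(M \<Otimes>\<^sub>M lborel)) \<longlonglongrightarrow> 0"
    and "(\<lambda>k. \<integral>\<^sup>+\<omega>. ennreal ((simple_ito_integral W (n k) (\<tau> k) (\<xi> k) \<omega> - J \<omega>)\<^sup>2) \<partial>M) \<longlonglongrightarrow> 0"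
proof -
  obtain n \<tau> \<xi> where S: "\<And>k. simple_integrand M Fil t (n k) (\<tau> k) (\<xi> k)"
    and P: "(\<lambda>k. \<integral>\<^sup>+\<omega>. (\<integral>\<^sup>+s\<in>{0..t}.
           ennreal ((simple_process (n k) (\<tau> k) (\<xi> k) s \<omega> - H s \<omega>)\<^sup>2) \<partial>lborel) \<partial>M) \<longlonglongrightarrow> 0"
    and I: "(\<lambda>k. \<integral>\<^sup>+\<omega>. ennreal ((simple_ito_integral W (n k) (\<tau> k) (\<xi> k) \<omega> - J \<omega>)\<^sup>2) \<partial>M) \<longlonglongrightarrow> 0"
    using J unfolding has_ito_integral_def by blast
  have "(\<integral>\<^sup>+\<omega>. (\<integral>\<^sup>+s\<in>{0..t}. ennreal ((simple_process (n k) (\<tau> k) (\<xi> k) s \<omega> - H s \<omega>)\<^sup>2) \<partial>lborel) \<partial>M)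
    = (\<integral>\<^sup>+x. ennreal ((simple_process (n k) (\<tau> k) (\<xi> k) (snd x) (fst x)
        - indicator {0..t} (snd x) * Z (snd x) (fst x))\<^sup>2) \<partial>(M \<Otimes>\<^sub>M lborel))" for k
  proof -
    note [measurable] = simple_process_measurable[OF S[of k]]
    have "(\<integral>\<^sup>+\<omega>. (\<integral>\<^sup>+s\<in>{0..t}. ennreal ((simple_process (n k) (\<tau> k) (\<xi> k) s \<omega> - H s \<omega>)\<^sup>2) \<partial>lborel) \<partial>M)
      = (\<integral>\<^sup>+\<omega>. (\<integral>\<^sup>+s. ennreal ((simple_process (n k) (\<tau> k) (\<xi> k) s \<omega> - indicator {0..t} s * Z s \<omega>)\<^sup>2) \<partial>lborel) \<partial>M)"
    proof (rule nn_integral_cong_AE, use HZ in eventually_elim)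
      fix \<omega> assume eq: "\<forall>u\<in>{0..t}. H u \<omega> = Z u \<omega>"
      show "(\<integral>\<^sup>+s\<in>{0..t}. ennreal ((simple_process (n k) (\<tau> k) (\<xi> k) s \<omega> - H s \<omega>)\<^sup>2) \<partial>lborel)
        = (\<integral>\<^sup>+s. ennreal ((simple_process (n k) (\<tau> k) (\<xi> k) s \<omega> - indicator {0..t} s * Z s \<omega>)\<^sup>2) \<partial>lborel)"
      proof (rule nn_integral_cong)
        fix s
        show "ennreal ((simple_process (n k) (\<tau> k) (\<xi> k) s \<omega> - H s \<omega>)\<^sup>2) * indicator {0..t} s
          = ennreal ((simple_process (n k) (\<tau> k) (\<xi> k) s \<omega> - indicator {0..t} s * Z s \<omega>)\<^sup>2)"
          using eq simple_process_outside[OF S[of k], of s \<omega>] by (cases "s \<in> {0..t}") auto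
      qed
    qed
    also have "\<dots> = (\<integral>\<^sup>+x. ennreal ((simple_process (n k) (\<tau> k) (\<xi> k) (snd x) (fst x)
        - indicator {0..t} (snd x) * Z (snd x) (fst x))\<^sup>2) \<partial>(M \<Otimes>\<^sub>M lborel))"
      by (subst lborel.nn_integral_fst[symmetric]) (auto intro!: measurable_compose[OF _ measurable_ennreal])
    finally show ?thesis .
  qed
  note eq = this
  show ?thesis by (rule that[OF S P[unfolded eq] I])
qed

text \<open>J and J' are approximated by unrelated sequences, which the bilinear isometry and
  continuity of inner products allow; the product of the cut-offs to [0, s] and [0, t] leaves
  [0, s]. Mean zero is the inner product with the constant 1.\<close>

lemma ito_covariance:
  assumes J: "has_ito_integral M Fil W s H J" and J': "has_ito_integral M Fil W t H J'" and "s \<le> t"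
    and Z[measurable]: "(\<lambda>x. Z (snd x) (fst x)) \<in> borel_measurable (M \<Otimes>\<^sub>M lborel)"
    and HZ: "AE \<omega> in M. \<forall>u\<in>{0..t}. H u \<omega> = Z u \<omega>"
  shows "integrable M (\<lambda>\<omega>. (J \<omega>)\<^sup>2)" and "expectation J = 0"
    and "integrable (M \<Otimes>\<^sub>M lborel) (\<lambda>x. indicator {0..s} (snd x) * (Z (snd x) (fst x))\<^sup>2)"
    and "expectation (\<lambda>\<omega>. J \<omega> * J' \<omega>)
      = (\<integral>x. indicator {0..s} (snd x) * (Z (snd x) (fst x))\<^sup>2 \<partial>(M \<Otimes>\<^sub>M lborel))"
proof -
  have [measurable]: "J \<in> borel_measurable M" "J' \<in> borel_measurable M"
    using J J' by (auto simp: has_ito_integral_def)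
  have HZ': "AE \<omega> in M. \<forall>u\<in>{0..s}. H u \<omega> = Z u \<omega>"
    using HZ by eventually_elim (use \<open>s \<le> t\<close> in auto)
  obtain n \<tau> \<xi> where S: "\<And>k. simple_integrand M Fil s (n k) (\<tau> k) (\<xi> k)"
    and P: "(\<lambda>k. \<integral>\<^sup>+x. ennreal ((simple_process (n k) (\<tau> k) (\<xi> k) (snd x) (fst x)
        - indicator {0..s} (snd x) * Z (snd x) (fst x))\<^sup>2) \<partial>(M \<Otimes>\<^sub>M lborel)) \<longlonglongrightarrow> 0"
    and I: "(\<lambda>k. \<integral>\<^sup>+\<omega>. ennreal ((simple_ito_integral W (n k) (\<tau> k) (\<xi> k) \<omega> - J \<omega>)\<^sup>2) \<partial>M) \<longlonglongrightarrow> 0"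
    by (rule ito_approximation[OF J Z HZ']) blast
  obtain n' \<tau>' \<xi>' where S': "\<And>k. simple_integrand M Fil t (n' k) (\<tau>' k) (\<xi>' k)"
    and P': "(\<lambda>k. \<integral>\<^sup>+x. ennreal ((simple_process (n' k) (\<tau>' k) (\<xi>' k) (snd x) (fst x)
        - indicator {0..t} (snd x) * Z (snd x) (fst x))\<^sup>2) \<partial>(M \<Otimes>\<^sub>M lborel)) \<longlonglongrightarrow> 0"
    and I': "(\<lambda>k. \<integral>\<^sup>+\<omega>. ennreal ((simple_ito_integral W (n' k) (\<tau>' k) (\<xi>' k) \<omega> - J' \<omega>)\<^sup>2) \<partial>M) \<longlonglongrightarrow> 0"
    by (rule ito_approximation[OF J' Z HZ]) blast
  note mI = simple_ito_integral_measurable[OF S] and mI' = simple_ito_integral_measurable[OF S']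
  note mP = simple_process_measurable[OF S] and mP' = simple_process_measurable[OF S']
  have zm: "(\<lambda>x. indicator {0..a} (snd x) * Z (snd x) (fst x)) \<in> borel_measurable (M \<Otimes>\<^sub>M lborel)" for a
    by measurable
  have sqI: "integrable M (\<lambda>\<omega>. (simple_ito_integral W (n k) (\<tau> k) (\<xi> k) \<omega>)\<^sup>2)"
    and sqP: "integrable (M \<Otimes>\<^sub>M lborel) (\<lambda>x. (simple_process (n k) (\<tau> k) (\<xi> k) (snd x) (fst x))\<^sup>2)" for k
    using simple_ito_isometry(1,2)[OF S[of k] S[of k]] by (simp_all add: power2_eq_square)
  have sqI': "integrable M (\<lambda>\<omega>. (simple_ito_integral W (n' k) (\<tau>' k) (\<xi>' k) \<omega>)\<^sup>2)"
    and sqP': "integrable (M \<Otimes>\<^sub>M lborel) (\<lambda>x. (simple_process (n' k) (\<tau>' k) (\<xi>' k) (snd x) (fst x))\<^sup>2)" for k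
    using simple_ito_isometry(1,2)[OF S'[of k] S'[of k]] by (simp_all add: power2_eq_square)
  show "integrable M (\<lambda>\<omega>. (J \<omega>)\<^sup>2)"
    by (rule L2_limit_square_integrable(1)[OF mI _ sqI I]) simp
  have sq: "(indicator {0..s} (snd x) * Z (snd x) (fst x))\<^sup>2 = indicator {0..s} (snd x) * (Z (snd x) (fst x))\<^sup>2"
    for x by (simp add: power_mult_distrib indicator_def)
  show "integrable (M \<Otimes>\<^sub>M lborel) (\<lambda>x. indicator {0..s} (snd x) * (Z (snd x) (fst x))\<^sup>2)"
    using L2_limit_square_integrable(1)[OF mP zm sqP P] unfolding sq .
  have "(\<lambda>k. expectation (\<lambda>\<omega>. simple_ito_integral W (n k) (\<tau> k) (\<xi> k) \<omega> * 1)) \<longlonglongrightarrow> expectation (\<lambda>\<omega>. J \<omega> * 1)"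
    by (rule L2_limit_inner_product[OF mI _ sqI I]) auto
  then have "(\<lambda>k. 0) \<longlonglongrightarrow> expectation J"
    using expectation_simple_ito_integral[OF S] by simp
  then show "expectation J = 0" by (simp add: LIMSEQ_const_iff)
  have lim1: "(\<lambda>k. expectation (\<lambda>\<omega>. simple_ito_integral W (n k) (\<tau> k) (\<xi> k) \<omega>
      * simple_ito_integral W (n' k) (\<tau>' k) (\<xi>' k) \<omega>)) \<longlonglongrightarrow> expectation (\<lambda>\<omega>. J \<omega> * J' \<omega>)"
    by (rule L2_limit_inner_product[OF mI _ sqI I mI' _ sqI' I']) auto
  have lim2: "(\<lambda>k. \<integral>x. simple_process (n k) (\<tau> k) (\<xi> k) (snd x) (fst x)
      * simple_process (n' k) (\<tau>' k) (\<xi>' k) (snd x) (fst x) \<partial>(M \<Otimes>\<^sub>M lborel))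
      \<longlonglongrightarrow> (\<integral>x. (indicator {0..s} (snd x) * Z (snd x) (fst x)) * (indicator {0..t} (snd x) * Z (snd x) (fst x)) \<partial>(M \<Otimes>\<^sub>M lborel))"
    by (rule L2_limit_inner_product[OF mP zm sqP P mP' zm sqP' P'])
  have "expectation (\<lambda>\<omega>. J \<omega> * J' \<omega>)
    = (\<integral>x. (indicator {0..s} (snd x) * Z (snd x) (fst x)) * (indicator {0..t} (snd x) * Z (snd x) (fst x)) \<partial>(M \<Otimes>\<^sub>M lborel))"
    using lim1 lim2 unfolding simple_ito_isometry(3)[OF S S'] by (rule LIMSEQ_unique)
  also have "\<dots> = (\<integral>x. indicator {0..s} (snd x) * (Z (snd x) (fst x))\<^sup>2 \<partial>(M \<Otimes>\<^sub>M lborel))"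
    by (intro Bochner_Integration.integral_cong refl)
       (use \<open>s \<le> t\<close> in \<open>auto simp: indicator_def power2_eq_square\<close>)
  finally show "expectation (\<lambda>\<omega>. J \<omega> * J' \<omega>)
      = (\<integral>x. indicator {0..s} (snd x) * (Z (snd x) (fst x))\<^sup>2 \<partial>(M \<Otimes>\<^sub>M lborel))" .
qed

end

section \<open>Second moments of mixtures\<close>

text \<open>Nonnegativity of the variance about the mean c; total mass 0 is separate because c
  divides by it.\<close>

lemma (in finite_measure) square_integral_le:
  fixes f :: "'a \<Rightarrow> real"
  assumes [measurable]: "f \<in> borel_measurable M" and sq: "integrable M (\<lambda>x. (f x)\<^sup>2)"
  shows "(\<integral>x. f x \<partial>M)\<^sup>2 \<le> measure M (space M) * (\<integral>x. (f x)\<^sup>2 \<partial>M)"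
proof (cases "measure M (space M) = 0")
  case True
  then have "emeasure M (space M) = 0" by (simp add: emeasure_eq_measure)
  then have "AE x in M. f x = 0" by (intro AE_I[of _ _ "space M"]) auto
  then have "(\<integral>x. f x \<partial>M) = 0" by (rule integral_eq_zero_AE)
  then show ?thesis using True by simp
next
  case False
  define m c where "m = measure M (space M)" and "c = (\<integral>x. f x \<partial>M) / m"
  have "m > 0" using False by (simp add: m_def zero_less_measure_iff)
  have f: "integrable M f"
    using integrable_mult_of_squares[of f M "\<lambda>_. 1"] sq by simp
  have "0 \<le> (\<integral>x. (f x - c)\<^sup>2 \<partial>M)" by simp
  also have "(\<lambda>x. (f x - c)\<^sup>2) = (\<lambda>x. (f x)\<^sup>2 - 2 * c * f x + c\<^sup>2)"
    by (simp add: power2_diff algebra_simps)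
  also have "(\<integral>x. (f x)\<^sup>2 - 2 * c * f x + c\<^sup>2 \<partial>M) = (\<integral>x. (f x)\<^sup>2 \<partial>M) - 2 * c * (\<integral>x. f x \<partial>M) + m * c\<^sup>2"
    using sq f by (simp add: m_def)
  also have "(\<integral>x. f x \<partial>M) = c * m" using \<open>m > 0\<close> by (simp add: c_def)
  finally have "m * c\<^sup>2 \<le> (\<integral>x. (f x)\<^sup>2 \<partial>M)" by (simp add: power2_eq_square algebra_simps)
  then have "m * (m * c\<^sup>2) \<le> m * (\<integral>x. (f x)\<^sup>2 \<partial>M)" using \<open>m > 0\<close> by simp
  moreover have "(\<integral>x. f x \<partial>M)\<^sup>2 = m * (m * c\<^sup>2)" using \<open>m > 0\<close> by (simp add: c_def power2_eq_square)
  ultimately show ?thesis by (simp add: m_def)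
qed

text \<open>Fubini for the squares on the product space. It is applied to the probability space as
  well as to the measure \<open>Q T\<close> below, so that the same averaging can be carried out on
  both sides of the isometry.\<close>

lemma L2_mixture:
  fixes h :: "real \<Rightarrow> 'a \<Rightarrow> real"
  assumes "finite_measure N" "finite_measure \<kappa>" and [measurable_cong]: "sets \<kappa> = sets borel"
    and h: "(\<lambda>x. h (fst x) (snd x)) \<in> borel_measurable (borel \<Otimes>\<^sub>M N)"
    and bound: "AE a in \<kappa>. integrable N (\<lambda>\<omega>. (h a \<omega>)\<^sup>2) \<and> (\<integral>\<omega>. (h a \<omega>)\<^sup>2 \<partial>N) \<le> B"
    and Z[measurable]: "Z \<in> borel_measurable N" and Z2: "integrable N (\<lambda>\<omega>. (Z \<omega>)\<^sup>2)"
  shows "(\<lambda>\<omega>. \<integral>a. h a \<omega> \<partial>\<kappa>) \<in> borel_measurable N"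
    and "integrable N (\<lambda>\<omega>. (\<integral>a. h a \<omega> \<partial>\<kappa>)\<^sup>2)"
    and "(\<integral>\<omega>. Z \<omega> * (\<integral>a. h a \<omega> \<partial>\<kappa>) \<partial>N) = (\<integral>a. (\<integral>\<omega>. Z \<omega> * h a \<omega> \<partial>N) \<partial>\<kappa>)"
proof -
  interpret N: finite_measure N by fact
  interpret K: finite_measure \<kappa> by fact
  interpret P: pair_sigma_finite \<kappa> N ..
  have hm[measurable]: "(\<lambda>x. h (fst x) (snd x)) \<in> borel_measurable (\<kappa> \<Otimes>\<^sub>M N)"
    using h by measurable
  have hm'[measurable]: "(\<lambda>x. h (snd x) (fst x)) \<in> borel_measurable (N \<Otimes>\<^sub>M \<kappa>)"
    using measurable_compose[OF measurable_pair_swap' hm] by (simp add: split_beta')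
  show m: "(\<lambda>\<omega>. \<integral>a. h a \<omega> \<partial>\<kappa>) \<in> borel_measurable N"
    by (rule K.borel_measurable_lebesgue_integral) (use hm' in \<open>simp add: split_beta'\<close>)
  have i: "integrable (\<kappa> \<Otimes>\<^sub>M N) (\<lambda>x. (h (fst x) (snd x))\<^sup>2)"
  proof (rule P.Fubini_integrable)
    show "AE a in \<kappa>. integrable N (\<lambda>\<omega>. (h (fst (a, \<omega>)) (snd (a, \<omega>)))\<^sup>2)"
      using bound by eventually_elim simp
    show "integrable \<kappa> (\<lambda>a. \<integral>\<omega>. norm ((h (fst (a, \<omega>)) (snd (a, \<omega>)))\<^sup>2) \<partial>N)"
    proof (rule K.integrable_const_bound)
      show "AE a in \<kappa>. norm (\<integral>\<omega>. norm ((h (fst (a, \<omega>)) (snd (a, \<omega>)))\<^sup>2) \<partial>N) \<le> B"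
        using bound by eventually_elim simp
      show "(\<lambda>a. \<integral>\<omega>. norm ((h (fst (a, \<omega>)) (snd (a, \<omega>)))\<^sup>2) \<partial>N) \<in> borel_measurable \<kappa>"
        by (rule N.borel_measurable_lebesgue_integral) (use hm in \<open>simp add: split_beta'\<close>)
    qed
  qed measurable
  have z: "integrable (\<kappa> \<Otimes>\<^sub>M N) (\<lambda>x. (Z (snd x))\<^sup>2)"
    by (rule P.Fubini_integrable) (use Z2 in auto)
  have "integrable (\<kappa> \<Otimes>\<^sub>M N) (\<lambda>x. Z (snd x) * h (fst x) (snd x))"
    by (rule integrable_mult_of_squares) (use i z in auto)
  then have "integrable (\<kappa> \<Otimes>\<^sub>M N) (\<lambda>(a, \<omega>). Z \<omega> * h a \<omega>)" by (simp add: split_beta')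
  from P.Fubini_integral[OF this]
  show "(\<integral>\<omega>. Z \<omega> * (\<integral>a. h a \<omega> \<partial>\<kappa>) \<partial>N) = (\<integral>a. (\<integral>\<omega>. Z \<omega> * h a \<omega> \<partial>N) \<partial>\<kappa>)" by simp
  have "(\<lambda>(a, \<omega>). (h a \<omega>)\<^sup>2) = (\<lambda>x. (h (fst x) (snd x))\<^sup>2)" by auto
  then have i': "integrable (\<kappa> \<Otimes>\<^sub>M N) (\<lambda>(a, \<omega>). (h a \<omega>)\<^sup>2)" using i by simp
  note s = P.integrable_snd[OF i'] P.AE_integrable_snd[OF i']
  show "integrable N (\<lambda>\<omega>. (\<integral>a. h a \<omega> \<partial>\<kappa>)\<^sup>2)"
  proof (rule Bochner_Integration.integrable_bound)
    show "integrable N (\<lambda>\<omega>. measure \<kappa> (space \<kappa>) * (\<integral>a. (h a \<omega>)\<^sup>2 \<partial>\<kappa>))"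
      using s(1) by (rule integrable_mult_right)
    show "(\<lambda>\<omega>. (\<integral>a. h a \<omega> \<partial>\<kappa>)\<^sup>2) \<in> borel_measurable N" using m by measurable
    show "AE \<omega> in N. norm ((\<integral>a. h a \<omega> \<partial>\<kappa>)\<^sup>2) \<le> norm (measure \<kappa> (space \<kappa>) * (\<integral>a. (h a \<omega>)\<^sup>2 \<partial>\<kappa>))"
      using s(2) AE_space
    proof eventually_elim
      case (elim \<omega>)
      have "(\<lambda>a. h a \<omega>) \<in> borel_measurable \<kappa>"
        using measurable_compose[OF measurable_Pair2'[OF elim(2), of \<kappa>] hm] by simp
      from K.square_integral_le[OF this elim(1)] show ?case by simp
    qed
  qed
qed

lemma square_diff_integrable:
  fixes f g :: "'b \<Rightarrow> real"
  assumes "f \<in> borel_measurable N" "g \<in> borel_measurable N"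
    "integrable N (\<lambda>x. (f x)\<^sup>2)" "integrable N (\<lambda>x. (g x)\<^sup>2)"
  shows "integrable N (\<lambda>x. (f x - g x)\<^sup>2)"
proof -
  have "integrable N (\<lambda>x. (f x)\<^sup>2 - 2 * (f x * g x) + (g x)\<^sup>2)"
    using integrable_mult_of_squares[OF assms] assms by simp
  then show ?thesis by (simp add: power2_diff algebra_simps)
qed

text \<open>Of the martingale only mean and covariance are kept; filtration and Wiener process are
  gone. \<open>y\<close> is merely locally integrable here, because its local boundedness comes from
  the renewal equation that this computation yields.\<close>

locale delay_moments =
  prob_space M + delay_equation mp mn \<alpha> r + G: delay_functional gp gn \<alpha>
  for M :: "'a measure" and mp mn \<alpha> r gp gn +
  fixes N D :: "real \<Rightarrow> 'a \<Rightarrow> real" and y :: "real \<Rightarrow> real"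
  assumes N_measurable: "(\<lambda>x. N (fst x) (snd x)) \<in> borel_measurable (borel \<Otimes>\<^sub>M M)"
    and D_measurable: "(\<lambda>x. D (fst x) (snd x)) \<in> borel_measurable (borel \<Otimes>\<^sub>M M)"
    and N_neg: "\<And>t \<omega>. t < 0 \<Longrightarrow> N t \<omega> = 0"
    and D_eq: "\<And>t \<omega>. \<omega> \<in> space M \<Longrightarrow> D t \<omega> = N t \<omega> + conv (Shift r) (\<lambda>s. N s \<omega>) t"
    and N_mean: "\<And>t. 0 \<le> t \<Longrightarrow> expectation (N t) = 0"
    and N_square: "\<And>t. 0 \<le> t \<Longrightarrow> integrable M (\<lambda>\<omega>. (N t \<omega>)\<^sup>2)"
    and N_cov: "\<And>s t. 0 \<le> s \<Longrightarrow> s \<le> t \<Longrightarrow> expectation (\<lambda>\<omega>. N s \<omega> * N t \<omega>) = (LBINT v. indicator {0..s} v * y v)"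
    and y_measurable[measurable]: "y \<in> borel_measurable borel"
    and y_nonneg: "\<And>v. 0 \<le> y v"
    and y_neg: "\<And>v. v < 0 \<Longrightarrow> y v = 0"
    and y_integrable: "\<And>t. integrable lborel (\<lambda>v. indicator {0..t} v * y v)"
begin

lemma N_measurable_at[measurable]: "N t \<in> borel_measurable M"
  using measurable_compose[OF measurable_Pair1'[of t borel M] N_measurable] by simp

lemma D_measurable_at[measurable]: "D t \<in> borel_measurable M"
  using measurable_compose[OF measurable_Pair1'[of t borel M] D_measurable] by simp

lemma N_square': "integrable M (\<lambda>\<omega>. (N t \<omega>)\<^sup>2)"
  using N_square[of t] N_neg[of t] by (cases "t < 0") auto

text \<open>The measure y(v) dv, cut off at T so that it is finite and bounded functions are square
  integrable.\<close>

definition Q :: "real \<Rightarrow> real measure" where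
  "Q T = density lborel (\<lambda>v. ennreal (indicator {0..T} v * y v))"

lemma sets_Q[measurable_cong]: "sets (Q T) = sets borel" by (simp add: Q_def)

lemma integral_Q:
  assumes [measurable]: "g \<in> borel_measurable borel"
  shows "(\<integral>v. g v \<partial>Q T) = (LBINT v. indicator {0..T} v * y v * g v)"
  unfolding Q_def by (subst integral_density) (auto simp: y_nonneg)

lemma AE_Q: "AE v in Q T. 0 \<le> v \<and> v \<le> T"
  unfolding Q_def by (subst AE_density) (auto simp: indicator_def)

lemma finite_Q: "finite_measure (Q T)"
proof
  have "emeasure (Q T) (space (Q T)) = (\<integral>\<^sup>+v. ennreal (indicator {0..T} v * y v) \<partial>lborel)"
    unfolding Q_def by (subst emeasure_density) auto
  also have "\<dots> = ennreal (LBINT v. indicator {0..T} v * y v)"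
    by (rule nn_integral_eq_integral[OF y_integrable]) (simp add: y_nonneg)
  finally show "emeasure (Q T) (space (Q T)) \<noteq> \<infinity>" by simp
qed

lemma Q_bounded_square:
  assumes [measurable]: "g \<in> borel_measurable borel" and B: "\<And>v. 0 \<le> v \<Longrightarrow> v \<le> T \<Longrightarrow> \<bar>g v\<bar> \<le> B"
  shows "integrable (Q T) (\<lambda>v. (g v)\<^sup>2)" "(\<integral>v. (g v)\<^sup>2 \<partial>Q T) \<le> measure (Q T) (space (Q T)) * B\<^sup>2"
proof -
  interpret Q: finite_measure "Q T" by (rule finite_Q)
  have ae: "AE v in Q T. norm ((g v)\<^sup>2) \<le> B\<^sup>2"
    using AE_Q
  proof eventually_elim
    case (elim v)
    then have "\<bar>g v\<bar>\<^sup>2 \<le> B\<^sup>2" using B[of v] by (intro power_mono) auto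
    then show ?case by simp
  qed
  show i: "integrable (Q T) (\<lambda>v. (g v)\<^sup>2)" by (rule Q.integrable_const_bound[OF ae]) measurable
  have "(\<integral>v. (g v)\<^sup>2 \<partial>Q T) \<le> (\<integral>v. B\<^sup>2 \<partial>Q T)"
    by (rule integral_mono_AE) (use i ae in auto)
  then show "(\<integral>v. (g v)\<^sup>2 \<partial>Q T) \<le> measure (Q T) (space (Q T)) * B\<^sup>2" by simp
qed

text \<open>
  The martingale \<open>N\<close> is compared with the family of indicator functions of \<open>[0, s]\<close> in \<open>L\<^sup>2(Q T)\<close>, which has
  the same Gram matrix. The predicate says that \<open>Z\<close> and \<open>g\<close> have the same inner products with these
  two families; it is inherited by everything that arises from them by the same linear operations.
\<close>

definition matched :: "real \<Rightarrow> ('a \<Rightarrow> real) \<Rightarrow> (real \<Rightarrow> real) \<Rightarrow> bool" where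
  "matched T Z g \<longleftrightarrow> Z \<in> borel_measurable M \<and> integrable M (\<lambda>\<omega>. (Z \<omega>)\<^sup>2) \<and>
     g \<in> borel_measurable borel \<and> integrable (Q T) (\<lambda>v. (g v)\<^sup>2) \<and>
     (\<forall>s\<le>T. expectation (\<lambda>\<omega>. Z \<omega> * N s \<omega>) = (\<integral>v. g v * heaviside (s - v) \<partial>Q T))"

lemma heaviside_measurable[measurable]: "heaviside \<in> borel_measurable borel"
  by (rule causal_measurable[OF causal_heaviside])

lemma Shift_r_measurable[measurable]: "Shift r \<in> borel_measurable borel"
  by (intro Shift_measurable r_measurable)

lemma heaviside_neg_Q: "s < 0 \<Longrightarrow> (\<integral>v. g v * heaviside (s - v) \<partial>Q T) = 0"
  by (rule integral_eq_zero_AE, use AE_Q in eventually_elim) (auto simp: heaviside_def)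

text \<open>Both inner products are the integral of y over [0, min s t].\<close>

lemma matched_N:
  assumes "0 \<le> s" "s \<le> T"
  shows "matched T (N s) (\<lambda>v. heaviside (s - v))"
  unfolding matched_def
proof (intro conjI allI impI)
  show "integrable M (\<lambda>\<omega>. (N s \<omega>)\<^sup>2)" by (rule N_square[OF assms(1)])
  show "integrable (Q T) (\<lambda>v. (heaviside (s - v))\<^sup>2)"
    by (rule Q_bounded_square[of _ _ 1]) (auto simp: heaviside_def indicator_def)
  fix t assume "t \<le> T"
  show "expectation (\<lambda>\<omega>. N s \<omega> * N t \<omega>) = (\<integral>v. heaviside (s - v) * heaviside (t - v) \<partial>Q T)"
  proof (cases "t < 0")
    case True
    then show ?thesis by (simp add: N_neg heaviside_neg_Q)
  next
    case False
    have "expectation (\<lambda>\<omega>. N s \<omega> * N t \<omega>) = (LBINT v. indicator {0..min s t} v * y v)"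
      using N_cov[of s t] N_cov[of t s] assms False by (cases "s \<le> t") (auto simp: min_def mult.commute)
    also have "\<dots> = (LBINT v. indicator {0..T} v * y v * (heaviside (s - v) * heaviside (t - v)))"
      by (intro Bochner_Integration.integral_cong refl)
         (use assms \<open>t \<le> T\<close> in \<open>auto simp: heaviside_def indicator_def\<close>)
    finally show ?thesis by (subst integral_Q) auto
  qed
qed measurable

text \<open>The constant is orthogonal to every \<open>N s\<close>; paired with it,
  \<open>D t\<close> and \<open>GD t\<close> turn out to have mean 0.\<close>

lemma matched_one: "matched T (\<lambda>_. 1) (\<lambda>_. 0)"
  unfolding matched_def
proof (intro conjI allI impI)
  fix s
  show "expectation (\<lambda>\<omega>. 1 * N s \<omega>) = (\<integral>v. 0 * heaviside (s - v) \<partial>Q T)"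
    using N_neg[of s] N_mean[of s] by (cases "s < 0") auto
qed auto

text \<open>\<open>D t\<close> is \<open>N t\<close> plus an average of \<open>N s\<close> with
  weights F(r) at t - s. The same operation on the indicators of [0, s] gives H + F(r) * H at t - v,
  which is r(t - v) by the equation of r.\<close>

lemma D_square: "integrable M (\<lambda>\<omega>. (D t \<omega>)\<^sup>2)"
  and matched_expectation_D:
    "matched T Z g \<Longrightarrow> t \<le> T \<Longrightarrow> expectation (\<lambda>\<omega>. Z \<omega> * D t \<omega>) = (\<integral>v. g v * r (t - v) \<partial>Q T)"
proof -
  define T' where "T' = (\<lambda>T. max T t)"
  define \<kappa> where "\<kappa> = (\<lambda>T. density lborel (\<lambda>v::real. ennreal (indicator {0..T} v)))"
  have sets_k[measurable_cong]: "sets (\<kappa> T) = sets borel" for T by (simp add: \<kappa>_def)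
  have fin: "finite_measure (\<kappa> T)" for T
  proof
    have "emeasure (\<kappa> T) (space (\<kappa> T)) = (\<integral>\<^sup>+v. indicator {0..T} v \<partial>lborel)"
      unfolding \<kappa>_def by (subst emeasure_density) (auto simp: ennreal_indicator)
    also have "\<dots> = emeasure lborel {0..T}" by (rule nn_integral_indicator) auto
    finally show "emeasure (\<kappa> T) (space (\<kappa> T)) \<noteq> \<infinity>" by (simp add: emeasure_lborel_Icc_eq)
  qed
  have int_k: "(\<integral>s. f s \<partial>\<kappa> T) = (LBINT s. indicator {0..T} s * f s)"
    if [measurable]: "f \<in> borel_measurable borel" for f :: "real \<Rightarrow> real" and T
    unfolding \<kappa>_def by (subst integral_density) auto
  have AE_k: "AE s in \<kappa> T. 0 \<le> s \<and> s \<le> T" for T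
    unfolding \<kappa>_def by (subst AE_density) (auto simp: indicator_def)
  obtain B where B: "B > 0" "\<And>v. v \<le> t \<Longrightarrow> \<bar>Shift r v\<bar> \<le> B"
    using causal_bound[OF causal_Shift[OF r_causal]] by metis
  let ?h = "\<lambda>s \<omega>. Shift r (t - s) * N s \<omega>"
  have hm: "(\<lambda>x. ?h (fst x) (snd x)) \<in> borel_measurable (borel \<Otimes>\<^sub>M M)"
    using N_measurable by measurable
  have hb: "AE s in \<kappa> T. integrable M (\<lambda>\<omega>. (?h s \<omega>)\<^sup>2)
      \<and> expectation (\<lambda>\<omega>. (?h s \<omega>)\<^sup>2) \<le> B\<^sup>2 * (LBINT v. indicator {0..T} v * y v)" for T
    using AE_k
  proof eventually_elim
    case (elim s)
    have "(\<lambda>\<omega>. (?h s \<omega>)\<^sup>2) = (\<lambda>\<omega>. (Shift r (t - s))\<^sup>2 * (N s \<omega>)\<^sup>2)" by (simp add: power_mult_distrib)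
    moreover have "expectation (\<lambda>\<omega>. (N s \<omega>)\<^sup>2) \<le> (LBINT v. indicator {0..T} v * y v)"
      unfolding power2_eq_square N_cov[OF conjunct1[OF elim] order_refl]
      by (rule integral_mono[OF y_integrable y_integrable]) (use elim y_nonneg in \<open>auto simp: indicator_def\<close>)
    moreover have "(Shift r (t - s))\<^sup>2 \<le> B\<^sup>2"
      using B(2)[of "t - s"] elim by (metis abs_ge_zero diff_le_eq le_add_same_cancel1 power2_abs power_mono)
    ultimately show ?case using N_square' by (simp add: mult_mono)
  qed
  have D_mix: "D t \<omega> = N t \<omega> + (\<integral>s. ?h s \<omega> \<partial>\<kappa> T)" if "\<omega> \<in> space M" "t \<le> T" for \<omega> T
  proof -
    have [measurable]: "(\<lambda>s. N s \<omega>) \<in> borel_measurable borel"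
      using measurable_compose[OF measurable_Pair2'[OF that(1), of borel] N_measurable] by simp
    have "(\<integral>s. ?h s \<omega> \<partial>\<kappa> T) = conv (Shift r) (\<lambda>s. N s \<omega>) t"
      unfolding conv_def
    proof (subst int_k, measurable, intro Bochner_Integration.integral_cong refl)
      fix s
      show "indicator {0..T} s * ?h s \<omega> = ?h s \<omega>"
        using that(2) N_neg[of s] causal_neg[OF causal_Shift[OF r_causal], of "t - s"]
        by (cases "s \<in> {0..T}") auto
    qed
    then show ?thesis using D_eq[OF that(1)] by simp
  qed
  note mix = L2_mixture[OF finite_measure_axioms fin sets_k hm hb]
  have mixm: "(\<lambda>\<omega>. \<integral>s. ?h s \<omega> \<partial>\<kappa> T) \<in> borel_measurable M"
    and mix2: "integrable M (\<lambda>\<omega>. (\<integral>s. ?h s \<omega> \<partial>\<kappa> T)\<^sup>2)" for T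
    using mix(1,2)[of "\<lambda>_. 1"] by auto
  show "integrable M (\<lambda>\<omega>. (D t \<omega>)\<^sup>2)"
  proof (rule Bochner_Integration.integrable_bound)
    show "integrable M (\<lambda>\<omega>. 2 * (N t \<omega>)\<^sup>2 + 2 * (\<integral>s. ?h s \<omega> \<partial>\<kappa> t)\<^sup>2)" using N_square' mix2 by simp
    show "AE \<omega> in M. norm ((D t \<omega>)\<^sup>2) \<le> norm (2 * (N t \<omega>)\<^sup>2 + 2 * (\<integral>s. ?h s \<omega> \<partial>\<kappa> t)\<^sup>2)"
    proof (rule AE_I2)
      fix \<omega> assume w: "\<omega> \<in> space M"
      have "(a + b)\<^sup>2 \<le> 2 * a\<^sup>2 + 2 * b\<^sup>2" for a b :: real
        using zero_le_power2[of "a - b"] by (simp add: power2_sum power2_diff)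
      then show "norm ((D t \<omega>)\<^sup>2) \<le> norm (2 * (N t \<omega>)\<^sup>2 + 2 * (\<integral>s. ?h s \<omega> \<partial>\<kappa> t)\<^sup>2)"
        using D_mix[OF w order_refl] by simp
    qed
  qed measurable
  assume Zg: "matched T Z g" and "t \<le> T"
  then have [measurable]: "Z \<in> borel_measurable M" "g \<in> borel_measurable borel"
    and Z2: "integrable M (\<lambda>\<omega>. (Z \<omega>)\<^sup>2)" and g2: "integrable (Q T) (\<lambda>v. (g v)\<^sup>2)"
    and ZN: "\<And>s. s \<le> T \<Longrightarrow> expectation (\<lambda>\<omega>. Z \<omega> * N s \<omega>) = (\<integral>v. g v * heaviside (s - v) \<partial>Q T)"
    by (auto simp: matched_def)
  let ?h' = "\<lambda>s v. Shift r (t - s) * heaviside (s - v)"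
  have "expectation (\<lambda>\<omega>. Z \<omega> * D t \<omega>)
      = expectation (\<lambda>\<omega>. Z \<omega> * N t \<omega> + Z \<omega> * (\<integral>s. ?h s \<omega> \<partial>\<kappa> T))"
    by (intro Bochner_Integration.integral_cong refl) (simp add: D_mix[OF _ \<open>t \<le> T\<close>] distrib_left)
  also have "\<dots> = expectation (\<lambda>\<omega>. Z \<omega> * N t \<omega>) + expectation (\<lambda>\<omega>. Z \<omega> * (\<integral>s. ?h s \<omega> \<partial>\<kappa> T))"
    by (intro Bochner_Integration.integral_add integrable_mult_of_squares Z2 N_square' mix2 mixm) measurable
  also have "expectation (\<lambda>\<omega>. Z \<omega> * (\<integral>s. ?h s \<omega> \<partial>\<kappa> T)) = (\<integral>s. (\<integral>\<omega>. Z \<omega> * ?h s \<omega> \<partial>M) \<partial>\<kappa> T)"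
    by (rule mix(3)) (use Z2 in auto)
  also have "\<dots> = (\<integral>s. (\<integral>v. g v * ?h' s v \<partial>Q T) \<partial>\<kappa> T)"
  proof (rule integral_cong_AE)
    show "AE s in \<kappa> T. (\<integral>\<omega>. Z \<omega> * ?h s \<omega> \<partial>M) = (\<integral>v. g v * ?h' s v \<partial>Q T)"
      using AE_k
    proof eventually_elim
      case (elim s)
      have "(\<integral>\<omega>. Z \<omega> * ?h s \<omega> \<partial>M) = (\<integral>\<omega>. Shift r (t - s) * (Z \<omega> * N s \<omega>) \<partial>M)"
        by (intro Bochner_Integration.integral_cong refl) (simp add: mult_ac)
      also have "\<dots> = (\<integral>v. Shift r (t - s) * (g v * heaviside (s - v)) \<partial>Q T)"
        using elim by (simp add: ZN)
      also have "\<dots> = (\<integral>v. g v * ?h' s v \<partial>Q T)"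
        by (intro Bochner_Integration.integral_cong refl) (simp add: mult_ac)
      finally show ?case .
    qed
    show "(\<lambda>s. \<integral>\<omega>. Z \<omega> * ?h s \<omega> \<partial>M) \<in> borel_measurable (\<kappa> T)"
      using N_measurable by measurable
    interpret Q: finite_measure "Q T" by (rule finite_Q)
    show "(\<lambda>s. \<integral>v. g v * ?h' s v \<partial>Q T) \<in> borel_measurable (\<kappa> T)" by measurable
  qed
  also have "\<dots> = (\<integral>v. g v * (\<integral>s. ?h' s v \<partial>\<kappa> T) \<partial>Q T)"
  proof (rule L2_mixture(3)[symmetric, OF finite_Q fin sets_k])
    show "(\<lambda>x. ?h' (fst x) (snd x)) \<in> borel_measurable (borel \<Otimes>\<^sub>M Q T)" by measurable
    show "AE s in \<kappa> T. integrable (Q T) (\<lambda>v. (?h' s v)\<^sup>2)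
      \<and> (\<integral>v. (?h' s v)\<^sup>2 \<partial>Q T) \<le> measure (Q T) (space (Q T)) * B\<^sup>2"
      using AE_k
    proof eventually_elim
      case (elim s)
      have "\<bar>?h' s v\<bar> \<le> B" for v using B(1) B(2)[of "t - s"] elim by (auto simp: heaviside_def indicator_def)
      then show ?case using Q_bounded_square[of "\<lambda>v. ?h' s v" T B] by simp
    qed
  qed (use g2 in auto)
  also have "\<dots> = (\<integral>v. g v * (r (t - v) - heaviside (t - v)) \<partial>Q T)"
  proof (rule integral_cong_AE)
    interpret k: finite_measure "\<kappa> T" by (rule fin)
    show "(\<lambda>v. g v * (\<integral>s. ?h' s v \<partial>\<kappa> T)) \<in> borel_measurable (Q T)" by measurable
    show "AE v in Q T. g v * (\<integral>s. ?h' s v \<partial>\<kappa> T) = g v * (r (t - v) - heaviside (t - v))"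
      using AE_Q
    proof eventually_elim
      case (elim v)
      have "(\<integral>s. ?h' s v \<partial>\<kappa> T) = (LBINT s. indicator {0..T} s * ?h' s v)" by (rule int_k) measurable
      also have "\<dots> = (LBINT s. ?h' s v)"
      proof (intro Bochner_Integration.integral_cong refl)
        fix s
        show "indicator {0..T} s * ?h' s v = ?h' s v"
          using elim \<open>t \<le> T\<close> causal_neg[OF causal_Shift[OF r_causal], of "t - s"]
          by (cases "s \<in> {0..T}") (auto simp: heaviside_def)
      qed
      also have "\<dots> = conv (Shift r) heaviside (t - v)"
        unfolding conv_def
        by (subst lborel_integral_real_affine[where c=1 and t=v]) (auto simp: algebra_simps)
      also have "\<dots> = r (t - v) - heaviside (t - v)"
        by (subst conv_commute) (simp add: conv_heaviside_Shift_r)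
      finally show ?case by simp
    qed
  qed measurable
  also have "expectation (\<lambda>\<omega>. Z \<omega> * N t \<omega>) = (\<integral>v. g v * heaviside (t - v) \<partial>Q T)"
    by (rule ZN[OF \<open>t \<le> T\<close>])
  also have "(\<integral>v. g v * heaviside (t - v) \<partial>Q T) + (\<integral>v. g v * (r (t - v) - heaviside (t - v)) \<partial>Q T)
     = (\<integral>v. g v * heaviside (t - v) + g v * (r (t - v) - heaviside (t - v)) \<partial>Q T)"
  proof (rule Bochner_Integration.integral_add[symmetric])
    obtain C where C: "C > 0" "\<And>v. v \<le> t \<Longrightarrow> \<bar>r v - heaviside v\<bar> \<le> C"
      using causal_bound[OF causal_diff[OF r_causal causal_heaviside]] by metis
    show "integrable (Q T) (\<lambda>v. g v * (r (t - v) - heaviside (t - v)))"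
      by (intro integrable_mult_of_squares g2 Q_bounded_square[of _ _ C]) (use C in auto)
    show "integrable (Q T) (\<lambda>v. g v * heaviside (t - v))"
      by (intro integrable_mult_of_squares g2 Q_bounded_square[of _ _ 1]) (auto simp: heaviside_def indicator_def)
  qed
  also have "\<dots> = (\<integral>v. g v * r (t - v) \<partial>Q T)" by (simp add: algebra_simps)
  finally show "expectation (\<lambda>\<omega>. Z \<omega> * D t \<omega>) = (\<integral>v. g v * r (t - v) \<partial>Q T)" .
qed

lemma r_bounded_on: obtains C where "C > 0" "\<And>s v. s \<le> T \<Longrightarrow> 0 \<le> v \<Longrightarrow> \<bar>r (s - v)\<bar> \<le> C"
proof -
  obtain C where "C > 0" "\<And>v. v \<le> T \<Longrightarrow> \<bar>r v\<bar> \<le> C" using causal_bound[OF r_causal] by metis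
  then show ?thesis using that[of C] by simp
qed

text \<open>Tested against \<open>N s\<close>, the formula for \<open>D t\<close> shows that
  \<open>D t\<close> is itself part of a matched pair; it can then be tested against itself, which
  yields its second moment.\<close>

lemma matched_D:
  assumes "t \<le> T"
  shows "matched T (D t) (\<lambda>v. r (t - v))"
  unfolding matched_def
proof (intro conjI allI impI)
  show "integrable M (\<lambda>\<omega>. (D t \<omega>)\<^sup>2)" by (rule D_square)
  obtain C where C: "C > 0" "\<And>s v. s \<le> T \<Longrightarrow> 0 \<le> v \<Longrightarrow> \<bar>r (s - v)\<bar> \<le> C" using r_bounded_on by metis
  show "integrable (Q T) (\<lambda>v. (r (t - v))\<^sup>2)"
    by (rule Q_bounded_square[of _ _ C]) (use C assms in auto)
  fix s assume "s \<le> T"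
  show "expectation (\<lambda>\<omega>. D t \<omega> * N s \<omega>) = (\<integral>v. r (t - v) * heaviside (s - v) \<partial>Q T)"
  proof (cases "s < 0")
    case True
    then show ?thesis by (simp add: N_neg heaviside_neg_Q)
  next
    case False
    then have "matched T (N s) (\<lambda>v. heaviside (s - v))" using \<open>s \<le> T\<close> by (intro matched_N) auto
    from matched_expectation_D[OF this assms] show ?thesis by (simp add: mult.commute)
  qed
qed measurable

lemma D_second_moment: "t \<le> T \<Longrightarrow> expectation (\<lambda>\<omega>. (D t \<omega>)\<^sup>2) = (\<integral>v. (r (t - v))\<^sup>2 \<partial>Q T)"
  using matched_expectation_D[OF matched_D, of t T t] by (simp add: power2_eq_square)

lemma D_mean: "expectation (D t) = 0"
  using matched_expectation_D[OF matched_one, of t t] by simp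

text \<open>The same averaging once more, now over a delay measure; the uniform bound that
  \<open>L2_mixture\<close> asks for is the second moment of D just found.\<close>

lemma integral_D_matched:
  assumes "delay_measure m \<alpha>" and "matched T Z g" "t \<le> T"
  shows "(\<lambda>\<omega>. \<integral>u. D (t + u) \<omega> \<partial>m) \<in> borel_measurable M"
    and "integrable M (\<lambda>\<omega>. (\<integral>u. D (t + u) \<omega> \<partial>m)\<^sup>2)"
    and "expectation (\<lambda>\<omega>. Z \<omega> * (\<integral>u. D (t + u) \<omega> \<partial>m)) = (\<integral>v. g v * (\<integral>u. r (t - v + u) \<partial>m) \<partial>Q T)"
    and "integrable (Q T) (\<lambda>v. (\<integral>u. r (t - v + u) \<partial>m)\<^sup>2)"
proof -
  interpret m: delay_measure m \<alpha> by fact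
  note [measurable_cong] = m.sets_m
  interpret Q: finite_measure "Q T" by (rule finite_Q)
  have [measurable]: "Z \<in> borel_measurable M" "g \<in> borel_measurable borel"
    and Z2: "integrable M (\<lambda>\<omega>. (Z \<omega>)\<^sup>2)" and g2: "integrable (Q T) (\<lambda>v. (g v)\<^sup>2)"
    using assms(2) by (auto simp: matched_def)
  obtain C where C: "C > 0" "\<And>s v. s \<le> T \<Longrightarrow> 0 \<le> v \<Longrightarrow> \<bar>r (s - v)\<bar> \<le> C" using r_bounded_on by metis
  let ?B = "measure (Q T) (space (Q T)) * C\<^sup>2"
  have rb: "integrable (Q T) (\<lambda>v. (r (s - v))\<^sup>2)" "(\<integral>v. (r (s - v))\<^sup>2 \<partial>Q T) \<le> ?B" if "s \<le> T" for s
    using Q_bounded_square[of "\<lambda>v. r (s - v)" T C] C(2)[OF that] by auto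
  have hm: "(\<lambda>x. D (t + fst x) (snd x)) \<in> borel_measurable (borel \<Otimes>\<^sub>M M)"
    by (rule measurable_compose[OF _ D_measurable, where f="\<lambda>x. (t + fst x, snd x)", simplified]) measurable
  have hb: "AE u in m. integrable M (\<lambda>\<omega>. (D (t + u) \<omega>)\<^sup>2) \<and> expectation (\<lambda>\<omega>. (D (t + u) \<omega>)\<^sup>2) \<le> ?B"
    using m.support
  proof eventually_elim
    case (elim u)
    then have "t + u \<le> T" using assms(3) by simp
    then show ?case using D_square D_second_moment rb by simp
  qed
  note mix = L2_mixture[OF finite_measure_axioms m.finite_measure_axioms m.sets_m hm hb]
  show "(\<lambda>\<omega>. \<integral>u. D (t + u) \<omega> \<partial>m) \<in> borel_measurable M"
    "integrable M (\<lambda>\<omega>. (\<integral>u. D (t + u) \<omega> \<partial>m)\<^sup>2)"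
    using mix(1,2)[of "\<lambda>_. 1"] by auto
  have hm': "(\<lambda>x. r (t - snd x + fst x)) \<in> borel_measurable (borel \<Otimes>\<^sub>M Q T)" by measurable
  have hb': "AE u in m. integrable (Q T) (\<lambda>v. (r (t - v + u))\<^sup>2) \<and> (\<integral>v. (r (t - v + u))\<^sup>2 \<partial>Q T) \<le> ?B"
    using m.support
  proof eventually_elim
    case (elim u)
    then have "t + u \<le> T" using assms(3) by simp
    from rb[OF this] show ?case by (simp add: algebra_simps)
  qed
  note mix' = L2_mixture[OF finite_Q m.finite_measure_axioms m.sets_m hm' hb']
  show "integrable (Q T) (\<lambda>v. (\<integral>u. r (t - v + u) \<partial>m)\<^sup>2)" using mix'(2)[OF _ g2] by auto
  have "expectation (\<lambda>\<omega>. Z \<omega> * (\<integral>u. D (t + u) \<omega> \<partial>m)) = (\<integral>u. (\<integral>\<omega>. Z \<omega> * D (t + u) \<omega> \<partial>M) \<partial>m)"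
    by (rule mix(3)) (use Z2 in auto)
  also have "\<dots> = (\<integral>u. (\<integral>v. g v * r (t - v + u) \<partial>Q T) \<partial>m)"
  proof (rule integral_cong_AE)
    show "AE u in m. (\<integral>\<omega>. Z \<omega> * D (t + u) \<omega> \<partial>M) = (\<integral>v. g v * r (t - v + u) \<partial>Q T)"
      using m.support
    proof eventually_elim
      case (elim u)
      then have "t + u \<le> T" using assms(3) by simp
      from matched_expectation_D[OF assms(2) this] show ?case by (simp add: algebra_simps)
    qed
    show "(\<lambda>u. \<integral>\<omega>. Z \<omega> * D (t + u) \<omega> \<partial>M) \<in> borel_measurable m"
      using hm by measurable
    show "(\<lambda>u. \<integral>v. g v * r (t - v + u) \<partial>Q T) \<in> borel_measurable m" by measurable
  qed
  also have "\<dots> = (\<integral>v. g v * (\<integral>u. r (t - v + u) \<partial>m) \<partial>Q T)"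
    by (rule mix'(3)[symmetric]) (use g2 in auto)
  finally show "expectation (\<lambda>\<omega>. Z \<omega> * (\<integral>u. D (t + u) \<omega> \<partial>m)) = (\<integral>v. g v * (\<integral>u. r (t - v + u) \<partial>m) \<partial>Q T)" .
qed

definition GD :: "real \<Rightarrow> 'a \<Rightarrow> real" where
  "GD t \<omega> = G.Shift (\<lambda>s. D s \<omega>) t"

lemma GD_eq: "GD t \<omega> = (\<integral>u. D (t + u) \<omega> \<partial>gp) - (\<integral>u. D (t + u) \<omega> \<partial>gn)"
  by (simp add: GD_def G.Shift_def G.p.shift_def G.n.shift_def)

lemma GD_measurable: "GD t \<in> borel_measurable M"
  unfolding GD_eq[abs_def]
  using integral_D_matched(1)[OF G.p.delay_measure_axioms matched_one order_refl]
    integral_D_matched(1)[OF G.n.delay_measure_axioms matched_one order_refl] by measurable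

lemma GD_square: "integrable M (\<lambda>\<omega>. (GD t \<omega>)\<^sup>2)"
  unfolding GD_eq
  by (intro square_diff_integrable
      integral_D_matched(1,2)[OF G.p.delay_measure_axioms matched_one order_refl]
      integral_D_matched(1,2)[OF G.n.delay_measure_axioms matched_one order_refl])

lemma matched_expectation_GD:
  assumes "matched T Z g" "t \<le> T"
  shows "expectation (\<lambda>\<omega>. Z \<omega> * GD t \<omega>) = (\<integral>v. g v * G.Shift r (t - v) \<partial>Q T)"
proof -
  note P = integral_D_matched[OF G.p.delay_measure_axioms assms]
    and N = integral_D_matched[OF G.n.delay_measure_axioms assms]
  have Z: "Z \<in> borel_measurable M" "integrable M (\<lambda>\<omega>. (Z \<omega>)\<^sup>2)"
    and g: "g \<in> borel_measurable (Q T)" "integrable (Q T) (\<lambda>v. (g v)\<^sup>2)"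
    using assms(1) by (auto simp: matched_def cong: measurable_cong_sets)
  note [measurable_cong] = G.p.sets_m G.n.sets_m
  interpret p: finite_measure gp by (rule G.p.finite_measure_axioms)
  interpret n: finite_measure gn by (rule G.n.finite_measure_axioms)
  have m: "(\<lambda>v. \<integral>u. r (t - v + u) \<partial>gp) \<in> borel_measurable (Q T)"
    "(\<lambda>v. \<integral>u. r (t - v + u) \<partial>gn) \<in> borel_measurable (Q T)" by measurable
  have "expectation (\<lambda>\<omega>. Z \<omega> * GD t \<omega>)
      = expectation (\<lambda>\<omega>. Z \<omega> * (\<integral>u. D (t + u) \<omega> \<partial>gp)) - expectation (\<lambda>\<omega>. Z \<omega> * (\<integral>u. D (t + u) \<omega> \<partial>gn))"
    unfolding GD_eq right_diff_distrib
    by (intro Bochner_Integration.integral_diff integrable_mult_of_squares Z P(1,2) N(1,2))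
  also have "\<dots> = (\<integral>v. g v * (\<integral>u. r (t - v + u) \<partial>gp) - g v * (\<integral>u. r (t - v + u) \<partial>gn) \<partial>Q T)"
    unfolding P(3) N(3)
    by (intro Bochner_Integration.integral_diff[symmetric] integrable_mult_of_squares g m P(4) N(4))
  finally show ?thesis
    by (simp add: G.Shift_def G.p.shift_def G.n.shift_def right_diff_distrib)
qed

lemma G_Shift_r_measurable[measurable]: "G.Shift r \<in> borel_measurable borel"
  by (intro G.Shift_measurable r_measurable)

lemma matched_GD:
  assumes "t \<le> T"
  shows "matched T (GD t) (\<lambda>v. G.Shift r (t - v))"
  unfolding matched_def
proof (intro conjI allI impI)
  show "GD t \<in> borel_measurable M" by (rule GD_measurable)
  show "integrable M (\<lambda>\<omega>. (GD t \<omega>)\<^sup>2)" by (rule GD_square)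
  obtain C where C: "C > 0" "\<And>v. v \<le> T \<Longrightarrow> \<bar>G.Shift r v\<bar> \<le> C"
    using causal_bound[OF G.causal_Shift[OF r_causal]] by metis
  show "integrable (Q T) (\<lambda>v. (G.Shift r (t - v))\<^sup>2)"
    by (rule Q_bounded_square[of _ _ C]) (use C assms in auto)
  fix s assume "s \<le> T"
  show "expectation (\<lambda>\<omega>. GD t \<omega> * N s \<omega>) = (\<integral>v. G.Shift r (t - v) * heaviside (s - v) \<partial>Q T)"
  proof (cases "s < 0")
    case True
    then show ?thesis by (simp add: N_neg heaviside_neg_Q)
  next
    case False
    then have "matched T (N s) (\<lambda>v. heaviside (s - v))" using \<open>s \<le> T\<close> by (intro matched_N) auto
    from matched_expectation_GD[OF this assms] show ?thesis by (simp add: mult.commute)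
  qed
qed measurable

lemma GD_mean: "expectation (GD t) = 0"
  using matched_expectation_GD[OF matched_one, of t t] by simp

lemma conv_eq_integral_Q:
  assumes "causal g"
  shows "(\<integral>v. g (t - v) \<partial>Q t) = conv g y t"
proof -
  have [measurable]: "g \<in> borel_measurable borel" using assms by (rule causal_measurable)
  have "(\<integral>v. g (t - v) \<partial>Q t) = (LBINT v. indicator {0..t} v * y v * g (t - v))" by (rule integral_Q) measurable
  also have "\<dots> = conv g y t"
    unfolding conv_def
  proof (intro Bochner_Integration.integral_cong refl)
    fix v
    show "indicator {0..t} v * y v * g (t - v) = g (t - v) * y v"
      using y_neg[of v] causal_neg[OF assms, of "t - v"] by (cases "v \<in> {0..t}") auto
  qed
  finally show ?thesis .
qed

text \<open>\<open>c\<close> is the deterministic part; the cross term vanishes because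
  \<open>D t\<close> has mean 0.\<close>

theorem second_moment_D: "expectation (\<lambda>\<omega>. (c + D t \<omega>)\<^sup>2) = c\<^sup>2 + conv (\<lambda>s. (r s)\<^sup>2) y t"
proof -
  have i: "integrable M (D t)" using integrable_mult_of_squares[of "D t" M "\<lambda>_. 1"] D_square by simp
  have "expectation (\<lambda>\<omega>. (c + D t \<omega>)\<^sup>2) = expectation (\<lambda>\<omega>. c\<^sup>2 + 2 * c * D t \<omega> + (D t \<omega>)\<^sup>2)"
    by (simp add: power2_sum algebra_simps)
  also have "\<dots> = c\<^sup>2 + expectation (\<lambda>\<omega>. (D t \<omega>)\<^sup>2)"
    using i D_square by (simp add: D_mean prob_space)
  finally show ?thesis
    using D_second_moment[of t t] conv_eq_integral_Q[OF causal_power2[OF r_causal]] by simp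
qed

theorem second_moment_GD:
  "integrable M (\<lambda>\<omega>. (c + GD t \<omega>)\<^sup>2)"
  "expectation (\<lambda>\<omega>. (c + GD t \<omega>)\<^sup>2) = c\<^sup>2 + conv (\<lambda>s. (G.Shift r s)\<^sup>2) y t"
proof -
  have i: "integrable M (GD t)"
    using integrable_mult_of_squares[of "GD t" M "\<lambda>_. 1"] GD_square GD_measurable by simp
  have eq: "(\<lambda>\<omega>. (c + GD t \<omega>)\<^sup>2) = (\<lambda>\<omega>. c\<^sup>2 + 2 * c * GD t \<omega> + (GD t \<omega>)\<^sup>2)"
    by (simp add: power2_sum algebra_simps)
  show "integrable M (\<lambda>\<omega>. (c + GD t \<omega>)\<^sup>2)" unfolding eq using i GD_square by simp
  have "expectation (\<lambda>\<omega>. (c + GD t \<omega>)\<^sup>2) = c\<^sup>2 + expectation (\<lambda>\<omega>. (GD t \<omega>)\<^sup>2)"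
    unfolding eq using i GD_square by (simp add: GD_mean prob_space)
  also have "expectation (\<lambda>\<omega>. (GD t \<omega>)\<^sup>2) = (\<integral>v. (G.Shift r (t - v))\<^sup>2 \<partial>Q t)"
    using matched_expectation_GD[OF matched_GD, of t t t] by (simp add: power2_eq_square)
  finally show "expectation (\<lambda>\<omega>. (c + GD t \<omega>)\<^sup>2) = c\<^sup>2 + conv (\<lambda>s. (G.Shift r s)\<^sup>2) y t"
    using conv_eq_integral_Q[OF causal_power2[OF G.causal_Shift[OF r_causal]]] by simp
qed

end

section \<open>Signed measures on the delay interval\<close>

text \<open>Image of a measure on [-\<alpha>, 0] under the inclusion into the line, the form
  required by \<open>delay_measure\<close>.\<close>

definition borel_part :: "real measure \<Rightarrow> real measure" where
  "borel_part m = distr m borel (\<lambda>u. u)"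

lemma restrict_borel_measurable:
  assumes "sets m = sets (restrict_space borel S)" "f \<in> borel_measurable borel"
  shows "f \<in> borel_measurable m"
  using measurable_restrict_space1[OF assms(2), of S] assms(1) by (simp cong: measurable_cong_sets)

lemma delay_measure_borel_part:
  assumes "finite_measure m" "sets m = sets (restrict_space borel {- \<alpha>..0})" "0 \<le> \<alpha>"
  shows "delay_measure (borel_part m) \<alpha>"
proof -
  have id: "(\<lambda>u. u) \<in> m \<rightarrow>\<^sub>M borel" by (rule restrict_borel_measurable[OF assms(2)]) simp
  have sp: "space m = {- \<alpha>..0}" using sets_eq_imp_space_eq[OF assms(2)] by (simp add: space_restrict_space)
  interpret D: finite_measure "borel_part m"
    unfolding borel_part_def by (rule finite_measure.finite_measure_distr[OF assms(1) id])
  show ?thesis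
  proof
    show "AE u in borel_part m. - \<alpha> \<le> u \<and> u \<le> 0"
      unfolding borel_part_def by (subst AE_distr_iff[OF id]) (auto simp: sp)
  qed (use assms in \<open>auto simp: borel_part_def\<close>)
qed

lemma delay_functional_borel_part:
  assumes "signed_borel_measure_on {- \<alpha>..0} \<mu>" "0 \<le> \<alpha>"
  shows "delay_functional (borel_part (fst \<mu>)) (borel_part (snd \<mu>)) \<alpha>"
  using assms unfolding delay_functional_def signed_borel_measure_on_def
  by (auto intro: delay_measure_borel_part)

text \<open>The measures see only [s - \<alpha>, s], so the segment of any f may be read from a
  Borel function g that agrees with it there. This brings functions specified only from -\<alpha> on
  into the convolution setting.\<close>

lemma signed_integral_segment:
  assumes \<mu>: "signed_borel_measure_on {- \<alpha>..0} \<mu>" "0 \<le> \<alpha>"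
    and g: "g \<in> borel_measurable borel" "\<And>v. s - \<alpha> \<le> v \<Longrightarrow> v \<le> s \<Longrightarrow> f v = g v"
  shows "signed_integral \<mu> (segment f s)
    = delay_functional.Shift (borel_part (fst \<mu>)) (borel_part (snd \<mu>)) g s"
proof -
  interpret delay_functional "borel_part (fst \<mu>)" "borel_part (snd \<mu>)" \<alpha>
    by (rule delay_functional_borel_part[OF \<mu>])
  have part: "(\<integral>u. segment f s u \<partial>m) = (\<integral>u. g (s + u) \<partial>borel_part m)"
    if "sets m = sets (restrict_space borel {- \<alpha>..0})" for m
  proof -
    have id: "(\<lambda>u. u) \<in> m \<rightarrow>\<^sub>M borel" by (rule restrict_borel_measurable[OF that]) simp
    have sp: "space m = {- \<alpha>..0}" using sets_eq_imp_space_eq[OF that] by (simp add: space_restrict_space)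
    have "(\<integral>u. segment f s u \<partial>m) = (\<integral>u. g (s + u) \<partial>m)"
      by (rule Bochner_Integration.integral_cong) (auto simp: sp segment_def intro!: g(2))
    also have "\<dots> = (\<integral>u. g (s + u) \<partial>borel_part m)"
      unfolding borel_part_def by (subst integral_distr[OF id]) (use g(1) in auto)
    finally show ?thesis .
  qed
  show ?thesis
    using \<mu> unfolding signed_integral_def Shift_def p.shift_def n.shift_def signed_borel_measure_on_def
    by (simp add: part)
qed

lemma (in delay_functional) Shift_add:
  assumes "f \<in> borel_measurable borel" "\<And>v. s - \<alpha> \<le> v \<Longrightarrow> v \<le> s \<Longrightarrow> \<bar>f v\<bar> \<le> B" "causal g"
  shows "Shift (\<lambda>v. f v + g v) s = Shift f s + Shift g s"
  using p.shift_integrable_bound(1)[where s=s, OF assms(1,2)] n.shift_integrable_bound(1)[where s=s, OF assms(1,2)]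
    p.shift_integrable[OF assms(3)] n.shift_integrable[OF assms(3)]
  by (simp add: Shift_def p.shift_def n.shift_def)

lemma absolutely_continuous_imp_continuous_on:
  assumes "absolutely_continuous_on_interval c d f"
  shows "continuous_on {c..d} f"
  unfolding continuous_on_iff
proof (intro ballI allI impI)
  fix u e assume u: "u \<in> {c..d}" and "(0::real) < e"
  then obtain \<delta> where "\<delta> > 0" and \<delta>: "\<And>(n::nat) a b.
        (\<forall>i<n. c \<le> a i \<and> a i \<le> b i \<and> b i \<le> d) \<and>
        (\<forall>i<n. \<forall>j<n. i \<noteq> j \<longrightarrow> {a i<..<b i} \<inter> {a j<..<b j} = {}) \<and>
        (\<Sum>i<n. b i - a i) < \<delta>
        \<Longrightarrow> (\<Sum>i<n. \<bar>f (b i) - f (a i)\<bar>) < e"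
    using assms unfolding absolutely_continuous_on_interval_def by meson
  show "\<exists>\<delta>>0. \<forall>v\<in>{c..d}. dist v u < \<delta> \<longrightarrow> dist (f v) (f u) < e"
  proof (intro exI[of _ \<delta>] conjI ballI impI)
    fix v assume v: "v \<in> {c..d}" "dist v u < \<delta>"
    \<comment> \<open>The family of intervals is the single one between u and v.\<close>
    have "(\<Sum>i<1::nat. \<bar>f (max u v) - f (min u v)\<bar>) < e"
      by (rule \<delta>) (use u v in \<open>auto simp: dist_real_def max_def min_def\<close>)
    then show "dist (f v) (f u) < e" by (auto simp: dist_real_def max_def min_def split: if_splits)
  qed (use \<open>\<delta> > 0\<close> in auto)
qed

section \<open>Joint measurability of continuous processes\<close>

text \<open>Time is rounded up to multiples of 1/(n + 1): countably many values for each n, and no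
  value leaves [0, \<infinity>), where the paths are continuous.\<close>

lemma measurable_continuous_process:
  fixes f :: "real \<Rightarrow> 'a \<Rightarrow> real"
  assumes cont: "\<And>\<omega>. \<omega> \<in> space M \<Longrightarrow> continuous_on {0..} (\<lambda>t. f t \<omega>)"
    and meas: "\<And>t. 0 \<le> t \<Longrightarrow> f t \<in> borel_measurable M"
  shows "(\<lambda>x. heaviside (fst x) * f (fst x) (snd x)) \<in> borel_measurable (borel \<Otimes>\<^sub>M M)"
proof (rule borel_measurable_LIMSEQ_real)
  let ?g = "\<lambda>n t. real (nat \<lceil>t * real (Suc n)\<rceil>) / real (Suc n)"
  have [measurable]: "heaviside \<in> borel_measurable borel" by (rule causal_measurable[OF causal_heaviside])
  show "(\<lambda>x. heaviside (fst x) * f (?g n (fst x)) (snd x)) \<in> borel_measurable (borel \<Otimes>\<^sub>M M)" for n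
  proof (rule borel_measurable_times)
    have [measurable]: "f (real i / real (Suc n)) \<in> borel_measurable M" for i by (rule meas) simp
    show "(\<lambda>x. f (?g n (fst x)) (snd x)) \<in> borel_measurable (borel \<Otimes>\<^sub>M M)"
      by (rule measurable_compose_countable[where f="\<lambda>i x. f (real i / real (Suc n)) (snd x)"
            and g="\<lambda>x. nat \<lceil>fst x * real (Suc n)\<rceil>"]) measurable
  qed measurable
  fix x :: "real \<times> 'a" assume x: "x \<in> space (borel \<Otimes>\<^sub>M M)"
  show "(\<lambda>n. heaviside (fst x) * f (?g n (fst x)) (snd x)) \<longlonglongrightarrow> heaviside (fst x) * f (fst x) (snd x)"
  proof (cases "fst x < 0")
    case False
    let ?t = "fst x"
    have "(\<lambda>n. ?g n ?t) \<longlonglongrightarrow> ?t"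
    proof (rule tendsto_sandwich[where f="\<lambda>_. ?t" and h="\<lambda>n. ?t + 1 / real (Suc n)"])
      have r: "real (nat \<lceil>?t * real (Suc n)\<rceil>) = of_int \<lceil>?t * real (Suc n)\<rceil>" for n
      proof -
        have "0 \<le> ?t * real (Suc n)" using False by simp
        then have "0 \<le> \<lceil>?t * real (Suc n)\<rceil>" by linarith
        then show ?thesis by simp
      qed
      show "\<forall>\<^sub>F n in sequentially. ?t \<le> ?g n ?t"
        by (intro always_eventually allI) (simp only: r, simp add: pos_le_divide_eq del: of_nat_Suc)
      show "\<forall>\<^sub>F n in sequentially. ?g n ?t \<le> ?t + 1 / real (Suc n)"
      proof (intro always_eventually allI)
        fix n
        have "of_int \<lceil>?t * real (Suc n)\<rceil> \<le> ?t * real (Suc n) + 1" by linarith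
        then have "of_int \<lceil>?t * real (Suc n)\<rceil> / real (Suc n) \<le> (?t * real (Suc n) + 1) / real (Suc n)"
          by (intro divide_right_mono) auto
        then show "?g n ?t \<le> ?t + 1 / real (Suc n)" unfolding r by (simp add: add_divide_distrib del: of_nat_Suc)
      qed
      show "(\<lambda>n. ?t + 1 / real (Suc n)) \<longlonglongrightarrow> ?t"
        using tendsto_add[OF tendsto_const[of ?t] LIMSEQ_Suc[OF lim_1_over_n]] by simp
    qed auto
    moreover have "\<forall>n. ?g n ?t \<in> {0..}" by simp
    moreover have "snd x \<in> space M" using x by (simp add: space_pair_measure mem_Times_iff)
    ultimately have "(\<lambda>n. f (?g n ?t) (snd x)) \<longlonglongrightarrow> f ?t (snd x)"
      using cont[of "snd x"] False unfolding continuous_on_sequentially comp_def by auto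
    then show ?thesis by (intro tendsto_intros)
  qed (simp add: heaviside_def)
qed

section \<open>The stochastic delay equation\<close>

locale stochastic_delay_equation = wiener_space M Fil W
  for M :: "'a measure" and Fil and W :: "real \<Rightarrow> 'a \<Rightarrow> real" +
  fixes X :: "real \<Rightarrow> 'a \<Rightarrow> real" and \<alpha> :: real and \<mu> \<nu> :: signed_measure and \<phi> x r :: "real \<Rightarrow> real"
  assumes \<alpha>_nonneg: "\<alpha> \<ge> 0"
    and \<mu>: "signed_borel_measure_on {-\<alpha>..0} \<mu>" and \<nu>: "signed_borel_measure_on {-\<alpha>..0} \<nu>"
    and X: "sdde_solution M Fil W \<alpha> \<mu> \<nu> \<phi> X"
    and x: "dde_solution \<alpha> \<mu> \<phi> x"
    and r: "fundamental_solution \<alpha> \<mu> r"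
begin

text \<open>r and x are unspecified below -\<alpha>. For r the whole negative axis is set to zero,
  while \<open>x0\<close> below keeps the initial segment.\<close>

definition r0 :: "real \<Rightarrow> real" where "r0 t = heaviside t * r t"

definition x0 :: "real \<Rightarrow> real" where "x0 v = indicator {- \<alpha>..} v * x v"

sublocale F: delay_functional "borel_part (fst \<mu>)" "borel_part (snd \<mu>)" \<alpha>
  by (rule delay_functional_borel_part[OF \<mu> \<alpha>_nonneg])

sublocale G: delay_functional "borel_part (fst \<nu>)" "borel_part (snd \<nu>)" \<alpha>
  by (rule delay_functional_borel_part[OF \<nu> \<alpha>_nonneg])

lemma r_continuous: "continuous_on {0..} r"
proof -
  have "continuous_on {0..T} r" if "T \<ge> 0" for T
    using r that unfolding fundamental_solution_def by (intro absolutely_continuous_imp_continuous_on) auto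
  then have "continuous (at t within {0..}) r" if "t \<in> {0..}" for t
  proof -
    have "continuous (at t within {0..t + 1}) r"
      using \<open>\<And>T. T \<ge> 0 \<Longrightarrow> continuous_on {0..T} r\<close>[of "t + 1"] that by (simp add: continuous_on_eq_continuous_within)
    moreover have "at t within {0..t + 1} = at t within {0..}"
    proof (rule at_within_nhd[of t "{..<t + 1}"])
      show "{0..t + 1} \<inter> {..<t + 1} - {t} = {0..} \<inter> {..<t + 1} - {t}" by auto
    qed auto
    ultimately show ?thesis by simp
  qed
  then show ?thesis by (simp add: continuous_on_eq_continuous_within)
qed

lemma r0_causal: "causal r0"
  unfolding r0_def[abs_def] by (rule causal_continuous_on[OF r_continuous])

lemma r0_eq_r: "- \<alpha> \<le> v \<Longrightarrow> r v = r0 v"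
  using r unfolding fundamental_solution_def r0_def heaviside_def by (cases "v < 0") auto

text \<open>The lower limit max (-\<alpha>) (-s) in the equation of r discards negative times, which
  amounts to extending r by zero.\<close>

sublocale E: delay_equation "borel_part (fst \<mu>)" "borel_part (snd \<mu>)" \<alpha> r0
proof
  show "causal r0" by (rule r0_causal)
  show "continuous_on {0..} r0"
    by (rule continuous_on_eq[OF r_continuous]) (auto simp: r0_def heaviside_def)
  fix t
  have fc: "causal (F.Shift r0)" by (rule F.causal_Shift[OF r0_causal])
  show "r0 t = heaviside t + conv heaviside (F.Shift r0) t"
  proof (cases "t < 0")
    case True
    then show ?thesis
      using causal_neg[OF r0_causal] causal_neg[OF causal_conv[OF causal_heaviside fc]] by (simp add: heaviside_def)
  next
    case False
    have "signed_integral \<mu> (\<lambda>u. indicator {max (-\<alpha>) (-s)..0} u * r (s + u)) = F.Shift r0 s" if "s \<in> {0..t}" for s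
    proof -
      have "signed_integral \<mu> (segment (\<lambda>v. indicator {max (-\<alpha>) (-s)..0} (v - s) * r v) s) = F.Shift r0 s"
        by (rule signed_integral_segment[OF \<mu> \<alpha>_nonneg causal_measurable[OF r0_causal]])
           (auto simp: r0_def heaviside_def indicator_def)
      then show ?thesis by (simp add: segment_def[abs_def])
    qed
    then have "(LBINT s:{0..t}. signed_integral \<mu> (\<lambda>u. indicator {max (-\<alpha>) (-s)..0} u * r (s + u)))
        = (LBINT s:{0..t}. F.Shift r0 s)"
      by (intro set_lebesgue_integral_cong) auto
    moreover have "r t = 1 + (LBINT s:{0..t}. signed_integral \<mu> (\<lambda>u. indicator {max (-\<alpha>) (-s)..0} u * r (s + u)))"
      using r False unfolding fundamental_solution_def by auto
    moreover have "heaviside t = 1" using False by (simp add: heaviside_def)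
    ultimately show ?thesis by (simp add: conv_heaviside[OF fc] r0_def)
  qed
qed

lemma x_continuous: "continuous_on {- \<alpha>..} x"
  using x by (simp add: dde_solution_def)

lemma x0_measurable[measurable]: "x0 \<in> borel_measurable borel"
  unfolding x0_def[abs_def] using borel_measurable_continuous_on_indicator[OF _ x_continuous] by simp

lemma x0_bound: obtains B where "B > 0" "\<And>v. v \<le> T \<Longrightarrow> \<bar>x0 v\<bar> \<le> B"
proof -
  have "compact (x ` {- \<alpha>..T})"
    by (intro compact_continuous_image continuous_on_subset[OF x_continuous]) auto
  then have "bounded (x ` {- \<alpha>..T})" by (rule compact_imp_bounded)
  then obtain B where B: "\<forall>z\<in>x ` {- \<alpha>..T}. norm z \<le> B" unfolding bounded_iff by blast
  have "\<bar>x0 v\<bar> \<le> \<bar>B\<bar> + 1" if "v \<le> T" for v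
  proof (cases "v < - \<alpha>")
    case False
    then have "\<bar>x v\<bar> \<le> B" using B that by auto
    then show ?thesis using False by (simp add: x0_def)
  qed (simp add: x0_def)
  then show ?thesis by (intro that[of "\<bar>B\<bar> + 1"]) auto
qed

lemma signed_integral_x:
  assumes "signed_borel_measure_on {- \<alpha>..0} \<rho>" "0 \<le> s"
  shows "signed_integral \<rho> (segment x s)
    = delay_functional.Shift (borel_part (fst \<rho>)) (borel_part (snd \<rho>)) x0 s"
  by (rule signed_integral_segment[OF assms(1) \<alpha>_nonneg x0_measurable]) (use assms(2) in \<open>auto simp: x0_def\<close>)

lemma x0_eq:
  assumes "0 \<le> t"
  shows "x0 t = x0 0 + (LBINT s:{0..t}. F.Shift x0 s)"
proof -
  have "(LBINT s:{0..t}. signed_integral \<mu> (segment x s)) = x t - x 0"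
    unfolding set_lebesgue_integral_def
  proof (rule integral_FTC_Icc[OF assms])
    fix s assume s: "0 \<le> s" "s \<le> t"
    then have "(x has_real_derivative signed_integral \<mu> (segment x s)) (at s within {0..})"
      using x by (simp add: dde_solution_def)
    then have "(x has_vector_derivative signed_integral \<mu> (segment x s)) (at s within {0..})"
      by (simp add: has_real_derivative_iff_has_vector_derivative)
    then show "(x has_vector_derivative signed_integral \<mu> (segment x s)) (at s within {0..t})"
      by (rule has_vector_derivative_within_subset) auto
  next
    show "continuous_on {0..t} (\<lambda>s. signed_integral \<mu> (segment x s))"
      using x unfolding dde_solution_def by (auto intro: continuous_on_subset)
  qed
  moreover have "(LBINT s:{0..t}. signed_integral \<mu> (segment x s)) = (LBINT s:{0..t}. F.Shift x0 s)"
    by (intro set_lebesgue_integral_cong) (auto simp: signed_integral_x[OF \<mu>])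
  ultimately show ?thesis using assms \<alpha>_nonneg by (simp add: x0_def)
qed

section \<open>The deviation from the deterministic solution and its martingale part\<close>

lemma X_continuous: "\<omega> \<in> space M \<Longrightarrow> continuous_on {0..} (\<lambda>t. X t \<omega>)"
  using X \<alpha>_nonneg unfolding sdde_solution_def by (auto intro: continuous_on_subset[of "{- \<alpha>..}"])

lemma X_measurable: "0 \<le> t \<Longrightarrow> X t \<in> borel_measurable M"
  using X Fil_measurable unfolding sdde_solution_def by auto

text \<open>Zero off the sample space and for t < 0, so that every path is causal; on [-\<alpha>, 0)
  the difference X - x is known to vanish only almost surely.\<close>

definition D :: "real \<Rightarrow> 'a \<Rightarrow> real" where
  "D t \<omega> = (if \<omega> \<in> space M then heaviside t * (X t \<omega> - x t) else 0)"

text \<open>Defined path by path as the residual of the deterministic equation, not as a stochastic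
  integral. Continuity and joint measurability follow at once, and \<open>N_ito\<close> identifies
  it with the Ito integral at each fixed time.\<close>

definition N :: "real \<Rightarrow> 'a \<Rightarrow> real" where
  "N t \<omega> = D t \<omega> - conv heaviside (F.Shift (\<lambda>s. D s \<omega>)) t"

definition g :: "real \<Rightarrow> real" where "g = G.Shift x0"

text \<open>Jointly measurable version of G(X_s): the deterministic part plus the functional of the
  deviation.\<close>

definition Z :: "real \<Rightarrow> 'a \<Rightarrow> real" where
  "Z s \<omega> = g s + G.Shift (\<lambda>v. D v \<omega>) s"

definition y :: "real \<Rightarrow> real" where
  "y s = heaviside s * expectation (\<lambda>\<omega>. (Z s \<omega>)\<^sup>2)"

lemma diff_continuous: "\<omega> \<in> space M \<Longrightarrow> continuous_on {0..} (\<lambda>t. X t \<omega> - x t)"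
  using \<alpha>_nonneg by (intro continuous_on_diff X_continuous continuous_on_subset[OF x_continuous]) auto

lemma D_causal: "causal (\<lambda>t. D t \<omega>)"
  using causal_continuous_on[OF diff_continuous, of \<omega>]
  by (cases "\<omega> \<in> space M") (auto simp: D_def intro: causal_bounded[of _ 0])

lemma D_continuous: "continuous_on {0..} (\<lambda>t. D t \<omega>)"
proof (cases "\<omega> \<in> space M")
  case True
  show ?thesis
    by (rule continuous_on_eq[OF diff_continuous[OF True]]) (use True in \<open>auto simp: D_def heaviside_def\<close>)
qed (simp add: D_def)

lemma N_causal: "causal (\<lambda>t. N t \<omega>)"
  unfolding N_def by (intro causal_diff D_causal causal_conv causal_heaviside F.causal_Shift)

lemma N_continuous: "continuous_on {0..} (\<lambda>t. N t \<omega>)"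
  unfolding N_def
  by (intro continuous_on_diff D_continuous continuous_on_conv causal_heaviside heaviside_continuous
      F.causal_Shift D_causal)

lemma D_eq: "D t \<omega> = N t \<omega> + conv (F.Shift r0) (\<lambda>s. N s \<omega>) t"
  by (rule E.variation_of_constants[OF D_causal D_continuous N_causal N_continuous]) (simp add: N_def)

lemma D_measurable: "(\<lambda>x. D (fst x) (snd x)) \<in> borel_measurable (borel \<Otimes>\<^sub>M M)"
proof -
  have "(\<lambda>x'. heaviside (fst x') * (X (fst x') (snd x') - x (fst x'))) \<in> borel_measurable (borel \<Otimes>\<^sub>M M)"
    using measurable_continuous_process[of M "\<lambda>t \<omega>. X t \<omega> - x t"] diff_continuous X_measurable by simp
  then show ?thesis
    by (rule measurable_cong[THEN iffD1, rotated]) (auto simp: D_def space_pair_measure)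
qed

lemma D_measurable_comp[measurable (raw)]:
  assumes "f \<in> A \<rightarrow>\<^sub>M borel" "h \<in> A \<rightarrow>\<^sub>M M"
  shows "(\<lambda>z. D (f z) (h z)) \<in> borel_measurable A"
  using measurable_compose[OF measurable_Pair[OF assms] D_measurable] by simp

lemmas measure_sets[measurable_cong] = F.p.sets_m F.n.sets_m G.p.sets_m G.n.sets_m

lemma N_measurable: "(\<lambda>x. N (fst x) (snd x)) \<in> borel_measurable (borel \<Otimes>\<^sub>M M)"
proof -
  have [measurable]: "heaviside \<in> borel_measurable borel" by (rule causal_measurable[OF causal_heaviside])
  show ?thesis
    unfolding N_def conv_def F.Shift_def F.p.shift_def F.n.shift_def by measurable
qed

lemma Z_measurable: "(\<lambda>x. Z (snd x) (fst x)) \<in> borel_measurable (M \<Otimes>\<^sub>M lborel)"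
proof -
  have [measurable]: "g \<in> borel_measurable borel" unfolding g_def by (rule G.Shift_measurable[OF x0_measurable])
  show ?thesis unfolding Z_def G.Shift_def G.p.shift_def G.n.shift_def by measurable
qed

lemma Z_measurable'[measurable]: "(\<lambda>x. Z (fst x) (snd x)) \<in> borel_measurable (borel \<Otimes>\<^sub>M M)"
proof -
  have [measurable]: "g \<in> borel_measurable borel" unfolding g_def by (rule G.Shift_measurable[OF x0_measurable])
  show ?thesis unfolding Z_def G.Shift_def G.p.shift_def G.n.shift_def by measurable
qed

lemma X_past: "AE \<omega> in M. \<forall>u\<in>{-\<alpha>..0}. X u \<omega> = x u"
proof -
  have "\<forall>u\<in>{-\<alpha>..0}. x u = \<phi> u" using x by (simp add: dde_solution_def)
  then show ?thesis using X unfolding sdde_solution_def by (auto elim!: eventually_mono)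
qed

lemma signed_integral_X:
  assumes "\<omega> \<in> space M" "\<forall>u\<in>{-\<alpha>..0}. X u \<omega> = x u" "0 \<le> s" "signed_borel_measure_on {- \<alpha>..0} \<rho>"
  shows "signed_integral \<rho> (segment (\<lambda>v. X v \<omega>) s)
    = delay_functional.Shift (borel_part (fst \<rho>)) (borel_part (snd \<rho>)) x0 s
      + delay_functional.Shift (borel_part (fst \<rho>)) (borel_part (snd \<rho>)) (\<lambda>v. D v \<omega>) s"
proof -
  interpret R: delay_functional "borel_part (fst \<rho>)" "borel_part (snd \<rho>)" \<alpha>
    by (rule delay_functional_borel_part[OF assms(4) \<alpha>_nonneg])
  have m: "(\<lambda>v. D v \<omega>) \<in> borel_measurable borel" by (rule causal_measurable[OF D_causal])
  obtain B where B: "B > 0" "\<And>v. v \<le> s \<Longrightarrow> \<bar>x0 v\<bar> \<le> B" using x0_bound by metis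
  have "signed_integral \<rho> (segment (\<lambda>v. X v \<omega>) s) = R.Shift (\<lambda>v. x0 v + D v \<omega>) s"
  proof (rule signed_integral_segment[OF assms(4) \<alpha>_nonneg])
    fix v assume v: "s - \<alpha> \<le> v" "v \<le> s"
    show "X v \<omega> = x0 v + D v \<omega>"
      using v assms by (cases "v < 0") (auto simp: x0_def D_def heaviside_def)
  qed (use m in measurable)
  also have "\<dots> = R.Shift x0 s + R.Shift (\<lambda>v. D v \<omega>) s"
    by (rule R.Shift_add[OF x0_measurable _ D_causal, of _ B]) (use B in auto)
  finally show ?thesis .
qed

definition H :: "real \<Rightarrow> 'a \<Rightarrow> real" where
  "H s \<omega> = signed_integral \<nu> (segment (\<lambda>v. X v \<omega>) s)"

lemma H_eq_Z: "AE \<omega> in M. \<forall>u\<in>{0..t}. H u \<omega> = Z u \<omega>"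
  using X_past AE_space
  by eventually_elim (auto simp: H_def Z_def g_def signed_integral_X[OF _ _ _ \<nu>])

lemma set_integrable_Shift_x0: "set_integrable lborel {0..t} (F.Shift x0)"
proof -
  obtain B where B: "B > 0" "\<And>v. v \<le> t \<Longrightarrow> \<bar>x0 v\<bar> \<le> B" using x0_bound by metis
  have [measurable]: "F.Shift x0 \<in> borel_measurable borel" by (rule F.Shift_measurable[OF x0_measurable])
  show ?thesis
    unfolding set_integrable_def
  proof (rule integrable_bounded_support[of _ 0 t "F.Mass * B"])
    fix s assume "0 \<le> s" "s \<le> t"
    then show "\<bar>indicator {0..t} s *\<^sub>R F.Shift x0 s\<bar> \<le> F.Mass * B"
      using F.Shift_bound[OF x0_measurable, of s B] B by simp
  qed auto
qed

lemma set_integrable_Shift_D: "set_integrable lborel {0..t} (F.Shift (\<lambda>v. D v \<omega>))"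
proof -
  have c: "causal (F.Shift (\<lambda>v. D v \<omega>))" by (rule F.causal_Shift[OF D_causal])
  then have [measurable]: "F.Shift (\<lambda>v. D v \<omega>) \<in> borel_measurable borel" by (rule causal_measurable)
  obtain B where B: "B > 0" "\<And>v. v \<le> t \<Longrightarrow> \<bar>F.Shift (\<lambda>v. D v \<omega>) v\<bar> \<le> B" using causal_bound[OF c] by metis
  show ?thesis unfolding set_integrable_def
    by (rule integrable_bounded_support[of _ 0 t B]) (use B in auto)
qed

text \<open>Subtracting the integrated equation of x from that of X leaves D - H * F(D) equal to the
  Ito integral, almost surely for each fixed t.\<close>

lemma N_ito:
  assumes "0 \<le> t"
  obtains J where "has_ito_integral M Fil W t H J" "AE \<omega> in M. N t \<omega> = J \<omega>"
proof -
  obtain J where J: "has_ito_integral M Fil W t H J"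
    and ae: "AE \<omega> in M. X t \<omega> = \<phi> 0
           + (LBINT s:{0..t}. signed_integral \<mu> (segment (\<lambda>v. X v \<omega>) s)) + J \<omega>"
    using X assms unfolding sdde_solution_def H_def[abs_def] by blast
  have "x 0 = \<phi> 0" using x \<alpha>_nonneg by (simp add: dde_solution_def)
  have "AE \<omega> in M. N t \<omega> = J \<omega>"
    using ae X_past AE_space
  proof eventually_elim
    case (elim \<omega>)
    have "(LBINT s:{0..t}. signed_integral \<mu> (segment (\<lambda>v. X v \<omega>) s))
      = (LBINT s:{0..t}. F.Shift x0 s + F.Shift (\<lambda>v. D v \<omega>) s)"
      by (intro set_lebesgue_integral_cong) (auto simp: signed_integral_X[OF elim(3) elim(2) _ \<mu>])
    also have "\<dots> = (LBINT s:{0..t}. F.Shift x0 s) + (LBINT s:{0..t}. F.Shift (\<lambda>v. D v \<omega>) s)"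
      by (rule set_integral_add(2)[OF set_integrable_Shift_x0 set_integrable_Shift_D])
    also have "(LBINT s:{0..t}. F.Shift (\<lambda>v. D v \<omega>) s) = conv heaviside (F.Shift (\<lambda>v. D v \<omega>)) t"
      by (rule conv_heaviside[symmetric, OF F.causal_Shift[OF D_causal]])
    also have "(LBINT s:{0..t}. F.Shift x0 s) = x t - x 0"
      using x0_eq[OF assms] assms \<alpha>_nonneg by (simp add: x0_def)
    finally show ?case
      using elim assms \<open>x 0 = \<phi> 0\<close> by (simp add: N_def D_def heaviside_def)
  qed
  then show ?thesis using that J by blast
qed

lemma N_measurable_at: "N t \<in> borel_measurable M"
  using measurable_compose[OF measurable_Pair1'[of t borel M] N_measurable] by simp

interpretation prd: pair_sigma_finite M lborel ..

text \<open>The isometry gives square integrability on the product space, and Fubini turns it into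
  local integrability of y.\<close>

lemma square_Z_integrable:
  assumes "0 \<le> t"
  shows "integrable (M \<Otimes>\<^sub>M lborel) (\<lambda>x. indicator {0..t} (snd x) * (Z (snd x) (fst x))\<^sup>2)"
    and "integrable lborel (\<lambda>v. indicator {0..t} v * y v)"
    and "(\<integral>x. indicator {0..t} (snd x) * (Z (snd x) (fst x))\<^sup>2 \<partial>(M \<Otimes>\<^sub>M lborel)) = (LBINT v. indicator {0..t} v * y v)"
proof -
  obtain J where J: "has_ito_integral M Fil W t H J" using N_ito[OF assms] by metis
  show i: "integrable (M \<Otimes>\<^sub>M lborel) (\<lambda>x. indicator {0..t} (snd x) * (Z (snd x) (fst x))\<^sup>2)"
    by (rule ito_covariance(3)[OF J J order_refl Z_measurable H_eq_Z])
  then have i': "integrable (M \<Otimes>\<^sub>M lborel) (\<lambda>(\<omega>, v). indicator {0..t} v * (Z v \<omega>)\<^sup>2)"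
    by (simp add: split_beta')
  have yv: "expectation (\<lambda>\<omega>. indicator {0..t} v * (Z v \<omega>)\<^sup>2) = indicator {0..t} v * y v" for v
    by (simp add: y_def heaviside_def indicator_def)
  show "integrable lborel (\<lambda>v. indicator {0..t} v * y v)"
    using prd.integrable_snd[OF i'] unfolding yv .
  show "(\<integral>x. indicator {0..t} (snd x) * (Z (snd x) (fst x))\<^sup>2 \<partial>(M \<Otimes>\<^sub>M lborel)) = (LBINT v. indicator {0..t} v * y v)"
    using prd.integral_snd[OF i'] unfolding yv by (simp add: split_beta')
qed

sublocale moments: delay_moments M "borel_part (fst \<mu>)" "borel_part (snd \<mu>)" \<alpha> r0
  "borel_part (fst \<nu>)" "borel_part (snd \<nu>)" N D y
proof
  show "(\<lambda>x. N (fst x) (snd x)) \<in> borel_measurable (borel \<Otimes>\<^sub>M M)" by (rule N_measurable)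
  show "(\<lambda>x. D (fst x) (snd x)) \<in> borel_measurable (borel \<Otimes>\<^sub>M M)" by (rule D_measurable)
  show "N t \<omega> = 0" if "t < 0" for t \<omega> using causal_neg[OF N_causal that] .
  show "D t \<omega> = N t \<omega> + conv (F.Shift r0) (\<lambda>s. N s \<omega>) t" for t \<omega> by (rule D_eq)
  show "expectation (N t) = 0" "integrable M (\<lambda>\<omega>. (N t \<omega>)\<^sup>2)" if t: "0 \<le> t" for t
  proof -
    obtain J where J: "has_ito_integral M Fil W t H J" and ae: "AE \<omega> in M. N t \<omega> = J \<omega>" using N_ito[OF t] by metis
    note c = ito_covariance(1,2)[OF J J order_refl Z_measurable H_eq_Z]
    have [measurable]: "J \<in> borel_measurable M" "N t \<in> borel_measurable M"
      using J N_measurable_at by (auto simp: has_ito_integral_def)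
    have "expectation (N t) = expectation J" by (rule integral_cong_AE) (use ae in auto)
    then show "expectation (N t) = 0" using c by simp
    show "integrable M (\<lambda>\<omega>. (N t \<omega>)\<^sup>2)"
      by (rule integrable_cong_AE_imp[OF c(1)]) (use ae in auto)
  qed
  show "expectation (\<lambda>\<omega>. N s \<omega> * N t \<omega>) = (LBINT v. indicator {0..s} v * y v)" if st: "0 \<le> s" "s \<le> t" for s t
  proof -
    obtain J where J: "has_ito_integral M Fil W s H J" and ae: "AE \<omega> in M. N s \<omega> = J \<omega>" using N_ito[OF st(1)] by metis
    obtain J' where J': "has_ito_integral M Fil W t H J'" and ae': "AE \<omega> in M. N t \<omega> = J' \<omega>"
      using N_ito[of t] st by (metis order_trans)
    have [measurable]: "J \<in> borel_measurable M" "J' \<in> borel_measurable M" "N s \<in> borel_measurable M" "N t \<in> borel_measurable M"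
      using J J' N_measurable_at by (auto simp: has_ito_integral_def)
    have "expectation (\<lambda>\<omega>. N s \<omega> * N t \<omega>) = expectation (\<lambda>\<omega>. J \<omega> * J' \<omega>)"
      by (rule integral_cong_AE) (use ae ae' in auto)
    also have "\<dots> = (LBINT v. indicator {0..s} v * y v)"
      unfolding ito_covariance(4)[OF J J' st(2) Z_measurable H_eq_Z] by (rule square_Z_integrable(3)[OF st(1)])
    finally show ?thesis .
  qed
  have "(\<lambda>s. expectation (\<lambda>\<omega>. (Z s \<omega>)\<^sup>2)) \<in> borel_measurable borel"
    by (rule borel_measurable_lebesgue_integral) (use Z_measurable' in \<open>simp add: split_beta'\<close>)
  then show "y \<in> borel_measurable borel"
    unfolding y_def[abs_def] using causal_measurable[OF causal_heaviside] by measurable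
  show "0 \<le> y v" for v by (simp add: y_def heaviside_def)
  show "y v = 0" if "v < 0" for v using that by (simp add: y_def heaviside_def)
  show "integrable lborel (\<lambda>v. indicator {0..t} v * y v)" for t
    using square_Z_integrable(2)[of t] by (cases "0 \<le> t") auto
qed

section \<open>The renewal equation for the second moments and the decay of its data\<close>

definition k :: "real \<Rightarrow> real" where "k t = (G.Shift r0 t)\<^sup>2"

definition f :: "real \<Rightarrow> real" where "f t = heaviside t * (g t)\<^sup>2"

lemma k_causal: "causal k"
  unfolding k_def[abs_def] by (rule causal_power2[OF G.causal_Shift[OF r0_causal]])

lemma second_moment_X: "0 \<le> t \<Longrightarrow> expectation (\<lambda>\<omega>. \<bar>X t \<omega>\<bar>\<^sup>2) = (x t)\<^sup>2 + conv (\<lambda>s. (r0 s)\<^sup>2) y t"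
proof -
  assume t: "0 \<le> t"
  have "expectation (\<lambda>\<omega>. \<bar>X t \<omega>\<bar>\<^sup>2) = expectation (\<lambda>\<omega>. (x t + D t \<omega>)\<^sup>2)"
    by (intro Bochner_Integration.integral_cong refl) (use t in \<open>simp add: D_def heaviside_def\<close>)
  then show ?thesis using moments.second_moment_D[of "x t" t] by simp
qed

lemma f_causal: "causal f"
  unfolding f_def[abs_def]
proof (rule causalI)
  have [measurable]: "heaviside \<in> borel_measurable borel" "g \<in> borel_measurable borel"
    unfolding g_def by (rule causal_measurable[OF causal_heaviside], rule G.Shift_measurable[OF x0_measurable])
  show "(\<lambda>t. heaviside t * (g t)\<^sup>2) \<in> borel_measurable borel" by measurable
  fix T :: real
  obtain B where B: "B > 0" "\<And>v. v \<le> T \<Longrightarrow> \<bar>x0 v\<bar> \<le> B" using x0_bound by metis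
  have "\<bar>heaviside t * (g t)\<^sup>2\<bar> \<le> (G.Mass * B)\<^sup>2" if "0 \<le> t" "t \<le> T" for t
  proof -
    have "\<bar>g t\<bar> \<le> G.Mass * B" unfolding g_def
      by (rule G.Shift_bound[OF x0_measurable]) (use B that in auto)
    then have "\<bar>g t\<bar>\<^sup>2 \<le> (G.Mass * B)\<^sup>2" by (rule power_mono) simp
    then show ?thesis using that by (simp add: heaviside_def)
  qed
  then show "\<exists>B. \<forall>t. 0 \<le> t \<and> t \<le> T \<longrightarrow> \<bar>heaviside t * (g t)\<^sup>2\<bar> \<le> B" by blast
qed (simp add: heaviside_def)

text \<open>Second moment of G(x_t) + G(D_t). For t < 0 the convolution is computed by hand, since y
  is not yet known to be causal.\<close>

lemma y_eq: "y t = f t + conv k y t"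
proof (cases "t < 0")
  case True
  have "conv k y t = 0"
    unfolding conv_def using True moments.y_neg causal_neg[OF k_causal]
    by (intro integral_eq_zero_AE AE_I2) (metis diff_less_0_iff_less less_trans linorder_neqE_linordered_idom mult_eq_0_iff)
  then show ?thesis using True by (simp add: y_def f_def heaviside_def)
next
  case False
  have "expectation (\<lambda>\<omega>. (Z t \<omega>)\<^sup>2) = (g t)\<^sup>2 + conv (\<lambda>s. (G.Shift r0 s)\<^sup>2) y t"
    using moments.second_moment_GD(2)[of "g t" t] by (simp add: Z_def moments.GD_def)
  then show ?thesis using False by (simp add: y_def f_def heaviside_def k_def[abs_def])
qed

text \<open>
  A priori \<open>y\<close> is only known to be locally integrable; the renewal equation makes it locally bounded.
\<close>

lemma y_causal: "causal y"
proof (rule causalI)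
  fix T :: real assume "T \<ge> 0"
  obtain B where B: "B > 0" "\<And>v. v \<le> T \<Longrightarrow> \<bar>f v\<bar> \<le> B" using causal_bound[OF f_causal] by metis
  obtain C where C: "C > 0" "\<And>v. v \<le> T \<Longrightarrow> \<bar>k v\<bar> \<le> C" using causal_bound[OF k_causal] by metis
  have [measurable]: "k \<in> borel_measurable borel" by (rule causal_measurable[OF k_causal])
  note yi = moments.y_integrable[of T]
  have "\<bar>y t\<bar> \<le> B + C * (LBINT v. indicator {0..T} v * y v)" if "0 \<le> t" "t \<le> T" for t
  proof -
    have le: "\<bar>k (t - v) * y v\<bar> \<le> C * (indicator {0..T} v * y v)" for v
    proof (cases "v \<in> {0..t}")
      case True
      then have "\<bar>k (t - v)\<bar> \<le> C" using C(2)[of "t - v"] that by simp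
      then show ?thesis using True that moments.y_nonneg[of v] by (simp add: abs_mult mult_right_mono)
    next
      case False
      then have z: "k (t - v) * y v = 0" using causal_neg[OF k_causal, of "t - v"] moments.y_neg[of v] by force
      show ?thesis unfolding z using C moments.y_nonneg[of v] by simp
    qed
    have "integrable lborel (\<lambda>v. k (t - v) * y v)"
    proof (rule Bochner_Integration.integrable_bound[OF integrable_mult_right[OF yi, of C]])
      show "AE v in lborel. norm (k (t - v) * y v) \<le> norm (C * (indicator {0..T} v * y v))"
        using le C moments.y_nonneg by (intro AE_I2) (metis abs_ge_self order_trans real_norm_def)
    qed measurable
    then have "\<bar>conv k y t\<bar> \<le> (LBINT v. C * (indicator {0..T} v * y v))"
      unfolding conv_def
      by (intro Bochner_Integration.integral_abs_bound_integral integrable_mult_right[OF yi] le)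
    then show ?thesis using y_eq[of t] B(2)[OF that(2)] by simp
  qed
  then show "\<exists>B. \<forall>t. 0 \<le> t \<and> t \<le> T \<longrightarrow> \<bar>y t\<bar> \<le> B" by blast
qed (auto simp: moments.y_neg)

lemma square_exp_decay:
  fixes a A c t :: real
  assumes "\<bar>a\<bar> \<le> A * exp (- c * t)"
  shows "a\<^sup>2 \<le> A\<^sup>2 * exp (- (2 * c) * t)"
proof -
  have "\<bar>a\<bar>\<^sup>2 \<le> (A * exp (- c * t))\<^sup>2" using assms by (rule power_mono) simp
  also have "\<dots> = A\<^sup>2 * exp (- (2 * c) * t)"
    by (simp add: power_mult_distrib exp_double[symmetric] algebra_simps power2_eq_square exp_add[symmetric])
  finally show ?thesis by simp
qed

text \<open>x decays with \<open>window\<close>, by \<open>solution_le_window\<close>. G of a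
  decaying function decays at the same rate up to a factor exp(c \<alpha>), and squaring doubles the
  rate.\<close>

lemma renewal_data:
  assumes "integrable lborel (\<lambda>t. (r0 t)\<^sup>2)"
  obtains C c A where "renewal_trichotomy k f (\<lambda>t. (r0 t)\<^sup>2) y C c" "c > 0"
    "\<And>t. 0 \<le> t \<Longrightarrow> \<bar>(x t)\<^sup>2\<bar> \<le> A * exp (- c * t)"
proof -
  obtain C c where "c > 0" and rd: "\<And>t. \<bar>r0 t\<bar> \<le> C * exp (- c * t)"
    using E.r_exp_decay[OF E.r_tendsto_0[OF assms]] by metis
  have "0 \<le> C" using rd[of 0] by simp
  obtain B where B: "B > 0" "\<And>v. v \<le> 0 \<Longrightarrow> \<bar>x0 v\<bar> \<le> B" using x0_bound by metis
  have x0_cont: "continuous_on {0..} x0"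
    by (rule continuous_on_eq[OF continuous_on_subset[OF x_continuous]]) (use \<alpha>_nonneg in \<open>auto simp: x0_def\<close>)
  \<comment> \<open>The summand 1 covers negative times, where |x0| \<le> B and the exponential is
    at least 1; the other summand is the constant of \<open>window_exp_decay\<close>.\<close>
  define A where "A = B * (1 + C * (1 + F.Mass * \<alpha> * exp (c * \<alpha>)))"
  have K: "0 \<le> C * (1 + F.Mass * \<alpha> * exp (c * \<alpha>))" using \<open>0 \<le> C\<close> F.Mass_nonneg \<alpha>_nonneg by simp
  have xd: "\<bar>x0 v\<bar> \<le> A * exp (- c * v)" for v
  proof (cases "v < 0")
    case True
    then have "1 \<le> exp (- c * v)" using \<open>c > 0\<close> by (simp add: mult_pos_neg less_imp_le)
    moreover have "B * 1 \<le> A" unfolding A_def using K B by (intro mult_left_mono) auto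
    ultimately have "B * 1 \<le> A * exp (- c * v)" using B by (intro mult_mono) auto
    then show ?thesis using B(2)[of v] True by simp
  next
    case False
    then have "\<bar>x0 v\<bar> \<le> B * E.window v"
      by (intro E.solution_le_window x0_measurable x0_cont B(2) x0_eq) auto
    also have "\<dots> \<le> B * (C * (1 + F.Mass * \<alpha> * exp (c * \<alpha>)) * exp (- c * v))"
      using E.window_exp_decay[OF rd \<open>c > 0\<close>] B by (intro mult_left_mono) auto
    also have "\<dots> \<le> A * exp (- c * v)" using B unfolding A_def by (simp add: algebra_simps)
    finally show ?thesis .
  qed
  define Ck where "Ck = G.Mass * C * exp (c * \<alpha>)"
  define Cf where "Cf = G.Mass * A * exp (c * \<alpha>)"
  have kd: "k t \<le> Ck\<^sup>2 * exp (- (2 * c) * t)" for t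
  proof (cases "t < 0")
    case False
    then show ?thesis unfolding k_def Ck_def
      by (intro square_exp_decay G.Shift_exp_decay causal_measurable[OF r0_causal] rd) (use \<open>c > 0\<close> in auto)
  qed (use causal_neg[OF k_causal] in auto)
  have fd: "f t \<le> Cf\<^sup>2 * exp (- (2 * c) * t)" for t
  proof (cases "t < 0")
    case False
    then have "(g t)\<^sup>2 \<le> Cf\<^sup>2 * exp (- (2 * c) * t)" unfolding g_def Cf_def
      by (intro square_exp_decay G.Shift_exp_decay x0_measurable xd) (use \<open>c > 0\<close> in auto)
    then show ?thesis using False by (simp add: f_def heaviside_def)
  qed (use causal_neg[OF f_causal] in auto)
  have qd: "(r0 t)\<^sup>2 \<le> C\<^sup>2 * exp (- (2 * c) * t)" for t by (rule square_exp_decay[OF rd])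
  define C' where "C' = Ck\<^sup>2 + Cf\<^sup>2 + C\<^sup>2"
  have le: "a \<le> C' * exp (- (2 * c) * t)" if "a \<le> b * exp (- (2 * c) * t)" "b \<le> C'" for a b t
    using that by (meson exp_ge_zero mult_right_mono order_trans)
  have "renewal_trichotomy k f (\<lambda>t. (r0 t)\<^sup>2) y C' (2 * c)"
  proof
    show "causal k" "causal f" "causal (\<lambda>t. (r0 t)\<^sup>2)" "causal y"
      by (rule k_causal f_causal causal_power2[OF r0_causal] y_causal)+
    fix t
    show "k t \<le> C' * exp (- (2 * c) * t)" by (rule le[OF kd]) (simp add: C'_def)
    show "f t \<le> C' * exp (- (2 * c) * t)" by (rule le[OF fd]) (simp add: C'_def)
    show "(r0 t)\<^sup>2 \<le> C' * exp (- (2 * c) * t)" by (rule le[OF qd]) (simp add: C'_def)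
    show "0 \<le> k t" "0 \<le> f t" "0 \<le> y t" by (simp_all add: k_def f_def heaviside_def moments.y_nonneg)
    show "y t = f t + conv k y t" by (rule y_eq)
    show "(k \<longlongrightarrow> k t) (at_right t)"
      unfolding k_def[abs_def] by (intro tendsto_power G.Shift_right_continuous r0_causal E.r_continuous)
  qed (use \<open>c > 0\<close> in auto)
  moreover have "\<bar>(x t)\<^sup>2\<bar> \<le> A\<^sup>2 * exp (- (2 * c) * t)" if "0 \<le> t" for t
    using square_exp_decay[OF xd[of t]] that \<alpha>_nonneg by (simp add: x0_def)
  ultimately show ?thesis using that[of C' "2 * c" "A\<^sup>2"] \<open>c > 0\<close> by simp
qed

end

theorem theorem3p2:
  fixes M :: "'a measure"
    and Fil :: "real \<Rightarrow> 'a measure"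
    and W X :: "real \<Rightarrow> 'a \<Rightarrow> real"
    and \<alpha> :: real
    and \<mu> \<nu> :: signed_measure
    and \<phi> x r :: "real \<Rightarrow> real"
    and G :: "(real \<Rightarrow> real) \<Rightarrow> real"
    and normG :: real
  assumes "prob_space M" and "complete_measure M"
    and "usual_filtration M Fil"
    and "wiener_process M Fil W"
    and "\<alpha> \<ge> 0"
    and "signed_borel_measure_on {-\<alpha>..0} \<mu>" and "signed_borel_measure_on {-\<alpha>..0} \<nu>"
    and G_def: "G = signed_integral \<nu>"
    and "continuous_on {-\<alpha>..0} \<phi>"
    and "sdde_solution M Fil W \<alpha> \<mu> \<nu> \<phi> X"
    and "dde_solution \<alpha> \<mu> \<phi> x"
    and "fundamental_solution \<alpha> \<mu> r"
    and "set_integrable lborel {0..} (\<lambda>s. (r s)\<^sup>2)"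
    and normG_def: "normG = sqrt (LINT s:{0..}|lborel. (G (segment r s))\<^sup>2)"
  shows
    "(normG < 1 \<longrightarrow>
        (\<exists>\<kappa>>0. ((\<lambda>t. exp (\<kappa> * t) * prob_space.expectation M (\<lambda>\<omega>. \<bar>X t \<omega>\<bar>\<^sup>2)) \<longlongrightarrow> 0) at_top))
     \<and>
     (normG = 1 \<longrightarrow>
        set_integrable lborel {0..} (\<lambda>s. (G (segment x s))\<^sup>2) \<and>
        set_integrable lborel {0..} (\<lambda>s. s * (G (segment r s))\<^sup>2) \<and>
        (LINT s:{0..}|lborel. s * (G (segment r s))\<^sup>2) > 0 \<and>
        ((\<lambda>t. prob_space.expectation M (\<lambda>\<omega>. \<bar>X t \<omega>\<bar>\<^sup>2)) \<longlongrightarrow>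
           (LINT s:{0..}|lborel. (G (segment x s))\<^sup>2) * (LINT s:{0..}|lborel. (r s)\<^sup>2)
             / (LINT s:{0..}|lborel. s * (G (segment r s))\<^sup>2)) at_top)
     \<and>
     (normG > 1 \<longrightarrow>
        (\<exists>\<kappa>>0.
           set_integrable lborel {0..} (\<lambda>s. exp (- \<kappa> * s) * (G (segment x s))\<^sup>2) \<and>
           set_integrable lborel {0..} (\<lambda>s. exp (- \<kappa> * s) * (r s)\<^sup>2) \<and>
           set_integrable lborel {0..} (\<lambda>s. s * exp (- \<kappa> * s) * (G (segment r s))\<^sup>2) \<and>
           (LINT s:{0..}|lborel. s * exp (- \<kappa> * s) * (G (segment r s))\<^sup>2) > 0 \<and>
           ((\<lambda>t. exp (- \<kappa> * t) * prob_space.expectation M (\<lambda>\<omega>. \<bar>X t \<omega>\<bar>\<^sup>2)) \<longlongrightarrow>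
              (LINT s:{0..}|lborel. exp (- \<kappa> * s) * (G (segment x s))\<^sup>2)
                * (LINT s:{0..}|lborel. exp (- \<kappa> * s) * (r s)\<^sup>2)
                / (LINT s:{0..}|lborel. s * exp (- \<kappa> * s) * (G (segment r s))\<^sup>2)) at_top))"
proof -
  interpret prob_space M by fact
  interpret S: stochastic_delay_equation M Fil W X \<alpha> \<mu> \<nu> \<phi> x r
    by unfold_locales fact+
  let ?q = "\<lambda>s. (S.r0 s)\<^sup>2"
  \<comment> \<open>The free factor w lets one identity serve all weights in the statement: 1, s,
    exp(-\<kappa> s) and their product.\<close>
  have q: "indicator {0..} s *\<^sub>R (w * (r s)\<^sup>2) = w * ?q s" for s w
    by (simp add: S.r0_def heaviside_def indicator_def)
  have gr: "indicator {0..} s *\<^sub>R (w * (G (segment r s))\<^sup>2) = w * S.k s" for s w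
  proof (cases "s < 0")
    case False
    then have "G (segment r s) = S.G.Shift S.r0 s"
      unfolding G_def
      by (intro signed_integral_segment[OF assms(7,5)] causal_measurable[OF S.r0_causal] S.r0_eq_r) auto
    then show ?thesis using False by (simp add: S.k_def)
  qed (simp add: causal_neg[OF S.k_causal])
  have gx: "indicator {0..} s *\<^sub>R (w * (G (segment x s))\<^sup>2) = w * S.f s" for s w
    using S.signed_integral_x[OF assms(7), of s]
    by (cases "s < 0") (auto simp: G_def S.f_def S.g_def heaviside_def)
  have q1: "indicator {0..} s *\<^sub>R (r s)\<^sup>2 = ?q s" for s using q[of s 1] by simp
  have gr1: "indicator {0..} s *\<^sub>R (G (segment r s))\<^sup>2 = S.k s" for s using gr[of s 1] by simp
  have gx1: "indicator {0..} s *\<^sub>R (G (segment x s))\<^sup>2 = S.f s" for s using gx[of s 1] by simp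
  have "integrable lborel ?q"
    using assms(13) unfolding set_integrable_def q1 .
  then obtain C c A where "renewal_trichotomy S.k S.f ?q S.y C c" "c > 0"
    and A: "\<And>t. 0 \<le> t \<Longrightarrow> \<bar>(x t)\<^sup>2\<bar> \<le> A * exp (- c * t)"
    by (rule S.renewal_data) blast
  then interpret T: renewal_trichotomy S.k S.f ?q S.y C c by simp
  note sec = S.second_moment_X
  \<comment> \<open>The square root preserves comparison with 1, so the three cases are decided by
    the total mass of \<open>S.k\<close>.\<close>
  have normG: "normG = sqrt (LBINT s. S.k s)"
    unfolding normG_def set_lebesgue_integral_def gr1 ..
  \<comment> \<open>The moment formula holds for t \<ge> 0, which is enough for a limit at
    infinity.\<close>
  have transfer: "((\<lambda>t. w t * expectation (\<lambda>\<omega>. \<bar>X t \<omega>\<bar>\<^sup>2)) \<longlongrightarrow> l) at_top"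
    if "((\<lambda>t. w t * ((x t)\<^sup>2 + conv ?q S.y t)) \<longlongrightarrow> l) at_top" for w l
    by (rule Lim_transform_eventually[OF that], rule eventually_mono[OF eventually_ge_at_top[of 0]])
       (simp only: sec)
  show ?thesis
    unfolding set_integrable_def set_lebesgue_integral_def
  proof (intro conjI impI)
    assume "normG < 1"
    then have "(LBINT s. S.k s) < 1" by (simp add: normG)
    note ex = T.tendsto_of_total_less_one[OF this A \<open>c > 0\<close>]
    show "\<exists>\<kappa>>0. ((\<lambda>t. exp (\<kappa> * t) * expectation (\<lambda>\<omega>. \<bar>X t \<omega>\<bar>\<^sup>2)) \<longlongrightarrow> 0) at_top"
    proof (rule ex)
      fix \<kappa> assume \<kappa>: "\<kappa> > 0" "((\<lambda>t. exp (\<kappa> * t) * ((x t)\<^sup>2 + conv ?q S.y t)) \<longlongrightarrow> 0) at_top"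
      show ?thesis
        by (intro exI[of _ \<kappa>] conjI \<kappa>(1) transfer[OF \<kappa>(2)])
    qed
  next
    assume "normG = 1"
    then have "(LBINT s. S.k s) = 1" by (simp add: normG)
    note lim = T.tendsto_of_total_one[OF this A \<open>c > 0\<close>]
    show "integrable lborel (\<lambda>s. indicat_real {0..} s *\<^sub>R (G (segment x s))\<^sup>2)"
      unfolding gx1 by (rule T.integrable_decay[OF T.f])
    show "integrable lborel (\<lambda>s. indicat_real {0..} s *\<^sub>R (s * (G (segment r s))\<^sup>2))"
      unfolding gr by (rule lim(2))
    show "0 < (LBINT s. indicat_real {0..} s *\<^sub>R (s * (G (segment r s))\<^sup>2))"
      unfolding gr by (rule lim(3))
    show "((\<lambda>t. expectation (\<lambda>\<omega>. \<bar>X t \<omega>\<bar>\<^sup>2)) \<longlongrightarrow>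
        (LBINT s. indicat_real {0..} s *\<^sub>R (G (segment x s))\<^sup>2) * (LBINT s. indicat_real {0..} s *\<^sub>R (r s)\<^sup>2)
          / (LBINT s. indicat_real {0..} s *\<^sub>R (s * (G (segment r s))\<^sup>2))) at_top"
      unfolding gr gx1 q1 using transfer[of "\<lambda>_. 1"] lim(1) by simp
  next
    assume "normG > 1"
    then have "(LBINT s. S.k s) > 1" by (simp add: normG)
    note ex = T.tendsto_of_total_greater_one[OF this A \<open>c > 0\<close>]
    show "\<exists>\<kappa>>0.
       integrable lborel (\<lambda>s. indicat_real {0..} s *\<^sub>R (exp (- \<kappa> * s) * (G (segment x s))\<^sup>2)) \<and>
       integrable lborel (\<lambda>s. indicat_real {0..} s *\<^sub>R (exp (- \<kappa> * s) * (r s)\<^sup>2)) \<and>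
       integrable lborel (\<lambda>s. indicat_real {0..} s *\<^sub>R (s * exp (- \<kappa> * s) * (G (segment r s))\<^sup>2)) \<and>
       0 < (LBINT s. indicat_real {0..} s *\<^sub>R (s * exp (- \<kappa> * s) * (G (segment r s))\<^sup>2)) \<and>
       ((\<lambda>t. exp (- \<kappa> * t) * expectation (\<lambda>\<omega>. \<bar>X t \<omega>\<bar>\<^sup>2)) \<longlongrightarrow>
        (LBINT s. indicat_real {0..} s *\<^sub>R (exp (- \<kappa> * s) * (G (segment x s))\<^sup>2)) *
        (LBINT s. indicat_real {0..} s *\<^sub>R (exp (- \<kappa> * s) * (r s)\<^sup>2)) /
        (LBINT s. indicat_real {0..} s *\<^sub>R (s * exp (- \<kappa> * s) * (G (segment r s))\<^sup>2))) at_top"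
    proof (rule ex)
      fix \<kappa>
      assume \<kappa>: "\<kappa> > 0"
      "integrable lborel (\<lambda>s. exp (- \<kappa> * s) * S.f s)" "integrable lborel (\<lambda>s. exp (- \<kappa> * s) * ?q s)"
      "integrable lborel (\<lambda>s. s * (exp (- \<kappa> * s) * S.k s))" "0 < (LBINT s. s * (exp (- \<kappa> * s) * S.k s))"
      "((\<lambda>t. exp (- \<kappa> * t) * ((x t)\<^sup>2 + conv ?q S.y t)) \<longlongrightarrow>
        (LBINT s. exp (- \<kappa> * s) * S.f s) * (LBINT s. exp (- \<kappa> * s) * ?q s)
          / (LBINT s. s * (exp (- \<kappa> * s) * S.k s))) at_top"
      have e: "s * exp (- \<kappa> * s) * S.k s = s * (exp (- \<kappa> * s) * S.k s)" for s by (rule mult.assoc)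
      show ?thesis
        unfolding gr gx q by (intro exI[of _ \<kappa>] conjI, unfold e) (rule \<kappa> transfer[OF \<kappa>(6)])+
    qed
  qed
qed

end
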